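(* Let $b\in\mathbb{N}\setminus\{1\}$ and $X=\mathbb{R}^d$. For each linear flow $\phi$ on $X$ the following are equivalent: (i) The set $\sigma(\phi)$ is exponentially $b$-nonresonant; (ii) For every linear functional $H:\mathcal{L}(X)\to\mathbb{R}$, either the function $H(\phi_\bullet)$ is $b$-Benford, or $H(\phi_\bullet)=0$ (that is, $H(\phi_t)=0$ for all $t\in\mathbb{R}$).
   Context: Notation: $d$ is a positive integer, $\mathbb{N}$ is the set of positive integers, $\mathbb{R}^+=[0,\infty)$, $\lambda$ is Lebesgue measure on $\mathbb{R}^+$, $\log_b$ is the base-$b$ logarithm, and $\imath$ is the imaginary unit. $\mathcal{L}(X)$ is the space of all linear maps $A:X\to X$. Linear flows: a linear flow on $X=\mathbb{R}^d$ is a continuous map $\phi:\mathbb{R}\times X\to X$ with $\phi(0,x)=x$ and $\phi(s,\phi(t,x))=\phi(s+t,x)$ for all $x\in X$, $s,t\in\mathbb{R}$, such that each map $\phi_t:=\phi(t,\cdot)$ is linear. There is a unique $A_\phi\in\mathcal{L}(X)$ (the generator) with $\phi_t=e^{tA_\phi}$ for all $t\in\mathbb{R}$. The spectrum of $\phi$ is $\sigma(\phi):=\sigma(A_\phi)=\{z\in\mathbb{C}: z \text{ is an eigenvalue of } A_\phi\}$. $H(\phi_\bullet)$ denotes the function $t\mapsto H(\phi_t)$; when asking whether it is $b$-Benford it is regarded as a function on $\mathbb{R}^+$. Benford functions: for $x\in\mathbb{R}\setminus\{0\}$, $S_b(x)\in[1,b)$ is the unique number with $|x|=S_b(x)b^k$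 for some integer $k$; $S_b(0):=0$. A Borel measurable function $f:\mathbb{R}^+\to\mathbb{R}$ is $b$-Benford if $\lim_{T\to+\infty}\frac1T\lambda(\{t\le T: S_b(f(t))\le s\})=\log_b s$ for all $s\in[1,b)$. Nonresonance: for $z\in\mathbb{C}\setminus\{0\}$, $\arg z\in(-\pi,\pi]$ is defined by $z=|z|e^{\imath\arg z}$. For $\mathcal{Z}\subset\mathbb{C}$, $\mathrm{span}_{\mathbb{Q}}\mathcal{Z}$ is the smallest $\mathbb{Q}$-linear subspace of $\mathbb{C}$ containing $\mathcal{Z}$. Let $\mathbb{S}$ be the unit circle in $\mathbb{C}$. A non-empty set $\mathcal{Z}\subset r\mathbb{S}$, with $r>0$, is $b$-nonresonant if the set $\Delta_{\mathcal{Z}}:=\{1+\frac{\arg z-\arg w}{2\pi}: z,w\in\mathcal{Z}\}$ satisfies $\Delta_{\mathcal{Z}}\cap\mathbb{Q}=\{1\}$ and $\log_b r\notin\mathrm{span}_{\mathbb{Q}}\Delta_{\mathcal{Z}}$. An arbitrary set $\mathcal{Z}\subset\mathbb{C}$ is $b$-nonresonant if for every $r>0$ the set $\mathcal{Z}\cap r\mathbb{S}$ is either $b$-nonresonant or empty; otherwise it is $b$-resonant. A set $\mathcal{Z}\subset\mathbb{C}$ is exponentially $b$-nonresonant if $e^{t\mathcal{Z}}:=\{e^{tz}:z\in\mathcal{Z}\}$ is $b$-nonresonant for some $t\in\mathbb{R}^+$; otherwise it is exponentially $b$-resonant. *)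

theory Defs
  imports "HOL-Analysis.Analysis"
begin

section \<open>Linear flows, their generators and spectra\<close>

definition linear_flow :: "(real \<Rightarrow> real ^ 'n \<Rightarrow> real ^ 'n) \<Rightarrow> bool" where
  "linear_flow \<phi> \<longleftrightarrow>
     continuous_on UNIV (\<lambda>(t, x). \<phi> t x) \<and>
     (\<forall>x. \<phi> 0 x = x) \<and>
     (\<forall>s t x. \<phi> s (\<phi> t x) = \<phi> (s + t) x) \<and>
     (\<forall>t. linear (\<phi> t))"

text \<open>The space of all linear maps on \<open>X = real ^ 'n\<close> is rendered by the type
  \<open>X \<Rightarrow>\<^sub>L X\<close> of bounded linear maps: every linear map on a finite-dimensional space is
  bounded.  In particular \<open>Blinfun\<close> is applied below only to (bounded) linear maps.\<close>

definition flow_map :: "(real \<Rightarrow> real ^ 'n \<Rightarrow> real ^ 'n) \<Rightarrow> real \<Rightarrow> ((real ^ 'n) \<Rightarrow>\<^sub>L (real ^ 'n))" where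
  "flow_map \<phi> t = Blinfun (\<phi> t)"

text \<open>The library's \<open>exp\<close> requires a normed algebra class, which \<open>\<Rightarrow>\<^sub>L\<close> cannot instantiate, so
  the exponential series is written out; its powers are iterated compositions.\<close>

definition blinfun_exp :: "('a::banach \<Rightarrow>\<^sub>L 'a) \<Rightarrow> ('a \<Rightarrow>\<^sub>L 'a)" where
  "blinfun_exp A = (\<Sum>k. inverse (fact k) *\<^sub>R (((o\<^sub>L) A) ^^ k) id_blinfun)"

definition generator :: "(real \<Rightarrow> real ^ 'n \<Rightarrow> real ^ 'n) \<Rightarrow> ((real ^ 'n) \<Rightarrow>\<^sub>L (real ^ 'n))" where
  "generator \<phi> = (THE A. \<forall>t. flow_map \<phi> t = blinfun_exp (t *\<^sub>R A))"

text \<open>Eigenvalues are complex, so the matrix of the real operator is made to act on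
  \<open>complex ^ 'n\<close>.\<close>

definition spectrum :: "((real ^ 'n) \<Rightarrow>\<^sub>L (real ^ 'n)) \<Rightarrow> complex set" where
  "spectrum A = {z. \<exists>v :: complex ^ 'n. v \<noteq> 0 \<and>
     map_matrix complex_of_real (matrix (blinfun_apply A)) *v v = z *s v}"

definition flow_spectrum :: "(real \<Rightarrow> real ^ 'n \<Rightarrow> real ^ 'n) \<Rightarrow> complex set" where
  "flow_spectrum \<phi> = spectrum (generator \<phi>)"

section \<open>Benford functions\<close>

definition significand :: "nat \<Rightarrow> real \<Rightarrow> real" where
  "significand b x = (if x = 0 then 0
     else (THE s. s \<in> {1..<real b} \<and> (\<exists>k::int. \<bar>x\<bar> = s * real b powi k)))"

text \<open>The function lives on the half-line \<open>{0..}\<close>; its values at negative arguments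
  are irrelevant.\<close>

definition benford :: "nat \<Rightarrow> (real \<Rightarrow> real) \<Rightarrow> bool" where
  "benford b f \<longleftrightarrow>
     f \<in> borel_measurable (restrict_space borel {0..}) \<and>
     (\<forall>s\<in>{1..<real b}.
        ((\<lambda>T. measure lborel {t \<in> {0..T}. significand b (f t) \<le> s} / T)
           \<longlongrightarrow> log (real b) s) at_top)"

section \<open>Nonresonance\<close>

definition rat_span :: "complex set \<Rightarrow> complex set" where
  "rat_span = module.span (\<lambda>(q::rat) (z::complex). of_rat q * z)"

interpretation rat_complex: vector_space "\<lambda>(q::rat) (z::complex). of_rat q * z"
  by unfold_locales (simp_all add: algebra_simps of_rat_add of_rat_mult)

definition arg_diffs :: "complex set \<Rightarrow> real set" where
  "arg_diffs Z = {1 + (Arg z - Arg w) / (2 * pi) | z w. z \<in> Z \<and> w \<in> Z}"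

text \<open>Meant for \<open>r > 0\<close> and non-empty subsets \<open>Z\<close> of the circle of radius \<open>r\<close> about \<open>0\<close>.\<close>

definition circle_nonresonant :: "nat \<Rightarrow> real \<Rightarrow> complex set \<Rightarrow> bool" where
  "circle_nonresonant b r Z \<longleftrightarrow>
     arg_diffs Z \<inter> \<rat> = {1} \<and>
     complex_of_real (log (real b) r) \<notin> rat_span (complex_of_real ` arg_diffs Z)"

definition nonresonant :: "nat \<Rightarrow> complex set \<Rightarrow> bool" where
  "nonresonant b Z \<longleftrightarrow>
     (\<forall>r>0. Z \<inter> sphere 0 r = {} \<or> circle_nonresonant b r (Z \<inter> sphere 0 r))"

definition exponentially_nonresonant :: "nat \<Rightarrow> complex set \<Rightarrow> bool" where
  "exponentially_nonresonant b Z \<longleftrightarrow>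
     (\<exists>t\<ge>0. nonresonant b ((\<lambda>z. exp (complex_of_real t * z)) ` Z))"

end

theory Submission
  imports Defs "HOL-Probability.Probability"
    "HOL-Computational_Algebra.Fundamental_Theorem_Algebra"
begin

text \<open>
  Observables \<open>H (flow_map \<phi> t)\<close> are exponential polynomials whose exponents are eigenvalues of the
  generator, so the theorem compares the growth of such functions, measured by real parts, with
  their oscillation, measured by imaginary parts. Both sides are shown to be equivalent to
  \<open>growth_independent\<close>: no \<open>Re z / ln b\<close> is a rational combination of the differences \<open>(Im z' - Im w') / (2 \<pi>)\<close>
  of eigenvalues with this real part. For exponential nonresonance this is a matter of choosing a
  sampling time outside a countable set.

  Independence implies Benford (\<open>exp_poly_benford\<close>). By Weyl's criterion it suffices that
  \<open>\<bar>f\<bar> powr (2 \<pi> i n / ln b)\<close> has vanishing time average for \<open>n > 0\<close>. The dominant part of \<open>f\<close> is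
  \<open>t ^ k * exp (\<rho> t) * p t\<close> with an almost periodic sum \<open>p\<close>. Its modulus contributes the oscillation with
  frequency \<open>2 \<pi> n \<rho> / ln b\<close>, a slowly varying phase, and a function of \<open>\<bar>p\<bar>\<^sup>2\<close>. Since \<open>p\<close> is rarely small
  (\<open>trig_sum_small_values\<close>), the latter is in the mean a polynomial in \<open>\<bar>p\<bar>\<^sup>2\<close>, whose frequencies are sums of
  differences of frequencies of \<open>p\<close>. Independence keeps the product from having a constant term
  (\<open>mean_zero_log_phase\<close>). Polynomial approximation takes the place of equidistribution on a torus.

  If independence fails for some \<open>\<rho>\<close>, a multiple \<open>\<Omega> = 2 \<pi> N \<rho> / ln b\<close> is an integral combination of frequency
  differences. If nevertheless every \<open>exp (\<rho> t) * p t\<close> were Benford, all functions \<open>cis (\<Omega> t) * \<bar>p t\<bar> powr (i \<beta>)\<close>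
  with \<open>\<beta> = 2 \<pi> N / ln b\<close> would have mean zero. Giving \<open>p\<close> Gaussian coefficients and taking expectations
  turns \<open>\<bar>p t\<bar>\<close> into the root of a variance of the form \<open>1 + x (Q t)\<^sup>2\<close>; the factor that appears is a
  value of the Gamma function, hence not zero. Expansion in powers of \<open>x\<close> then contradicts the fact that
  some power of \<open>(Q t)\<^sup>2\<close> contains the frequency \<open>- \<Omega>\<close> with a positive coefficient
  (\<open>resonance_not_all_benford\<close>).

  On the side of linear algebra, the generator is obtained by integrating the flow, and the
  exponential polynomials come from a polynomial annihilating the generator whose roots are
  eigenvalues, by solving scalar equations \<open>g' = z g + h\<close>. Eigenvectors show conversely that every real
  combination of the exponentials \<open>exp (z t)\<close> is an observable.
\<close>

section \<open>Time averages of bounded Borel functions\<close>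

definition time_mean :: "(real \<Rightarrow> 'a::{banach,second_countable_topology}) \<Rightarrow> real \<Rightarrow> 'a" where
  "time_mean F T = (1 / T) *\<^sub>R (LINT t:{0..T}|lborel. F t)"

definition bdd_borel :: "(real \<Rightarrow> 'a::{banach,second_countable_topology}) \<Rightarrow> bool" where
  "bdd_borel F \<longleftrightarrow> F \<in> borel_measurable borel \<and> bounded (range F)"

definition mean_zero :: "(real \<Rightarrow> complex) \<Rightarrow> bool" where
  "mean_zero F \<longleftrightarrow> (time_mean F \<longlongrightarrow> 0) at_top"

lemma bdd_borelI:
  assumes "F \<in> borel_measurable borel" "\<And>t. norm (F t) \<le> B"
  shows "bdd_borel F"
  using assms unfolding bdd_borel_def bounded_iff by auto

lemma bdd_borel_measurable[measurable_dest]: "bdd_borel F \<Longrightarrow> F \<in> borel_measurable borel"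
  by (simp add: bdd_borel_def)

lemma bdd_borel_bound: "bdd_borel F \<Longrightarrow> \<exists>B\<ge>0. \<forall>t. norm (F t) \<le> B"
  unfolding bdd_borel_def bounded_iff by (metis norm_ge_zero order_trans rangeI)

lemma bdd_borel_const [simp]: "bdd_borel (\<lambda>t. c)"
  by (rule bdd_borelI[of _ "norm c"]) auto

lemma bdd_borel_add:
  assumes "bdd_borel F" "bdd_borel G" shows "bdd_borel (\<lambda>t. F t + G t)"
proof -
  obtain A B where "\<And>t. norm (F t) \<le> A" "\<And>t. norm (G t) \<le> B"
    using assms bdd_borel_bound by metis
  with assms show ?thesis
    by (intro bdd_borelI[of _ "A + B"]) (auto intro!: norm_triangle_le add_mono)
qed

lemma bdd_borel_mult:
  fixes F G :: "real \<Rightarrow> 'a::{banach,second_countable_topology,real_normed_algebra}"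
  assumes "bdd_borel F" "bdd_borel G" shows "bdd_borel (\<lambda>t. F t * G t)"
proof -
  obtain A B where "A \<ge> 0" "\<And>t. norm (F t) \<le> A" "\<And>t. norm (G t) \<le> B"
    using assms bdd_borel_bound by metis
  with assms show ?thesis
    by (intro bdd_borelI[of _ "A * B"]) (auto intro!: order_trans[OF norm_mult_ineq] mult_mono)
qed

lemma bdd_borel_diff:
  assumes "bdd_borel F" "bdd_borel G" shows "bdd_borel (\<lambda>t. F t - G t)"
proof -
  obtain A B where "\<And>t. norm (F t) \<le> A" "\<And>t. norm (G t) \<le> B"
    using assms bdd_borel_bound by metis
  with assms show ?thesis
    by (intro bdd_borelI[of _ "A + B"]) (auto intro!: norm_triangle_le_diff add_mono)
qed

lemma bdd_borel_norm: "bdd_borel F \<Longrightarrow> bdd_borel (\<lambda>t. norm (F t))"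
  using bdd_borel_bound[of F] by (auto intro!: bdd_borelI)

lemma bdd_borel_cnj: "bdd_borel F \<Longrightarrow> bdd_borel (\<lambda>t. cnj (F t))"
  using bdd_borel_bound[of F] by (auto intro!: bdd_borelI borel_measurable_continuous_on[of cnj] continuous_intros)

lemma bdd_borel_of_real: "bdd_borel F \<Longrightarrow> bdd_borel (\<lambda>t. complex_of_real (F t))"
  using bdd_borel_bound[of F] by (auto intro!: bdd_borelI)

lemma bdd_borel_sum:
  assumes "\<And>i. i \<in> I \<Longrightarrow> bdd_borel (F i)" shows "bdd_borel (\<lambda>t. \<Sum>i\<in>I. F i t)"
  using assms by (induction I rule: infinite_finite_induct) (auto intro: bdd_borel_add)

lemma bdd_borel_indicat: "A \<in> sets borel \<Longrightarrow> bdd_borel (indicat_real A)"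
  by (intro bdd_borelI[of _ 1]) (auto simp: indicator_def)

lemma borel_measurable_cis[measurable]: "cis \<in> borel_measurable borel"
  by (intro borel_measurable_continuous_onI continuous_intros)

lemma bdd_borel_cis: "f \<in> borel_measurable borel \<Longrightarrow> bdd_borel (\<lambda>t. cis (f t))"
  by (intro bdd_borelI[of _ 1]) auto

lemma bdd_borel_power:
  fixes F :: "real \<Rightarrow> 'a::{banach,second_countable_topology,real_normed_algebra_1}"
  assumes "bdd_borel F" shows "bdd_borel (\<lambda>t. F t ^ n)"
  by (induction n) (auto intro: bdd_borel_mult assms)

lemmas bdd_borel_intros = bdd_borel_const bdd_borel_add bdd_borel_mult bdd_borel_diff bdd_borel_norm
  bdd_borel_cnj bdd_borel_sum bdd_borel_power bdd_borel_of_real bdd_borel_indicat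

lemma set_integrable_bdd_borel:
  assumes "bdd_borel F" shows "set_integrable lborel {0..T} F"
proof -
  obtain B where B: "\<And>t. norm (F t) \<le> B" using bdd_borel_bound[OF assms] by blast
  have "integrable lborel (\<lambda>t. indicat_real {0..T} t *\<^sub>R F t)"
  proof (rule Bochner_Integration.integrable_bound[of _ "\<lambda>t. B * indicat_real {0..T} t"])
    show "integrable lborel (\<lambda>t. B * indicat_real {0..T} t)"
      by (intro integrable_mult_right integrable_real_indicator) (auto simp: emeasure_lborel_Icc_eq)
  qed (use assms B in \<open>auto simp: indicator_def intro!: AE_I2 order_trans[OF B] \<close>)
  then show ?thesis by (simp add: set_integrable_def)
qed

lemma time_mean_add:
  assumes "bdd_borel F" "bdd_borel G"
  shows "time_mean (\<lambda>t. F t + G t) T = time_mean F T + time_mean G T"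
  using set_integral_add(2)[OF set_integrable_bdd_borel[OF assms(1)] set_integrable_bdd_borel[OF assms(2)]]
  by (simp add: time_mean_def scaleR_add_right)

lemma time_mean_diff:
  assumes "bdd_borel F" "bdd_borel G"
  shows "time_mean (\<lambda>t. F t - G t) T = time_mean F T - time_mean G T"
  using set_integral_diff(2)[OF set_integrable_bdd_borel[OF assms(1)] set_integrable_bdd_borel[OF assms(2)]]
  by (simp add: time_mean_def scaleR_diff_right)

lemma time_mean_mult_left:
  fixes c :: "'a::{banach,second_countable_topology,real_normed_field}"
  shows "time_mean (\<lambda>t. c * F t) T = c * time_mean F T"
  by (simp add: time_mean_def)

lemma time_mean_zero[simp]: "time_mean (\<lambda>t. 0) T = 0"
  by (simp add: time_mean_def set_lebesgue_integral_def)

lemma time_mean_sum: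
  assumes "\<And>i. i \<in> I \<Longrightarrow> bdd_borel (F i)"
  shows "time_mean (\<lambda>t. \<Sum>i\<in>I. F i t) T = (\<Sum>i\<in>I. time_mean (F i) T)"
  using assms
  by (induction I rule: infinite_finite_induct) (auto simp: time_mean_add bdd_borel_sum)

lemma time_mean_const:
  assumes "T > 0" shows "time_mean (\<lambda>t. c) T = c"
  using assms by (simp add: time_mean_def set_lebesgue_integral_def)

lemma time_mean_norm_le:
  "T > 0 \<Longrightarrow> norm (time_mean F T) \<le> time_mean (\<lambda>t. norm (F t)) T"
  using integral_norm_bound[of lborel "\<lambda>t. indicat_real {0..T} t *\<^sub>R F t"]
  by (simp add: time_mean_def set_lebesgue_integral_def divide_right_mono)

lemma time_mean_mono:
  fixes F G :: "real \<Rightarrow> real"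
  assumes "bdd_borel F" "bdd_borel G" "T > 0" "\<And>t. t \<in> {0..T} \<Longrightarrow> F t \<le> G t"
  shows "time_mean F T \<le> time_mean G T"
  using set_integral_mono[OF set_integrable_bdd_borel[OF assms(1)] set_integrable_bdd_borel[OF assms(2)] assms(4)] assms(3)
  by (simp add: time_mean_def divide_right_mono)

lemma time_mean_norm_bound:
  assumes "bdd_borel F" "T > 0" "\<And>t. t \<in> {0..T} \<Longrightarrow> norm (F t) \<le> B"
  shows "norm (time_mean F T) \<le> B"
proof -
  have "norm (time_mean F T) \<le> time_mean (\<lambda>t. norm (F t)) T" by (rule time_mean_norm_le) fact
  also have "\<dots> \<le> time_mean (\<lambda>t. B) T"
    by (rule time_mean_mono) (use assms in \<open>auto intro: bdd_borel_intros\<close>)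
  finally show ?thesis using assms by (simp add: time_mean_const)
qed

lemma time_mean_indicat:
  assumes "A \<in> sets borel" shows "time_mean (indicat_real A) T = measure lborel (A \<inter> {0..T}) / T"
proof -
  have "(LINT t:{0..T}|lborel. indicat_real A t) = (LINT t|lborel. indicat_real (A \<inter> {0..T}) t)"
    unfolding set_lebesgue_integral_def by (intro Bochner_Integration.integral_cong) (auto simp: indicator_def)
  also have "\<dots> = measure lborel (A \<inter> {0..T})" using assms by simp
  finally show ?thesis by (simp add: time_mean_def)
qed

lemma time_mean_of_real: "time_mean (\<lambda>t. complex_of_real (F t)) T = of_real (time_mean F T)"
  by (simp add: time_mean_def set_integral_complex_of_real scaleR_conv_of_real)

lemma time_mean_cnj: "time_mean (\<lambda>t. cnj (F t)) T = cnj (time_mean F T)"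
proof -
  have "(LINT t:{0..T}|lborel. cnj (F t)) = cnj (LINT t:{0..T}|lborel. F t)"
    using Bochner_Integration.integral_cnj[of lborel "\<lambda>t. indicat_real {0..T} t *\<^sub>R F t"]
    by (simp add: set_lebesgue_integral_def scaleR_conv_of_real)
  then show ?thesis by (simp add: time_mean_def scaleR_conv_of_real)
qed

lemma mean_zero_add:
  assumes "bdd_borel F" "bdd_borel G" "mean_zero F" "mean_zero G"
  shows "mean_zero (\<lambda>t. F t + G t)"
proof -
  have "time_mean (\<lambda>t. F t + G t) = (\<lambda>T. time_mean F T + time_mean G T)"
    using time_mean_add[OF assms(1,2)] by blast
  then show ?thesis using tendsto_add[OF assms(3,4)[unfolded mean_zero_def]] by (simp add: mean_zero_def)
qed

lemma mean_zero_mult_left: "mean_zero F \<Longrightarrow> mean_zero (\<lambda>t. c * F t)"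
  unfolding mean_zero_def time_mean_mult_left[abs_def] by (rule tendsto_mult_right_zero)

text \<open>A head of fixed length does not influence the average, so a bound that holds for late times
  only is good enough.\<close>

lemma time_mean_eventually_le:
  fixes F G :: "real \<Rightarrow> real"
  assumes "bdd_borel F" "bdd_borel G" "\<forall>\<^sub>F t in at_top. F t \<le> G t" "\<eta> > 0"
  shows "\<forall>\<^sub>F T in at_top. time_mean F T \<le> time_mean G T + \<eta>"
proof -
  obtain T0 where T0: "\<And>t. t \<ge> T0 \<Longrightarrow> F t \<le> G t" using assms(3) by (auto simp: eventually_at_top_linorder)
  define S where "S = max T0 1"
  obtain B where B: "B \<ge> 0" "\<And>t. norm (F t) \<le> B" using bdd_borel_bound[OF assms(1)] by blast
  obtain C where C: "C \<ge> 0" "\<And>t. norm (G t) \<le> C" using bdd_borel_bound[OF assms(2)] by blast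
  show ?thesis
    using eventually_ge_at_top[of "(B + C) * S / \<eta>"] eventually_ge_at_top[of S]
  proof eventually_elim
    case (elim T)
    have T: "T > 0" using elim(2) by (simp add: S_def)
    have "time_mean F T \<le> time_mean (\<lambda>t. G t + (B + C) * indicat_real {0..S} t) T"
    proof (rule time_mean_mono)
      show "F t \<le> G t + (B + C) * indicat_real {0..S} t" if "t \<in> {0..T}" for t
        using that T0[of t] B(2)[of t] C(2)[of t] by (auto simp: indicator_def S_def abs_le_iff)
    qed (use assms T in \<open>auto intro!: bdd_borel_intros\<close>)
    also have "\<dots> = time_mean G T + (B + C) * time_mean (indicat_real {0..S}) T"
      using assms by (subst time_mean_add) (auto intro!: bdd_borel_intros simp: time_mean_mult_left)
    also have "time_mean (indicat_real {0..S}) T = S / T"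
      using elim(2) by (subst time_mean_indicat) (auto simp: S_def)
    also have "(B + C) * (S / T) \<le> \<eta>" using elim(1) T \<open>\<eta> > 0\<close> by (simp add: field_simps)
    finally show ?case by simp
  qed
qed

text \<open>The approximation principle behind the equidistribution statements below: at late times \<open>F\<close> has to
  be matched only outside a set \<open>E\<close> of small upper density, while on \<open>E\<close> a bound covering two functions of
  modulus about \<open>1\<close> is enough.\<close>

lemma mean_zero_approx:
  assumes F: "bdd_borel F"
    and approx: "\<And>\<eta>. \<eta> > 0 \<Longrightarrow> \<exists>G E. bdd_borel G \<and> mean_zero G \<and> E \<in> sets borel \<and>
      (\<forall>\<^sub>F t in at_top. norm (F t - G t) \<le> \<eta> + 2 * indicat_real E t) \<and>
      (\<forall>\<^sub>F T in at_top. measure lborel (E \<inter> {0..T}) / T \<le> \<eta>)"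
  shows "mean_zero F"
  unfolding mean_zero_def
proof (rule tendstoI)
  fix e :: real assume e: "e > 0"
  define \<eta> where "\<eta> = e / 6"
  have \<eta>: "\<eta> > 0" using e by (simp add: \<eta>_def)
  from approx[OF \<eta>] obtain G E where G: "bdd_borel G" "mean_zero G" and E: "E \<in> sets borel"
    and close: "\<forall>\<^sub>F t in at_top. norm (F t - G t) \<le> \<eta> + 2 * indicat_real E t"
    and small: "\<forall>\<^sub>F T in at_top. measure lborel (E \<inter> {0..T}) / T \<le> \<eta>" by blast
  have 1: "\<forall>\<^sub>F T in at_top. time_mean (\<lambda>t. norm (F t - G t)) T \<le> time_mean (\<lambda>t. \<eta> + 2 * indicat_real E t) T + \<eta>"
    by (rule time_mean_eventually_le) (use F G E \<eta> close in \<open>auto intro!: bdd_borel_intros\<close>)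
  have 2: "\<forall>\<^sub>F T in at_top. norm (time_mean G T) < \<eta>"
    using tendstoD[OF G(2)[unfolded mean_zero_def] \<eta>] by simp
  show "\<forall>\<^sub>F T in at_top. dist (time_mean F T) 0 < e"
    using 1 2 small eventually_gt_at_top[of 0]
  proof eventually_elim
    case (elim T)
    have "time_mean (\<lambda>t. \<eta> + 2 * indicat_real E t) T = \<eta> + 2 * (measure lborel (E \<inter> {0..T}) / T)"
      using E elim(4) by (subst time_mean_add) (auto intro!: bdd_borel_intros simp: time_mean_const time_mean_mult_left time_mean_indicat)
    moreover have "norm (time_mean F T - time_mean G T) \<le> time_mean (\<lambda>t. norm (F t - G t)) T"
      using time_mean_norm_le[OF elim(4), of "\<lambda>t. F t - G t"] F G by (simp add: time_mean_diff)
    moreover have "norm (time_mean F T) \<le> norm (time_mean F T - time_mean G T) + norm (time_mean G T)"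
      using norm_triangle_ineq[of "time_mean F T - time_mean G T" "time_mean G T"] by simp
    ultimately have "norm (time_mean F T) < \<eta> + 2 * \<eta> + \<eta> + \<eta>" using elim(1-3) by linarith
    then show ?case using e by (simp add: \<eta>_def)
  qed
qed

section \<open>Almost periodic sums\<close>

inductive trig_poly :: "real set \<Rightarrow> (real \<Rightarrow> complex) \<Rightarrow> bool" for \<Lambda> where
  cis: "\<nu> \<in> \<Lambda> \<Longrightarrow> trig_poly \<Lambda> (\<lambda>t. c * cis (\<nu> * t))"
| add: "trig_poly \<Lambda> F \<Longrightarrow> trig_poly \<Lambda> G \<Longrightarrow> trig_poly \<Lambda> (\<lambda>t. F t + G t)"

lemma trig_poly_mult_left: "trig_poly \<Lambda> F \<Longrightarrow> trig_poly \<Lambda> (\<lambda>t. c * F t)"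
proof (induction rule: trig_poly.induct)
  case (cis \<nu> d)
  then show ?case using trig_poly.cis[of \<nu> \<Lambda> "c * d"] by (simp add: mult.assoc)
next
  case (add F G)
  then show ?case by (simp add: distrib_left trig_poly.add)
qed

lemma trig_poly_mult_cis:
  assumes "\<And>\<mu> \<nu>. \<mu> \<in> \<Lambda> \<Longrightarrow> \<nu> \<in> \<Lambda> \<Longrightarrow> \<mu> + \<nu> \<in> \<Lambda>" "\<mu> \<in> \<Lambda>"
  shows "trig_poly \<Lambda> F \<Longrightarrow> trig_poly \<Lambda> (\<lambda>t. c * cis (\<mu> * t) * F t)"
proof (induction rule: trig_poly.induct)
  case (cis \<nu> d)
  have "(\<lambda>t. c * cis (\<mu> * t) * (d * cis (\<nu> * t))) = (\<lambda>t. c * d * cis ((\<mu> + \<nu>) * t))"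
    by (simp add: cis_mult[symmetric] ring_distribs mult_ac)
  then show ?case using trig_poly.cis[OF assms(1)[OF assms(2) cis], of "c * d"] by simp
next
  case (add F G)
  then show ?case by (simp add: distrib_left trig_poly.add)
qed

lemma trig_poly_mult:
  assumes "\<And>\<mu> \<nu>. \<mu> \<in> \<Lambda> \<Longrightarrow> \<nu> \<in> \<Lambda> \<Longrightarrow> \<mu> + \<nu> \<in> \<Lambda>" "trig_poly \<Lambda> G"
  shows "trig_poly \<Lambda> F \<Longrightarrow> trig_poly \<Lambda> (\<lambda>t. F t * G t)"
proof (induction rule: trig_poly.induct)
  case (cis \<nu> d)
  then show ?case by (intro trig_poly_mult_cis assms)
next
  case (add F G)
  then show ?case by (simp add: distrib_right trig_poly.add)
qed

lemma trig_poly_const: "0 \<in> \<Lambda> \<Longrightarrow> trig_poly \<Lambda> (\<lambda>t. c)"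
  using trig_poly.cis[of 0 \<Lambda> c] by simp

lemma trig_poly_sum:
  assumes "0 \<in> \<Lambda>" "\<And>i. i \<in> I \<Longrightarrow> trig_poly \<Lambda> (F i)"
  shows "trig_poly \<Lambda> (\<lambda>t. \<Sum>i\<in>I. F i t)"
  using assms(2)
  by (induction I rule: infinite_finite_induct) (auto intro: trig_poly_const trig_poly.add assms(1))

lemma trig_poly_power:
  assumes "0 \<in> \<Lambda>" "\<And>\<mu> \<nu>. \<mu> \<in> \<Lambda> \<Longrightarrow> \<nu> \<in> \<Lambda> \<Longrightarrow> \<mu> + \<nu> \<in> \<Lambda>" "trig_poly \<Lambda> F"
  shows "trig_poly \<Lambda> (\<lambda>t. F t ^ n)"
  by (induction n) (auto intro: trig_poly_const trig_poly_mult assms)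

lemma bdd_borel_trig_poly: "trig_poly \<Lambda> F \<Longrightarrow> bdd_borel F"
  by (induction rule: trig_poly.induct) (auto intro!: bdd_borel_intros bdd_borel_cis)

lemma has_vector_derivative_cis:
  assumes "(g has_real_derivative g') (at t within S)"
  shows "((\<lambda>t. cis (g t)) has_vector_derivative \<i> * of_real g' * cis (g t)) (at t within S)"
proof -
  have "(cis has_vector_derivative \<i> * cis x) (at x within X)" for x X
    unfolding cis_conv_exp
    by (auto intro!: derivative_eq_intros has_vector_derivative_real_field simp: field_simps)
  from vector_diff_chain_within[OF assms[unfolded has_real_derivative_iff_has_vector_derivative] this]
  show ?thesis by (simp add: o_def scaleR_conv_of_real mult_ac)
qed

text \<open>The slow phase \<open>t powr (i \<delta>)\<close> stems from a power of \<open>t\<close> in front of an exponential. On its own it has no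
  mean value, but it cannot undo the cancellation in a pure oscillation: integration by parts leaves
  an integral of order \<open>ln T\<close>.\<close>

lemma mean_zero_cis_slow_phase:
  assumes "\<kappa> \<noteq> 0"
  shows "mean_zero (\<lambda>t. cis (\<kappa> * t) * cis (\<delta> * ln t))"
proof -
  define F where "F t = cis (\<kappa> * t) * cis (\<delta> * ln t)" for t :: real
  define D where "D t = (\<delta> / \<kappa>) *\<^sub>R ((1 / t) *\<^sub>R F t)" for t :: real
  have bF: "bdd_borel F"
    unfolding F_def by (intro bdd_borel_intros bdd_borel_cis) measurable
  have nF: "norm (F t) = 1" for t by (simp add: F_def norm_mult)
  have bound: "norm (LINT t:{0..T}|lborel. F t) \<le> 1 + 2 / \<bar>\<kappa>\<bar> + \<bar>\<delta> / \<kappa>\<bar> * ln T" if T: "T \<ge> 1" for T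
  proof -
    have split: "(LINT t:{0..T}|lborel. F t) = (LINT t:{0..1}|lborel. F t) + (LINT t:{1<..T}|lborel. F t)"
    proof -
      have "{0..T} = {0..1} \<union> {1<..T}" using T by auto
      moreover have "set_integrable lborel {1<..T} F"
        by (rule set_integrable_subset[OF set_integrable_bdd_borel[OF bF, of T]]) auto
      ultimately show ?thesis
        using set_integral_Un[of "{0..1}" "{1<..T}" lborel F] set_integrable_bdd_borel[OF bF, of 1]
        by (metis disjoint_iff atLeastAtMost_iff greaterThanAtMost_iff not_le)
    qed
    have "norm (LINT t:{0..1}|lborel. F t) \<le> 1"
      using time_mean_norm_bound[OF bF, of 1 1] nF by (simp add: time_mean_def)
    moreover have "norm (LINT t:{1<..T}|lborel. F t) \<le> 2 / \<bar>\<kappa>\<bar> + \<bar>\<delta> / \<kappa>\<bar> * ln T"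
    proof -
      define P where "P t = - (\<i> / of_real \<kappa>) * F t" for t
      have der: "(P has_vector_derivative F t + D t) (at t within S)" if "t > 0" for t S
        unfolding P_def F_def D_def using that assms
        by (auto intro!: derivative_eq_intros has_vector_derivative_cis simp: field_simps scaleR_conv_of_real)
      have cF: "continuous_on {1..T} F" unfolding F_def by (intro continuous_intros) auto
      have cD: "continuous_on {1..T} D" unfolding D_def by (intro continuous_intros cF) auto
      have "(LINT t:{1<..T}|lborel. F t) = (LINT t:{1..T}|lborel. F t)"
        unfolding set_lebesgue_integral_def
        by (intro integral_cong_AE) (use bF AE_lborel_singleton[of 1] in \<open>auto simp: indicator_def elim!: eventually_mono\<close>)
      also have "\<dots> = (LINT t:{1..T}|lborel. F t + D t) - (LINT t:{1..T}|lborel. D t)"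
        by (subst set_integral_add(2)) (auto intro!: borel_integrable_atLeastAtMost' cF cD)
      also have "(LINT t:{1..T}|lborel. F t + D t) = P T - P 1"
        unfolding set_lebesgue_integral_def
        by (rule integral_FTC_atLeastAtMost) (use T der in \<open>auto intro!: continuous_intros cF cD\<close>)
      finally have eq: "(LINT t:{1<..T}|lborel. F t) = P T - P 1 - (LINT t:{1..T}|lborel. D t)" .
      have "norm (P T - P 1) \<le> 2 / \<bar>\<kappa>\<bar>"
        using norm_triangle_ineq4[of "P T" "P 1"] by (simp add: P_def norm_mult norm_divide nF)
      moreover have "norm (LINT t:{1..T}|lborel. D t) \<le> (LINT t:{1..T}|lborel. norm (D t))"
        using integral_norm_bound[of lborel "\<lambda>t. indicat_real {1..T} t *\<^sub>R D t"]
        by (simp add: set_lebesgue_integral_def)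
      moreover have "(LINT t:{1..T}|lborel. norm (D t)) = (LINT t:{1..T}|lborel. \<bar>\<delta> / \<kappa>\<bar> * (1 / t))"
        by (rule set_lebesgue_integral_cong) (auto simp: D_def nF abs_mult)
      moreover have "(LINT t:{1..T}|lborel. c * (1 / t)) = c * ln T - c * ln 1" for c
        unfolding set_lebesgue_integral_def
        by (rule integral_FTC_atLeastAtMost)
          (use T in \<open>auto intro!: derivative_eq_intros continuous_intros simp flip: has_real_derivative_iff_has_vector_derivative\<close>)
      ultimately show ?thesis
        using eq norm_triangle_ineq4[of "P T - P 1" "LINT t:{1..T}|lborel. D t"] by (simp only: ln_one)
    qed
    ultimately show ?thesis
      using norm_triangle_ineq[of "LINT t:{0..1}|lborel. F t" "LINT t:{1<..T}|lborel. F t"] by (simp add: split)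
  qed
  have "((\<lambda>T. (1 + 2 / \<bar>\<kappa>\<bar> + \<bar>\<delta> / \<kappa>\<bar> * ln T) / T) \<longlongrightarrow> 0) at_top" by real_asymp
  then have "(time_mean F \<longlongrightarrow> 0) at_top"
  proof (rule Lim_null_comparison[rotated])
    show "\<forall>\<^sub>F T in at_top. norm (time_mean F T) \<le> (1 + 2 / \<bar>\<kappa>\<bar> + \<bar>\<delta> / \<kappa>\<bar> * ln T) / T"
      using eventually_ge_at_top[of 1]
    proof eventually_elim
      case (elim T)
      then show ?case using bound[OF elim] by (simp add: time_mean_def divide_right_mono)
    qed
  qed
  then show ?thesis unfolding mean_zero_def F_def .
qed

lemma mean_zero_trig_poly_slow_phase:
  assumes "\<And>\<nu>. \<nu> \<in> \<Lambda> \<Longrightarrow> \<kappa> + \<nu> \<noteq> 0"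
  shows "trig_poly \<Lambda> F \<Longrightarrow> mean_zero (\<lambda>t. cis (\<kappa> * t) * cis (\<delta> * ln t) * F t)"
proof (induction rule: trig_poly.induct)
  case (cis \<nu> c)
  have "(\<lambda>t. cis (\<kappa> * t) * cis (\<delta> * ln t) * (c * cis (\<nu> * t))) = (\<lambda>t. c * (cis ((\<kappa> + \<nu>) * t) * cis (\<delta> * ln t)))"
    by (simp add: cis_mult[symmetric] ring_distribs mult_ac)
  then show ?case using mean_zero_mult_left[OF mean_zero_cis_slow_phase[OF assms[OF cis], of \<delta>], of c] by simp
next
  case (add F G)
  have "bdd_borel (\<lambda>t. cis (\<kappa> * t) * cis (\<delta> * ln t))"
    by (intro bdd_borel_intros bdd_borel_cis) measurable
  then show ?case
    using add by (auto simp: distrib_left intro!: mean_zero_add bdd_borel_mult dest: bdd_borel_trig_poly)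
qed

lemma time_mean_cis:
  "(time_mean (\<lambda>t. cis (\<nu> * t)) \<longlongrightarrow> (if \<nu> = 0 then 1 else 0)) at_top"
proof (cases "\<nu> = 0")
  case True
  have "\<forall>\<^sub>F T in at_top. time_mean (\<lambda>t. cis (\<nu> * t)) T = 1"
    using eventually_gt_at_top[of 0] by eventually_elim (simp add: True time_mean_const)
  then show ?thesis using True by (simp add: tendsto_eventually)
next
  case False
  then show ?thesis using mean_zero_cis_slow_phase[of \<nu> 0] by (simp add: mean_zero_def)
qed

lemma norm_cis_diff_le: "norm (cis x - cis y) \<le> \<bar>x - y\<bar>"
proof -
  have "cis x - cis y = cis y * (cis (x - y) - 1)" by (simp add: algebra_simps cis_mult)
  then have "norm (cis x - cis y) = dist (exp (\<i> * of_real (x - y))) 1"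
    by (simp add: norm_mult dist_norm cis_conv_exp)
  then show ?thesis
    using dist_exp_i_1[of "x - y"] abs_sin_x_le_abs_x[of "(x - y) / 2"] by (simp add: dist_norm)
qed

text \<open>While \<open>\<bar>D\<bar> \<ge> \<epsilon>\<close>, the curve \<open>G\<close> moves almost along a straight line at speed at least \<open>\<epsilon> / 2\<close>, so on a
  short interval it can visit the disc of radius \<open>\<delta>\<close> only during a time of order \<open>\<delta> / \<epsilon>\<close>.\<close>

lemma small_values_one_piece:
  fixes G D :: "real \<Rightarrow> complex"
  assumes der: "\<And>t. (G has_vector_derivative D t) (at t)"
    and lip: "\<And>s t. norm (D s - D t) \<le> B * \<bar>s - t\<bar>" and "B > 0" "\<epsilon> > 0" "L > 0" "L * B \<le> \<epsilon> / 2"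
    and s: "s \<in> {a..a+L}" "norm (G s) < \<delta>" "norm (D s) \<ge> \<epsilon>"
    and t: "t \<in> {a..a+L}" "norm (G t) < \<delta>"
  shows "\<bar>s - t\<bar> \<le> 4 * \<delta> / \<epsilon>"
proof -
  have st: "\<bar>x - s\<bar> \<le> L" if "x \<in> closed_segment s t" for x
    using that s(1) t(1) by (auto simp: closed_segment_eq_real_ivl split: if_splits)
  have "norm ((G t - t *\<^sub>R D s) - (G s - s *\<^sub>R D s)) \<le> (\<epsilon> / 2) * norm (t - s)"
  proof (rule differentiable_bound[of "closed_segment s t" "\<lambda>x. G x - x *\<^sub>R D s" "\<lambda>x h. h *\<^sub>R (D x - D s)"])
    fix x assume x: "x \<in> closed_segment s t"
    show "((\<lambda>x. G x - x *\<^sub>R D s) has_derivative (\<lambda>h. h *\<^sub>R (D x - D s))) (at x within closed_segment s t)"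
      using der[of x, THEN has_vector_derivative_at_within, of "closed_segment s t"]
      by (auto simp: has_vector_derivative_def scaleR_diff_right intro!: derivative_eq_intros)
    have "onorm (\<lambda>h. h *\<^sub>R (D x - D s)) \<le> norm (D x - D s)"
      by (rule onorm_le) (simp add: mult.commute)
    also have "\<dots> \<le> B * L" using order_trans[OF lip[of x s] mult_left_mono[OF st[OF x], of B]] \<open>B > 0\<close> by simp
    finally show "onorm (\<lambda>h. h *\<^sub>R (D x - D s)) \<le> \<epsilon> / 2" using \<open>L * B \<le> \<epsilon> / 2\<close> by (simp add: mult.commute)
  qed auto
  moreover have "(t - s) *\<^sub>R D s = (G t - G s) - ((G t - t *\<^sub>R D s) - (G s - s *\<^sub>R D s))"
    by (simp add: algebra_simps)
  then have "\<bar>t - s\<bar> * norm (D s) \<le> norm (G t - G s) + norm ((G t - t *\<^sub>R D s) - (G s - s *\<^sub>R D s))"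
    by (metis norm_scaleR norm_triangle_ineq4)
  moreover have "norm (G t - G s) \<le> norm (G t) + norm (G s)" by (rule norm_triangle_ineq4)
  moreover have "\<bar>t - s\<bar> * \<epsilon> \<le> \<bar>t - s\<bar> * norm (D s)" using s(3) by (intro mult_left_mono) auto
  ultimately have "\<bar>t - s\<bar> * \<epsilon> \<le> 2 * \<delta> + \<epsilon> / 2 * \<bar>t - s\<bar>" using s(2) t(2) by (simp add: real_norm_def)
  then have "\<bar>t - s\<bar> * \<epsilon> \<le> 4 * \<delta>" by (simp add: algebra_simps)
  then show ?thesis using \<open>\<epsilon> > 0\<close> by (simp add: field_simps abs_minus_commute)
qed

lemma measure_le_diameter:
  fixes A :: "real set"
  assumes "A \<in> sets borel" "\<And>s t. s \<in> A \<Longrightarrow> t \<in> A \<Longrightarrow> \<bar>s - t\<bar> \<le> d" "d \<ge> 0"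
  shows "measure lborel A \<le> 2 * d"
proof (cases "A = {}")
  case False
  then obtain s where s: "s \<in> A" by blast
  have "A \<subseteq> {s - d..s + d}" using assms(2)[OF s] by (force simp: abs_le_iff)
  then have "measure lborel A \<le> measure lborel {s - d..s + d}"
    using assms(1) by (intro measure_mono_fmeasurable) (auto simp: fmeasurable_def emeasure_lborel_Icc_eq)
  then show ?thesis using \<open>d \<ge> 0\<close> by simp
qed (use assms in auto)

lemma measure_lborel_mono:
  assumes "A \<subseteq> B" "A \<in> sets borel" "B \<in> sets borel" "B \<subseteq> {a..b::real}"
  shows "measure lborel A \<le> measure lborel B"
proof -
  have "{a..b} \<in> fmeasurable lborel" by (simp add: fmeasurable_def emeasure_lborel_Icc_eq)
  then have "B \<in> fmeasurable lborel" by (rule fmeasurableI2) (use assms(3,4) in simp_all)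
  then show ?thesis by (rule measure_mono_fmeasurable[rotated 2]) (use assms(1,2) in simp_all)
qed

lemma Icc_grid_cover:
  fixes a :: real and n :: nat
  assumes "n > 0" "t \<in> {a..a+1}"
  shows "\<exists>j\<le>n. t \<in> {a + j / n..a + j / n + 1 / n}"
proof -
  define j where "j = nat \<lfloor>(t - a) * n\<rfloor>"
  have "real j = of_int \<lfloor>(t - a) * n\<rfloor>" using assms by (simp add: j_def)
  then have "real j \<le> (t - a) * n" "(t - a) * n < real j + 1" by linarith+
  moreover have "(t - a) * n \<le> 1 * real n" using assms by (intro mult_right_mono) auto
  ultimately have "real j \<le> n" "j / n \<le> t - a" "t - a \<le> (real j + 1) / n"
    using assms(1) by (linarith, simp_all add: pos_divide_le_eq pos_le_divide_eq)
  then have "j \<le> n" "a + j / n \<le> t" "t \<le> a + j / n + 1 / n"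
    unfolding add_divide_distrib by linarith+
  then show ?thesis by (intro exI[of _ j]) simp
qed

text \<open>A sum of exponentials is rarely small, uniformly in the position of the unit interval. Dividing
  by one of its exponentials leaves the modulus unchanged and turns that term into a constant, so
  the derivative \<open>D\<close> of the quotient \<open>G\<close> has one frequency less. By induction \<open>D\<close> is small only on a small set,
  and elsewhere \<open>G\<close> leaves the neighbourhood of \<open>0\<close> quickly.\<close>

lemma trig_sum_small_values:
  fixes c :: "real \<Rightarrow> complex"
  assumes "finite W" "W \<noteq> {}" "\<And>\<omega>. \<omega> \<in> W \<Longrightarrow> c \<omega> \<noteq> 0" "\<eta> > 0"
  shows "\<exists>\<epsilon>>0. \<forall>a. measure lborel {t \<in> {a..a+1}. norm (\<Sum>\<omega>\<in>W. c \<omega> * cis (\<omega> * t)) < \<epsilon>} \<le> \<eta>"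
  using assms
proof (induction W arbitrary: c \<eta> rule: finite_ne_induct)
  case (singleton \<omega>)
  then show ?case by (intro exI[of _ "norm (c \<omega>)"]) (auto simp: norm_mult)
next
  case (insert \<omega>\<^sub>0 W)
  define d where "d \<omega> = c \<omega> * (\<i> * of_real (\<omega> - \<omega>\<^sub>0))" for \<omega>
  define G where "G t = c \<omega>\<^sub>0 + (\<Sum>\<omega>\<in>W. c \<omega> * cis ((\<omega> - \<omega>\<^sub>0) * t))" for t
  define D where "D t = (\<Sum>\<omega>\<in>W. d \<omega> * cis ((\<omega> - \<omega>\<^sub>0) * t))" for t
  define p where "p t = (\<Sum>\<omega>\<in>insert \<omega>\<^sub>0 W. c \<omega> * cis (\<omega> * t))" for t
  have shift: "cis (\<omega> * t) = cis (\<omega>\<^sub>0 * t) * cis ((\<omega> - \<omega>\<^sub>0) * t)" for \<omega> t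
    by (simp add: cis_mult algebra_simps)
  have "p t = cis (\<omega>\<^sub>0 * t) * G t" for t
  proof -
    have "(\<Sum>\<omega>\<in>W. c \<omega> * cis (\<omega> * t)) = (\<Sum>\<omega>\<in>W. cis (\<omega>\<^sub>0 * t) * (c \<omega> * cis ((\<omega> - \<omega>\<^sub>0) * t)))"
      by (intro sum.cong refl, subst shift) (simp only: mult_ac)
    then show ?thesis
      using insert.hyps by (simp add: p_def G_def sum_distrib_left[symmetric] distrib_left mult.commute)
  qed
  then have pG: "norm (p t) = norm (G t)" for t by (simp add: norm_mult)
  have Dq: "norm (D t) = norm (\<Sum>\<omega>\<in>W. d \<omega> * cis (\<omega> * t))" for t
  proof -
    have "(\<Sum>\<omega>\<in>W. d \<omega> * cis (\<omega> * t)) = cis (\<omega>\<^sub>0 * t) * D t"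
      unfolding D_def sum_distrib_left by (intro sum.cong refl, subst shift) (simp only: mult_ac)
    then show ?thesis by (simp add: norm_mult)
  qed
  have der: "(G has_vector_derivative D t) (at t)" for t
    unfolding G_def D_def d_def
    by (auto intro!: derivative_eq_intros has_vector_derivative_cis sum.cong simp: mult_ac)
  define B where "B = 1 + (\<Sum>\<omega>\<in>W. norm (d \<omega>) * \<bar>\<omega> - \<omega>\<^sub>0\<bar>)"
  have B: "B > 0" unfolding B_def by (auto intro!: add_pos_nonneg sum_nonneg)
  have lip: "norm (D s - D t) \<le> B * \<bar>s - t\<bar>" for s t
  proof -
    have "norm (D s - D t) \<le> (\<Sum>\<omega>\<in>W. norm (d \<omega>) * \<bar>\<omega> - \<omega>\<^sub>0\<bar> * \<bar>s - t\<bar>)"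
      unfolding D_def sum_subtractf[symmetric] right_diff_distrib[symmetric]
    proof (rule sum_norm_le)
      fix \<omega>
      have "norm (cis ((\<omega> - \<omega>\<^sub>0) * s) - cis ((\<omega> - \<omega>\<^sub>0) * t)) \<le> \<bar>\<omega> - \<omega>\<^sub>0\<bar> * \<bar>s - t\<bar>"
        using norm_cis_diff_le[of "(\<omega> - \<omega>\<^sub>0) * s" "(\<omega> - \<omega>\<^sub>0) * t"] by (simp flip: right_diff_distrib add: abs_mult)
      then show "norm (d \<omega> * (cis ((\<omega> - \<omega>\<^sub>0) * s) - cis ((\<omega> - \<omega>\<^sub>0) * t))) \<le> norm (d \<omega>) * \<bar>\<omega> - \<omega>\<^sub>0\<bar> * \<bar>s - t\<bar>"
        by (simp add: norm_mult mult.assoc mult_left_mono)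
    qed
    also have "\<dots> \<le> B * \<bar>s - t\<bar>" by (simp add: B_def sum_distrib_right distrib_right)
    finally show ?thesis .
  qed
  have "\<exists>\<epsilon>>0. \<forall>a. measure lborel {t \<in> {a..a+1}. norm (\<Sum>\<omega>\<in>W. d \<omega> * cis (\<omega> * t)) < \<epsilon>} \<le> \<eta> / 2"
    by (rule insert.IH) (use insert.prems insert.hyps in \<open>auto simp: d_def\<close>)
  then obtain \<epsilon> where \<epsilon>: "\<epsilon> > 0" "\<And>a. measure lborel {t \<in> {a..a+1}. norm (D t) < \<epsilon>} \<le> \<eta> / 2"
    unfolding Dq by blast
  \<comment> \<open>pieces of length \<open>1 / n\<close>, on which \<open>D\<close> varies by at most \<open>\<epsilon> / 2\<close>\<close>
  obtain n :: nat where n: "2 * B / \<epsilon> < n" using reals_Archimedean2 by blast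
  have n0: "n > 0" using n B \<epsilon>(1) by (cases n) (auto simp: field_simps)
  have nB: "1 / n * B \<le> \<epsilon> / 2" using n n0 \<epsilon>(1) by (simp add: field_simps)
  define \<delta> where "\<delta> = \<eta> * \<epsilon> / (16 * (n + 1))"
  have \<delta>: "\<delta> > 0" using \<open>\<eta> > 0\<close> \<epsilon> by (simp add: \<delta>_def)
  have [measurable]: "G \<in> borel_measurable borel" "D \<in> borel_measurable borel"
    unfolding G_def D_def by measurable
  show ?case
  proof (intro exI[of _ \<delta>] conjI allI)
    fix a :: real
    define A where "A j = {t \<in> {a + j / n..a + j / n + 1 / n}. norm (G t) < \<delta> \<and> norm (D t) \<ge> \<epsilon>}" for j :: nat
    define C where "C = {t \<in> {a..a+1}. norm (D t) < \<epsilon>}"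
    have mA: "measure lborel (A j) \<le> 2 * (4 * \<delta> / \<epsilon>)" for j
    proof (rule measure_le_diameter)
      show "\<bar>s - t\<bar> \<le> 4 * \<delta> / \<epsilon>" if "s \<in> A j" "t \<in> A j" for s t
        using that small_values_one_piece[OF der lip B \<epsilon>(1) _ nB, of s "a + j / n" \<delta> t] n0 by (auto simp: A_def)
    qed (use \<delta> \<epsilon> in \<open>auto simp: A_def\<close>)
    have "measure lborel {t \<in> {a..a+1}. norm (G t) < \<delta>} \<le> measure lborel ((\<Union>j\<le>n. A j) \<union> C)"
    proof (rule measure_lborel_mono)
      show "{t \<in> {a..a+1}. norm (G t) < \<delta>} \<subseteq> (\<Union>j\<le>n. A j) \<union> C"
        using Icc_grid_cover[OF n0, of _ a] by (fastforce simp: A_def C_def not_less)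
      have "A j \<subseteq> {a..a+2}" if "j \<le> n" for j
      proof -
        have le: "j / n \<le> 1" "1 / real n \<le> 1" "real j / real n \<ge> 0" using that n0 by auto
        show ?thesis
        proof
          fix t assume "t \<in> A j"
          then have "a + j / n \<le> t" "t \<le> a + j / n + 1 / n" by (simp_all add: A_def)
          then have "a \<le> t" "t \<le> a + 2" using le by linarith+
          then show "t \<in> {a..a+2}" by simp
        qed
      qed
      then show "(\<Union>j\<le>n. A j) \<union> C \<subseteq> {a..a+2}" by (auto simp: C_def)
    qed (auto simp: A_def C_def)
    moreover have "measure lborel ((\<Union>j\<le>n. A j) \<union> C) \<le> measure lborel (\<Union>j\<le>n. A j) + measure lborel C"
      by (rule measure_Un_le) (auto simp: A_def C_def)
    moreover have "measure lborel (\<Union>j\<le>n. A j) \<le> (\<Sum>j\<le>n. measure lborel (A j))"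
      by (rule measure_UNION_le) (auto simp: A_def)
    moreover have "(\<Sum>j\<le>n. measure lborel (A j)) \<le> (\<Sum>j\<le>n. 2 * (4 * \<delta> / \<epsilon>))" by (intro sum_mono mA)
    moreover have "(\<Sum>j\<le>n. 2 * (4 * \<delta> / \<epsilon>)) = \<eta> / 2"
    proof -
      have "m * (2 * (4 * (\<eta> * \<epsilon> / (16 * m)) / \<epsilon>)) = \<eta> / 2" if "m > 0" for m
        using that \<epsilon>(1) by (simp add: field_simps)
      from this[of "real (n + 1)"] show ?thesis unfolding \<delta>_def by (simp add: add.commute)
    qed
    moreover have "measure lborel C \<le> \<eta> / 2" using \<epsilon>(2)[of a] by (simp only: C_def)
    ultimately have "measure lborel {t \<in> {a..a+1}. norm (G t) < \<delta>} \<le> \<eta>" by linarith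
    then show "measure lborel {t \<in> {a..a+1}. norm (\<Sum>\<omega>\<in>insert \<omega>\<^sub>0 W. c \<omega> * cis (\<omega> * t)) < \<delta>} \<le> \<eta>"
      by (simp only: pG[symmetric] p_def)
  qed (rule \<delta>)
qed

lemma unit_intervals_imp_density:
  assumes A: "A \<in> sets borel" and unit: "\<And>a. measure lborel (A \<inter> {a..a+1::real}) \<le> \<eta>" and "\<eta> > 0"
  shows "\<forall>\<^sub>F T in at_top. measure lborel (A \<inter> {0..T}) / T \<le> 2 * \<eta>"
  using eventually_ge_at_top[of 1]
proof eventually_elim
  case (elim T)
  define n where "n = nat \<lfloor>T\<rfloor>"
  have "real n = of_int \<lfloor>T\<rfloor>" using elim by (simp add: n_def)
  then have n: "real n \<le> T" "T \<le> real n + 1" by linarith+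
  have "A \<inter> {0..T} \<subseteq> (\<Union>j\<le>n. A \<inter> {real j..real j + 1})"
  proof
    fix t assume t: "t \<in> A \<inter> {0..T}"
    then have "nat \<lfloor>t\<rfloor> \<le> n" unfolding n_def by (intro nat_mono floor_mono) auto
    moreover have "real (nat \<lfloor>t\<rfloor>) = of_int \<lfloor>t\<rfloor>" using t by simp
    then have "real (nat \<lfloor>t\<rfloor>) \<le> t" "t \<le> real (nat \<lfloor>t\<rfloor>) + 1" by linarith+
    ultimately show "t \<in> (\<Union>j\<le>n. A \<inter> {real j..real j + 1})" using t by auto
  qed
  then have "measure lborel (A \<inter> {0..T}) \<le> measure lborel (\<Union>j\<le>n. A \<inter> {real j..real j + 1})"
    by (rule measure_lborel_mono[of _ _ 0 "real n + 1"]) (use A in auto)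
  also have "\<dots> \<le> (\<Sum>j\<le>n. measure lborel (A \<inter> {real j..real j + 1}))"
    by (rule measure_UNION_le) (use A in auto)
  also have "\<dots> \<le> (\<Sum>j\<le>n. \<eta>)" by (intro sum_mono unit)
  also have "\<dots> = (real n + 1) * \<eta>" by (simp add: algebra_simps)
  also have "\<dots> \<le> (2 * T) * \<eta>" using n elim \<open>\<eta> > 0\<close> by (intro mult_right_mono) linarith+
  finally show ?case using elim by (simp add: field_simps)
qed

section \<open>Weyl's criterion on the circle\<close>

lemma real_polynomial_on_circle:
  fixes P :: "complex \<Rightarrow> real"
  assumes "real_polynomial_function P"
  shows "\<exists>C N. \<forall>z. norm z = 1 \<longrightarrow> of_real (P z) = poly C z * cnj z ^ N"
  using assms
proof (induction rule: real_polynomial_function.induct)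
  case (linear f)
  define a b where "a = complex_of_real (f 1)" and "b = complex_of_real (f \<i>)"
  show ?case
  proof (intro exI allI impI)
    fix z :: complex assume z: "norm z = 1"
    have zz: "z * cnj z = 1" using z by (simp flip: complex_norm_square)
    have "f z = f (Re z *\<^sub>R 1 + Im z *\<^sub>R \<i>)"
      by (rule arg_cong[of _ _ f]) (simp add: complex_eq_iff)
    also have "\<dots> = Re z * f 1 + Im z * f \<i>"
      using linear by (simp add: bounded_linear.linear linear_add linear_scale)
    finally have "complex_of_real (f z) = (a + \<i> * b) / 2 * cnj z + (a - \<i> * b) / 2 * z"
      by (simp add: a_def b_def complex_eq_iff field_simps)
    also have "\<dots> = (a + \<i> * b) / 2 * cnj z + (a - \<i> * b) / 2 * (z * (z * cnj z))"
      by (simp add: zz)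
    finally show "complex_of_real (f z) = poly [:(a + \<i> * b) / 2, 0, (a - \<i> * b) / 2:] z * cnj z ^ 1"
      by (simp add: algebra_simps add_divide_distrib)
  qed
next
  case (const c)
  show ?case by (intro exI[of _ "[:of_real c:]"] exI[of _ 0]) simp
next
  case (add f g)
  then obtain C N D M where "\<And>z. norm z = 1 \<Longrightarrow> complex_of_real (f z) = poly C z * cnj z ^ N"
    "\<And>z. norm z = 1 \<Longrightarrow> complex_of_real (g z) = poly D z * cnj z ^ M" by blast
  moreover have "z ^ n * cnj z ^ n = 1" if "norm z = 1" for z n
    using that by (simp flip: power_mult_distrib complex_norm_square)
  ultimately show ?case
    by (intro exI[of _ "monom 1 M * C + monom 1 N * D"] exI[of _ "N + M"])
      (auto simp: poly_monom power_add algebra_simps)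
next
  case (mult f g)
  then obtain C N D M where "\<And>z. norm z = 1 \<Longrightarrow> complex_of_real (f z) = poly C z * cnj z ^ N"
    "\<And>z. norm z = 1 \<Longrightarrow> complex_of_real (g z) = poly D z * cnj z ^ M" by blast
  then show ?case
    by (intro exI[of _ "C * D"] exI[of _ "N + M"]) (auto simp: power_add)
qed

lemma time_mean_Laurent:
  assumes v: "bdd_borel v" "\<And>t. norm (v t) = 1"
  shows "time_mean (\<lambda>t. poly C (v t) * cnj (v t) ^ N) T =
    (\<Sum>i\<le>degree C. coeff C i * (if i \<ge> N then time_mean (\<lambda>t. v t ^ (i - N)) T
       else cnj (time_mean (\<lambda>t. v t ^ (N - i)) T)))"
proof -
  have red: "v t ^ i * cnj (v t) ^ N = (if i \<ge> N then v t ^ (i - N) else cnj (v t ^ (N - i)))" for t i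
  proof -
    have one: "v t ^ n * cnj (v t) ^ n = 1" for n
      using v(2)[of t] by (simp flip: power_mult_distrib complex_norm_square)
    show ?thesis
    proof (cases "i \<ge> N")
      case True
      then have "v t ^ i = v t ^ (i - N) * v t ^ N" by (simp flip: power_add)
      then show ?thesis using True one[of N] by (simp add: mult.assoc)
    next
      case False
      then have "cnj (v t) ^ N = cnj (v t) ^ i * cnj (v t) ^ (N - i)" by (simp flip: power_add)
      then show ?thesis using False one[of i] by (simp add: mult.assoc[symmetric])
    qed
  qed
  have "(\<lambda>t. poly C (v t) * cnj (v t) ^ N) = (\<lambda>t. \<Sum>i\<le>degree C. coeff C i * (v t ^ i * cnj (v t) ^ N))"
    by (simp add: poly_altdef sum_distrib_right mult.assoc)
  then have "time_mean (\<lambda>t. poly C (v t) * cnj (v t) ^ N) T =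
      (\<Sum>i\<le>degree C. coeff C i * time_mean (\<lambda>t. v t ^ i * cnj (v t) ^ N) T)"
    by (simp only: time_mean_sum) (subst time_mean_sum, auto intro!: bdd_borel_intros v simp: time_mean_mult_left)
  also have "\<dots> = (\<Sum>i\<le>degree C. coeff C i * (if i \<ge> N then time_mean (\<lambda>t. v t ^ (i - N)) T
       else cnj (time_mean (\<lambda>t. v t ^ (N - i)) T)))"
    unfolding red by (intro sum.cong refl) (simp add: time_mean_cnj flip: complex_cnj_power)
  finally show ?thesis .
qed

lemma time_mean_full_rotation:
  assumes "n > 0" shows "time_mean (\<lambda>t. cis (2 * pi * t) ^ n) 1 = 0"
proof -
  define k where "k = 2 * pi * real n"
  have k: "k \<noteq> 0" using assms by (simp add: k_def)
  have "(LINT t:{0..1}|lborel. cis (k * t)) = - \<i> / k * cis (k * 1) - (- \<i> / k * cis (k * 0))"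
    unfolding set_lebesgue_integral_def
    by (rule integral_FTC_atLeastAtMost)
      (use k in \<open>auto intro!: derivative_eq_intros has_vector_derivative_cis continuous_intros\<close>)
  also have "cis (k * 1) = 1" using cis_multiple_2pi[of "real n"] by (simp add: k_def)
  finally have "(LINT t:{0..1}|lborel. cis (k * t)) = 0" by simp
  moreover have "cis (2 * pi * t) ^ n = cis (k * t)" for t
    unfolding Complex.DeMoivre k_def by (simp only: mult_ac)
  ultimately show ?thesis by (simp add: time_mean_def)
qed

text \<open>On the circle a real polynomial is a Laurent polynomial in \<open>z\<close>. Its mean along \<open>v\<close> and its mean over
  one full rotation both only see the constant coefficient.\<close>

lemma time_mean_real_polynomial_circle:
  assumes v: "bdd_borel v" "\<And>t. norm (v t) = 1" "\<And>n. n > 0 \<Longrightarrow> mean_zero (\<lambda>t. v t ^ n)"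
    and P: "real_polynomial_function P"
  shows "(time_mean (\<lambda>t. P (v t)) \<longlongrightarrow> time_mean (\<lambda>x. P (cis (2 * pi * x))) 1) at_top"
proof -
  obtain C N where C: "\<And>z. norm z = 1 \<Longrightarrow> complex_of_real (P z) = poly C z * cnj z ^ N"
    using real_polynomial_on_circle[OF P] by blast
  define S where "S m = (\<Sum>i\<le>degree C. coeff C i * (if i \<ge> N then m (i - N) else cnj (m (N - i))))"
    for m :: "nat \<Rightarrow> complex"
  have eq: "complex_of_real (time_mean (\<lambda>t. P (w t)) T) = S (\<lambda>n. time_mean (\<lambda>t. w t ^ n) T)"
    if "bdd_borel w" "\<And>t. norm (w t) = 1" for w T
    using time_mean_Laurent[OF that, of C N T] C[OF that(2)]
    by (simp add: S_def flip: time_mean_of_real)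
  have m: "((\<lambda>T. time_mean (\<lambda>t. v t ^ n) T) \<longlongrightarrow> time_mean (\<lambda>x. cis (2 * pi * x) ^ n) 1) at_top" for n
  proof (cases "n = 0")
    case True
    have "\<forall>\<^sub>F T in at_top. time_mean (\<lambda>t. 1 :: complex) T = 1"
      using eventually_gt_at_top[of 0] by eventually_elim (simp add: time_mean_const)
    then show ?thesis using True by (simp add: tendsto_eventually time_mean_const)
  next
    case False
    then show ?thesis using v(3)[of n] time_mean_full_rotation[of n] by (simp add: mean_zero_def)
  qed
  have "((\<lambda>T. S (\<lambda>n. time_mean (\<lambda>t. v t ^ n) T)) \<longlongrightarrow> S (\<lambda>n. time_mean (\<lambda>x. cis (2 * pi * x) ^ n) 1)) at_top"
    unfolding S_def by (intro tendsto_sum tendsto_mult tendsto_const) (auto intro!: tendsto_cnj m)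
  then have "((\<lambda>T. complex_of_real (time_mean (\<lambda>t. P (v t)) T)) \<longlongrightarrow>
      complex_of_real (time_mean (\<lambda>x. P (cis (2 * pi * x))) 1)) at_top"
    using eq[OF v(1,2)] eq[of "\<lambda>x. cis (2 * pi * x)" 1] by (simp add: bdd_borel_cis)
  then show ?thesis by (simp only: tendsto_of_real_iff)
qed

text \<open>The half of Weyl's criterion that concerns closed sets: asymptotically they receive at most their
  share of time. It holds because the indicator of \<open>K\<close> is the decreasing limit of continuous
  functions, which polynomials approximate uniformly. Applied to two complementary arcs it yields
  the exact asymptotic share of each.\<close>

lemma Weyl_closed_upper_bound:
  assumes v: "bdd_borel v" "\<And>t. norm (v t) = 1" "\<And>n. n > 0 \<Longrightarrow> mean_zero (\<lambda>t. v t ^ n)"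
    and K: "closed K" and "\<eta> > 0"
  shows "\<forall>\<^sub>F T in at_top. measure lborel ({t. v t \<in> K} \<inter> {0..T}) / T
    \<le> measure lborel ({x. cis (2 * pi * x) \<in> K} \<inter> {0..1}) + \<eta>"
proof (cases "K = {}")
  case True
  then show ?thesis using \<open>\<eta> > 0\<close> by simp
next
  case False
  define e where "e x = cis (2 * pi * x)" for x
  define g where "g n z = max 0 (1 - real n * infdist z K)" for n z
  have contg: "continuous_on S (g n)" for n S unfolding g_def by (intro continuous_intros)
  have g01: "0 \<le> g n z" "g n z \<le> 1" for n z unfolding g_def using infdist_nonneg[of z K] by auto
  have gK: "indicat_real K z \<le> g n z" for n z
    by (auto simp: g_def indicator_def)
  have [measurable]: "v \<in> borel_measurable borel" using v by measurable
  have [measurable]: "e \<in> borel_measurable borel" unfolding e_def by measurable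
  have [measurable]: "g n \<in> borel_measurable borel" for n by (intro borel_measurable_continuous_onI contg)
  have [measurable]: "K \<in> sets borel" using K by simp
  have bdd: "bdd_borel (\<lambda>t. g n (w t))" if "w \<in> borel_measurable borel" for n w
    using that g01 by (intro bdd_borelI[of _ 1]) auto
  have g_lim: "(\<lambda>n. g n z) \<longlonglongrightarrow> indicat_real K z" for z
  proof (cases "z \<in> K")
    case True
    then show ?thesis by (simp add: g_def)
  next
    case z: False
    then have "infdist z K > 0" using K False by (simp add: infdist_pos_not_in_closed)
    then obtain m :: nat where m: "1 < real m * infdist z K" using reals_Archimedean3 by blast
    have "g n z = 0" if "n \<ge> m" for n
      using mult_right_mono[of m n "infdist z K"] that m infdist_nonneg[of z K] by (simp add: g_def)
    then have "\<forall>\<^sub>F n in sequentially. g n z = 0" using eventually_sequentially by auto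
    then show ?thesis using z by (simp add: tendsto_eventually)
  qed
  have "(\<lambda>n. LINT x|lborel. indicat_real {0..1} x *\<^sub>R g n (e x)) \<longlonglongrightarrow>
      (LINT x|lborel. indicat_real {0..1} x *\<^sub>R indicat_real K (e x))"
  proof (rule integral_dominated_convergence[where w = "indicat_real {0..1}"])
    show "AE x in lborel. (\<lambda>n. indicat_real {0..1} x *\<^sub>R g n (e x)) \<longlonglongrightarrow> indicat_real {0..1} x *\<^sub>R indicat_real K (e x)"
      by (intro AE_I2 tendsto_scaleR tendsto_const g_lim)
  qed (use g01 in \<open>auto simp: indicator_def\<close>)
  then have "(\<lambda>n. time_mean (\<lambda>x. g n (e x)) 1) \<longlonglongrightarrow> time_mean (\<lambda>x. indicat_real K (e x)) 1"
    by (simp add: time_mean_def set_lebesgue_integral_def)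
  moreover have "time_mean (\<lambda>x. indicat_real K (e x)) 1 = measure lborel ({x. e x \<in> K} \<inter> {0..1})"
  proof -
    have "{x. e x \<in> K} \<in> sets borel" by measurable
    from time_mean_indicat[OF this, of 1] show ?thesis by (simp add: indicator_def[abs_def])
  qed
  ultimately have "\<forall>\<^sub>F n in sequentially. time_mean (\<lambda>x. g n (e x)) 1 < measure lborel ({x. e x \<in> K} \<inter> {0..1}) + \<eta> / 4"
    using \<open>\<eta> > 0\<close> by (intro order_tendstoD) auto
  then obtain n where n: "time_mean (\<lambda>x. g n (e x)) 1 < measure lborel ({x. e x \<in> K} \<inter> {0..1}) + \<eta> / 4"
    by (auto simp: eventually_sequentially)
  obtain P where P: "real_polynomial_function P" "\<And>z. z \<in> sphere 0 1 \<Longrightarrow> \<bar>g n z - P z\<bar> < \<eta> / 4"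
    using Stone_Weierstrass_real_polynomial_function[of "sphere 0 1 :: complex set" "g n" "\<eta> / 4"]
      contg \<open>\<eta> > 0\<close> by auto
  have Pc: "\<bar>g n z - P z\<bar> < \<eta> / 4" if "norm z = 1" for z using P(2)[of z] that by simp
  have contP: "P \<in> borel_measurable borel"
    using P(1) by (intro borel_measurable_continuous_onI) (simp add: continuous_on_polymonial_function real_polynomial_function_eq)
  have Pbound: "\<bar>P z\<bar> \<le> 1 + \<eta> / 4" if "norm z = 1" for z
    using Pc[OF that] g01[of n z] by linarith
  have bddP: "bdd_borel (\<lambda>t. P (w t))" if "w \<in> borel_measurable borel" "\<And>t. norm (w t) = 1" for w
    using Pbound that contP by (intro bdd_borelI[of _ "1 + \<eta> / 4"] measurable_compose[OF _ contP]) auto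
  have "time_mean (\<lambda>x. P (e x)) 1 \<le> time_mean (\<lambda>x. g n (e x) + \<eta> / 4) 1"
  proof (rule time_mean_mono)
    show "P (e x) \<le> g n (e x) + \<eta> / 4" for x
    proof -
      have "norm (e x) = 1" by (simp add: e_def)
      from Pc[OF this] show ?thesis by linarith
    qed
  qed (auto intro!: bdd_borel_add bdd bddP simp: e_def)
  also have "\<dots> = time_mean (\<lambda>x. g n (e x)) 1 + \<eta> / 4"
    by (subst time_mean_add) (auto intro!: bdd simp: time_mean_const)
  finally have Pe: "time_mean (\<lambda>x. P (e x)) 1 < measure lborel ({x. e x \<in> K} \<inter> {0..1}) + \<eta> / 2"
    using n by simp
  have "(time_mean (\<lambda>t. P (v t)) \<longlongrightarrow> time_mean (\<lambda>x. P (e x)) 1) at_top"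
    unfolding e_def by (rule time_mean_real_polynomial_circle) (use v P in auto)
  then have "\<forall>\<^sub>F T in at_top. time_mean (\<lambda>t. P (v t)) T < measure lborel ({x. e x \<in> K} \<inter> {0..1}) + \<eta> / 2"
    using Pe by (rule order_tendstoD)
  then show ?thesis
    using eventually_gt_at_top[of 0] unfolding e_def[symmetric]
  proof eventually_elim
    case (elim T)
    have "measure lborel ({t. v t \<in> K} \<inter> {0..T}) / T = time_mean (indicat_real {t. v t \<in> K}) T"
      by (rule time_mean_indicat [symmetric]) measurable
    also have "\<dots> \<le> time_mean (\<lambda>t. P (v t) + \<eta> / 4) T"
    proof (rule time_mean_mono)
      show "indicat_real {t. v t \<in> K} t \<le> P (v t) + \<eta> / 4" for t
        using gK[of "v t" n] Pc[OF v(2), of t] unfolding indicator_def mem_Collect_eq by linarith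
    qed (use elim v in \<open>auto intro!: bdd_borel_add bddP bdd_borel_indicat\<close>)
    also have "\<dots> = time_mean (\<lambda>t. P (v t)) T + \<eta> / 4"
      using elim v by (subst time_mean_add) (auto intro!: bddP simp: time_mean_const)
    finally show ?case using elim \<open>\<eta> > 0\<close> by linarith
  qed
qed

section \<open>Significands and Benford functions\<close>

lemma significand_eq_powr_frac:
  assumes b: "b \<ge> 2" and "x \<noteq> 0"
  shows "significand b x = real b powr frac (log b \<bar>x\<bar>)"
proof -
  have pw: "real b powi k = real b powr real_of_int k" for k
    using b by (simp add: powr_real_of_int')
  have "(THE s. s \<in> {1..<real b} \<and> (\<exists>k::int. \<bar>x\<bar> = s * real b powi k)) = real b powr frac (log b \<bar>x\<bar>)"
  proof (rule the_equality)
    have "\<bar>x\<bar> = real b powr (log b \<bar>x\<bar>)" using b \<open>x \<noteq> 0\<close> by simp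
    also have "log b \<bar>x\<bar> = frac (log b \<bar>x\<bar>) + real_of_int \<lfloor>log b \<bar>x\<bar>\<rfloor>" by (simp add: frac_def)
    also have "real b powr \<dots> = real b powr frac (log b \<bar>x\<bar>) * real b powi \<lfloor>log b \<bar>x\<bar>\<rfloor>"
      unfolding pw by (rule powr_add)
    finally have "\<exists>k::int. \<bar>x\<bar> = real b powr frac (log b \<bar>x\<bar>) * real b powi k" by blast
    moreover have "real b powr frac (log b \<bar>x\<bar>) < real b powr 1"
      using b frac_lt_1[of "log b \<bar>x\<bar>"] by (intro powr_less_mono) auto
    moreover have "real b powr frac (log b \<bar>x\<bar>) \<ge> 1" using b by (intro ge_one_powr_ge_zero) auto
    ultimately show "real b powr frac (log b \<bar>x\<bar>) \<in> {1..<real b} \<and>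
        (\<exists>k::int. \<bar>x\<bar> = real b powr frac (log b \<bar>x\<bar>) * real b powi k)" using b by simp
  next
    fix s assume s: "s \<in> {1..<real b} \<and> (\<exists>k::int. \<bar>x\<bar> = s * real b powi k)"
    then obtain k :: int where k: "\<bar>x\<bar> = s * real b powr real_of_int k" unfolding pw by blast
    have "log b \<bar>x\<bar> = log b s + real_of_int k" unfolding k using s b by (subst log_mult) auto
    moreover have "0 \<le> log b s" "log b s < 1" using s b by auto
    ultimately have "frac (log b \<bar>x\<bar>) = log b s" by (simp add: frac_unique_iff)
    then show "s = real b powr frac (log b \<bar>x\<bar>)" using s b by simp
  qed
  then show ?thesis using \<open>x \<noteq> 0\<close> by (simp add: significand_def)
qed

lemma significand_le_iff:
  assumes "b \<ge> 2" "s \<ge> 1"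
  shows "significand b x \<le> s \<longleftrightarrow> x = 0 \<or> frac (log b \<bar>x\<bar>) \<le> log b s"
proof (cases "x = 0")
  case True
  then show ?thesis using assms by (simp add: significand_def)
next
  case False
  then show ?thesis using assms by (simp add: significand_eq_powr_frac powr_le_iff)
qed

lemma sets_significand_le:
  assumes "b \<ge> 2" "s \<ge> 1" "f \<in> borel_measurable borel"
  shows "{t. significand b (f t) \<le> s} \<in> sets borel"
  using assms(3) unfolding significand_le_iff[OF assms(1,2)] frac_def by measurable

lemma cis_log_eq_frac:
  fixes b :: nat
  assumes "b \<ge> 2"
  shows "cis (2 * pi * real n / ln b * ln x) = cis (2 * pi * (real n * frac (log b x)))"
proof -
  have "2 * pi * real n / ln b * ln x = 2 * pi * (real n * frac (log b x)) + 2 * pi * (real n * of_int \<lfloor>log b x\<rfloor>)"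
    by (simp add: log_def frac_def algebra_simps add_divide_distrib)
  moreover have "cis (2 * pi * (real n * of_int \<lfloor>log b x\<rfloor>)) = 1"
    by (rule cis_multiple_2pi) auto
  ultimately show ?thesis by (simp flip: cis_mult)
qed

lemma cis_2pi_inj: "cis (2 * pi * x) = cis (2 * pi * y) \<Longrightarrow> x \<in> {0<..<1} \<Longrightarrow> y \<in> {0..1} \<Longrightarrow> x = y"
proof -
  assume xy: "cis (2 * pi * x) = cis (2 * pi * y)" "x \<in> {0<..<1}" "y \<in> {0..1}"
  then have "cis (2 * pi * (x - y)) = 1" by (simp add: right_diff_distrib cis_divide[symmetric])
  then have "exp (2 * of_real pi * \<i> * of_real (x - y)) = 1" by (simp add: cis_conv_exp mult_ac)
  then obtain k :: int where "Im (2 * of_real pi * \<i> * of_real (x - y)) = of_int (2 * k) * pi"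
    unfolding exp_eq_1 by blast
  then have "x - y = of_int k" by simp
  moreover have "-1 < x - y" "x - y < 1" using xy by auto
  ultimately have "k = 0" by linarith
  then show "x = y" using \<open>x - y = of_int k\<close> by simp
qed

text \<open>The significand is a function of the point \<open>v = \<bar>f\<bar> powr (2 \<pi> i / ln b)\<close> of the circle, and the powers of \<open>v\<close>
  are the functions in the hypothesis. Since \<open>ln 0 = 0\<close>, zeros of \<open>f\<close> are sent to \<open>1\<close>, the image of
  significand \<open>1\<close>, in accordance with their significand \<open>0\<close> lying below every threshold.\<close>

lemma Weyl_imp_benford:
  assumes b: "b \<ge> 2" and f: "f \<in> borel_measurable borel"
    and mz: "\<And>n. n > 0 \<Longrightarrow> mean_zero (\<lambda>t. cis (2 * pi * real n / ln b * ln \<bar>f t\<bar>))"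
  shows "benford b f"
  unfolding benford_def
proof (intro conjI ballI)
  show "f \<in> borel_measurable (restrict_space borel {0..})" using f by (rule measurable_restrict_space1)
next
  fix s assume s: "s \<in> {1..<real b}"
  define c where "c = log b s"
  have c: "0 \<le> c" "c < 1" using s b by (auto simp: c_def)
  define e where "e x = cis (2 * pi * x)" for x
  define L where "L t = frac (log b \<bar>f t\<bar>)" for t
  define v where "v t = e (L t)" for t
  have log_zero: "log b 0 = 0" by (simp add: log_def)
  have L: "0 \<le> L t" "L t < 1" for t by (auto simp: L_def frac_lt_1)
  have [measurable]: "L \<in> borel_measurable borel" using f unfolding L_def frac_def by measurable
  have v: "bdd_borel v" unfolding v_def e_def by (intro bdd_borel_cis) measurable
  have v1: "norm (v t) = 1" for t by (simp add: v_def e_def)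
  have vmz: "mean_zero (\<lambda>t. v t ^ n)" if "n > 0" for n
  proof -
    have "v t ^ n = cis (2 * pi * real n / ln b * ln \<bar>f t\<bar>)" for t
      unfolding v_def e_def L_def cis_log_eq_frac[OF b] Complex.DeMoivre by (simp only: mult_ac)
    then show ?thesis using mz[OF that] by simp
  qed
  define S where "S = {t. significand b (f t) \<le> s}"
  have S: "S \<in> sets borel" unfolding S_def using b s f by (intro sets_significand_le) auto
  have S_iff: "t \<in> S \<longleftrightarrow> f t = 0 \<or> L t \<le> c" for t
    using significand_le_iff[of b s "f t"] b s by (simp add: S_def L_def c_def)
  have comp: "compact (e ` {x..y})" for x y
    unfolding e_def by (intro compact_continuous_image continuous_intros) auto
  have [measurable]: "e \<in> borel_measurable borel" unfolding e_def by measurable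
  have arc [measurable]: "e ` {x..y} \<in> sets borel" for x y
    using comp[of x y] by (intro borel_closed compact_imp_closed)
  have arc_density: "\<forall>\<^sub>F T in at_top. measure lborel ({t. v t \<in> e ` {x..y}} \<inter> {0..T}) / T \<le> y - x + \<eta>"
    if "\<eta> > 0" "0 \<le> x" "x \<le> y" "y \<le> 1" for x y \<eta>
  proof -
    have "\<forall>\<^sub>F T in at_top. measure lborel ({t. v t \<in> e ` {x..y}} \<inter> {0..T}) / T
        \<le> measure lborel ({z. e z \<in> e ` {x..y}} \<inter> {0..1}) + \<eta>"
      unfolding e_def
      by (rule Weyl_closed_upper_bound[OF v v1 vmz _ that(1)])
        (use comp[of x y] in \<open>auto simp: e_def compact_imp_closed\<close>)
    moreover have "measure lborel ({z. e z \<in> e ` {x..y}} \<inter> {0..1}) \<le> y - x"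
    proof -
      have "{z. e z \<in> e ` {x..y}} \<inter> {0..1} \<subseteq> {x..y} \<union> {0, 1}"
        using cis_2pi_inj that by (fastforce simp: e_def)
      moreover have "{z. e z \<in> e ` {x..y}} \<inter> {0..1} \<in> sets borel" by measurable
      ultimately have "measure lborel ({z. e z \<in> e ` {x..y}} \<inter> {0..1}) \<le> measure lborel ({x..y} \<union> {0, 1})"
        by (intro measure_lborel_mono[of _ _ 0 1]) (use that in auto)
      also have "\<dots> \<le> measure lborel {x..y} + measure lborel {0, 1 :: real}"
        by (rule measure_Un_le) auto
      also have "measure lborel {0, 1 :: real} = 0"
        by (intro measure_eq_0_null_sets countable_imp_null_set_lborel) simp
      finally show ?thesis using that by simp
    qed
    ultimately show ?thesis by (auto elim!: eventually_mono)
  qed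
  have sets_arc: "{t. v t \<in> e ` {x..y}} \<inter> {0..T} \<in> sets borel" for x y T
    using v by measurable
  have upper: "\<forall>\<^sub>F T in at_top. measure lborel (S \<inter> {0..T}) / T \<le> c + \<eta>" if "\<eta> > 0" for \<eta>
    using arc_density[OF that order_refl c(1) less_imp_le[OF c(2)]] eventually_gt_at_top[of 0]
  proof eventually_elim
    case (elim T)
    have "S \<inter> {0..T} \<subseteq> {t. v t \<in> e ` {0..c}} \<inter> {0..T}"
    proof
      fix t assume t: "t \<in> S \<inter> {0..T}"
      then have "L t \<in> {0..c}" using S_iff[of t] L[of t] c log_zero by (auto simp: L_def)
      then show "t \<in> {t. v t \<in> e ` {0..c}} \<inter> {0..T}" using t by (auto simp: v_def)
    qed
    then have "measure lborel (S \<inter> {0..T}) \<le> measure lborel ({t. v t \<in> e ` {0..c}} \<inter> {0..T})"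
      by (rule measure_lborel_mono[of _ _ 0 T]) (use S sets_arc in auto)
    then have "measure lborel (S \<inter> {0..T}) / T \<le> measure lborel ({t. v t \<in> e ` {0..c}} \<inter> {0..T}) / T"
      using elim by (intro divide_right_mono) auto
    then show ?case using elim by linarith
  qed
  have lower: "\<forall>\<^sub>F T in at_top. measure lborel (S \<inter> {0..T}) / T \<ge> c - \<eta>" if "\<eta> > 0" for \<eta>
    using arc_density[OF that c(1) less_imp_le[OF c(2)] order_refl] eventually_gt_at_top[of 0]
  proof eventually_elim
    case (elim T)
    have "{0..T} \<subseteq> (S \<inter> {0..T}) \<union> ({t. v t \<in> e ` {c..1}} \<inter> {0..T})"
    proof
      fix t assume t: "t \<in> {0..T}"
      have "L t \<in> {c..1}" if "t \<notin> S" using that S_iff[of t] L[of t] by auto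
      then show "t \<in> (S \<inter> {0..T}) \<union> ({t. v t \<in> e ` {c..1}} \<inter> {0..T})"
        using t by (cases "t \<in> S") (auto simp: v_def)
    qed
    then have "measure lborel {0..T} \<le> measure lborel ((S \<inter> {0..T}) \<union> ({t. v t \<in> e ` {c..1}} \<inter> {0..T}))"
      by (rule measure_lborel_mono[of _ _ 0 T]) (use S sets_arc in auto)
    also have "\<dots> \<le> measure lborel (S \<inter> {0..T}) + measure lborel ({t. v t \<in> e ` {c..1}} \<inter> {0..T})"
      by (rule measure_Un_le) (use S sets_arc in auto)
    finally have "T / T \<le> (measure lborel (S \<inter> {0..T}) + measure lborel ({t. v t \<in> e ` {c..1}} \<inter> {0..T})) / T"
      using elim by (intro divide_right_mono) auto
    then have "1 \<le> measure lborel (S \<inter> {0..T}) / T + measure lborel ({t. v t \<in> e ` {c..1}} \<inter> {0..T}) / T"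
      using elim by (simp add: add_divide_distrib)
    then show ?case using elim by linarith
  qed
  have "((\<lambda>T. measure lborel (S \<inter> {0..T}) / T) \<longlongrightarrow> c) at_top"
  proof (rule tendstoI)
    fix \<eta> :: real assume \<eta>: "\<eta> > 0"
    then have "\<eta> / 2 > 0" by simp
    from upper[OF this] lower[OF this]
    show "\<forall>\<^sub>F T in at_top. dist (measure lborel (S \<inter> {0..T}) / T) c < \<eta>"
    proof eventually_elim
      case (elim T)
      have "\<bar>measure lborel (S \<inter> {0..T}) / T - c\<bar> \<le> \<eta> / 2" unfolding abs_le_iff using elim by linarith
      then show ?case using \<eta> by (simp add: dist_real_def)
    qed
  qed
  moreover have "S \<inter> {0..T} = {t \<in> {0..T}. significand b (f t) \<le> s}" for T by (auto simp: S_def)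
  ultimately show "((\<lambda>T. measure lborel {t \<in> {0..T}. significand b (f t) \<le> s} / T) \<longlongrightarrow> log b s) at_top"
    by (simp add: c_def)
qed

section \<open>Exponential polynomials\<close>

definition exp_poly :: "complex set \<Rightarrow> (complex \<Rightarrow> complex poly) \<Rightarrow> real \<Rightarrow> complex" where
  "exp_poly S P t = (\<Sum>\<zeta>\<in>S. poly (P \<zeta>) (of_real t) * exp (\<zeta> * of_real t))"

lemma power_exp_tendsto_0:
  assumes "\<delta> < 0 \<or> (\<delta> = 0 \<and> i < k)"
  shows "((\<lambda>t::real. t ^ i / t ^ k * exp (\<delta> * t)) \<longlongrightarrow> 0) at_top"
  using assms
proof
  assume \<delta>: "\<delta> < 0"
  have "((\<lambda>t. (- \<delta> * t) ^ i / exp (- \<delta> * t)) \<longlongrightarrow> 0) at_top"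
    by (rule filterlim_compose[OF tendsto_power_div_exp_0])
      (use \<delta> in \<open>intro filterlim_tendsto_pos_mult_at_top[OF tendsto_const _ filterlim_ident]; simp\<close>)
  then have "((\<lambda>t. (1 / (- \<delta>) ^ i) * ((- \<delta> * t) ^ i / exp (- \<delta> * t))) \<longlongrightarrow> 0) at_top"
    by (rule tendsto_mult_right_zero)
  moreover have "(1 / (- \<delta>) ^ i) * ((- \<delta> * t) ^ i / exp (- \<delta> * t)) = t ^ i * exp (\<delta> * t)" for t
    using \<delta> unfolding power_mult_distrib by (simp add: exp_minus field_simps)
  ultimately have lim: "((\<lambda>t. t ^ i * exp (\<delta> * t)) \<longlongrightarrow> 0) at_top" by simp
  show ?thesis
  proof (rule Lim_null_comparison[OF _ lim])
    show "\<forall>\<^sub>F t in at_top. norm (t ^ i / t ^ k * exp (\<delta> * t)) \<le> t ^ i * exp (\<delta> * t)"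
      using eventually_ge_at_top[of 1]
    proof eventually_elim
      case (elim t)
      then have "t ^ i / t ^ k \<le> t ^ i / 1" by (intro divide_left_mono) auto
      then have "t ^ i / t ^ k * exp (\<delta> * t) \<le> t ^ i / 1 * exp (\<delta> * t)" by (intro mult_right_mono) auto
      then show ?case using elim by (simp add: abs_mult)
    qed
  qed
next
  assume "\<delta> = 0 \<and> i < k"
  then have \<delta>: "\<delta> = 0" and ik: "i < k" by auto
  have "((\<lambda>t::real. 1 / t ^ (k - i)) \<longlongrightarrow> 0) at_top"
    by (intro tendsto_divide_0[OF tendsto_const] filterlim_at_top_imp_at_infinity filterlim_pow_at_top filterlim_ident)
      (use ik in auto)
  then show ?thesis
  proof (rule Lim_transform_eventually)
    show "\<forall>\<^sub>F t in at_top. 1 / t ^ (k - i) = t ^ i / t ^ k * exp (\<delta> * t)"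
      using eventually_gt_at_top[of 0]
    proof eventually_elim
      case (elim t)
      have "t ^ k = t ^ i * t ^ (k - i)" using ik by (simp flip: power_add)
      then show ?case using elim \<delta> by simp
    qed
  qed
qed

lemma exp_poly_term_limit:
  fixes q :: "complex poly"
  assumes "Re \<zeta> < \<rho> \<or> (Re \<zeta> = \<rho> \<and> degree q \<le> k)"
  shows "((\<lambda>t. poly q (of_real t) * exp (\<zeta> * of_real t) / of_real (t ^ k * exp (\<rho> * t))
      - (if Re \<zeta> = \<rho> then coeff q k * cis (Im \<zeta> * t) else 0)) \<longlongrightarrow> 0) at_top"
proof -
  define m where "m i t = coeff q i * of_real (t ^ i / t ^ k * exp ((Re \<zeta> - \<rho>) * t)) * cis (Im \<zeta> * t)" for i t
  define d where "d i t = (if Re \<zeta> = \<rho> \<and> i = k then coeff q k * cis (Im \<zeta> * t) else 0)" for i t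
  have "((\<lambda>t. m i t - d i t) \<longlongrightarrow> 0) at_top" if "i \<le> degree q" for i
  proof (cases "Re \<zeta> = \<rho> \<and> i = k")
    case True
    have "\<forall>\<^sub>F t in at_top. m i t - d i t = 0"
      using eventually_gt_at_top[of 0] by eventually_elim (use True in \<open>simp add: m_def d_def\<close>)
    then show ?thesis by (rule tendsto_eventually)
  next
    case False
    have "((\<lambda>t. norm (coeff q i) * (t ^ i / t ^ k * exp ((Re \<zeta> - \<rho>) * t))) \<longlongrightarrow> 0) at_top"
      by (rule tendsto_mult_right_zero, rule power_exp_tendsto_0) (use False assms that in auto)
    then have "(m i \<longlongrightarrow> 0) at_top"
    proof (rule Lim_null_comparison[rotated])
      show "\<forall>\<^sub>F t in at_top. norm (m i t) \<le> norm (coeff q i) * (t ^ i / t ^ k * exp ((Re \<zeta> - \<rho>) * t))"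
        using eventually_gt_at_top[of 0]
        by eventually_elim (simp add: m_def norm_mult norm_divide norm_power flip: of_real_power)
    qed
    then show ?thesis using False by (auto simp: d_def)
  qed
  then have lim: "((\<lambda>t. \<Sum>i\<le>degree q. m i t - d i t) \<longlongrightarrow> 0) at_top" by (intro tendsto_null_sum) auto
  have "(\<Sum>i\<le>degree q. m i t - d i t) = poly q (of_real t) * exp (\<zeta> * of_real t) / of_real (t ^ k * exp (\<rho> * t))
      - (if Re \<zeta> = \<rho> then coeff q k * cis (Im \<zeta> * t) else 0)" for t
  proof -
    have "exp (\<zeta> * of_real t) = of_real (exp (Re \<zeta> * t)) * cis (Im \<zeta> * t)"
      by (simp add: exp_eq_polar)
    then have e: "exp (\<zeta> * of_real t) / of_real (exp (\<rho> * t)) = of_real (exp ((Re \<zeta> - \<rho>) * t)) * cis (Im \<zeta> * t)"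
      by (simp add: left_diff_distrib exp_diff)
    have "poly q (of_real t) * exp (\<zeta> * of_real t) / of_real (t ^ k * exp (\<rho> * t)) =
        (\<Sum>i\<le>degree q. coeff q i * of_real t ^ i / of_real t ^ k) * (exp (\<zeta> * of_real t) / of_real (exp (\<rho> * t)))"
      by (simp add: poly_altdef sum_divide_distrib flip: sum_divide_distrib)
    also have "\<dots> = (\<Sum>i\<le>degree q. m i t)"
      unfolding e m_def sum_distrib_right by (intro sum.cong) auto
    finally have 1: "poly q (of_real t) * exp (\<zeta> * of_real t) / of_real (t ^ k * exp (\<rho> * t)) = (\<Sum>i\<le>degree q. m i t)" .
    have "(\<Sum>i\<le>degree q. d i t) = (if Re \<zeta> = \<rho> then coeff q k * cis (Im \<zeta> * t) else 0)"
      by (cases "k \<le> degree q") (auto simp: d_def sum.delta coeff_eq_0)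
    then show ?thesis unfolding 1 by (simp add: sum_subtractf)
  qed
  then show ?thesis using lim by simp
qed

text \<open>Among the exponents of largest real part \<open>\<rho>\<close>, those whose coefficient polynomials have the largest
  degree \<open>k\<close> survive division by \<open>t ^ k * exp (\<rho> t)\<close>. The limit is an almost periodic sum, which is not
  identically zero because its coefficients are leading coefficients.\<close>

lemma exp_poly_dominant_part:
  assumes S: "finite S" and nz: "\<exists>\<zeta>\<in>S. P \<zeta> \<noteq> 0"
  shows "\<exists>\<rho> k W c. finite W \<and> W \<noteq> {} \<and> (\<forall>\<omega>\<in>W. c \<omega> \<noteq> 0 \<and> Complex \<rho> \<omega> \<in> S) \<and>
    ((\<lambda>t. exp_poly S P t / of_real (t ^ k * exp (\<rho> * t)) - (\<Sum>\<omega>\<in>W. c \<omega> * cis (\<omega> * t))) \<longlongrightarrow> 0) at_top"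
proof -
  define S' where "S' = {\<zeta>\<in>S. P \<zeta> \<noteq> 0}"
  have S': "finite S'" "S' \<noteq> {}" using S nz by (auto simp: S'_def)
  define \<rho> where "\<rho> = Max (Re ` S')"
  have \<rho>: "Re \<zeta> \<le> \<rho>" if "\<zeta> \<in> S'" for \<zeta> unfolding \<rho>_def using S' that by (intro Max_ge) auto
  define R where "R = {\<zeta>\<in>S'. Re \<zeta> = \<rho>}"
  have "\<rho> \<in> Re ` S'" unfolding \<rho>_def using S' by (intro Max_in) auto
  then have R: "finite R" "R \<noteq> {}" using S' by (auto simp: R_def)
  define k where "k = Max ((\<lambda>\<zeta>. degree (P \<zeta>)) ` R)"
  have k: "degree (P \<zeta>) \<le> k" if "\<zeta> \<in> R" for \<zeta> unfolding k_def using R that by (intro Max_ge) auto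
  define Z where "Z = {\<zeta>\<in>R. degree (P \<zeta>) = k}"
  have "k \<in> (\<lambda>\<zeta>. degree (P \<zeta>)) ` R" unfolding k_def using R by (intro Max_in) auto
  then have Z: "finite Z" "Z \<noteq> {}" using R by (auto simp: Z_def)
  define c where "c \<omega> = coeff (P (Complex \<rho> \<omega>)) k" for \<omega>
  have Zc: "Complex \<rho> (Im \<zeta>) = \<zeta>" if "\<zeta> \<in> Z" for \<zeta>
    using that by (auto simp: Z_def R_def complex_eq_iff)
  have W: "c \<omega> \<noteq> 0 \<and> Complex \<rho> \<omega> \<in> S" if "\<omega> \<in> Im ` Z" for \<omega>
  proof -
    from that obtain \<zeta> where \<zeta>: "\<zeta> \<in> Z" "\<omega> = Im \<zeta>" by blast
    have "P \<zeta> \<noteq> 0" "degree (P \<zeta>) = k" "\<zeta> \<in> S" using \<zeta>(1) by (auto simp: Z_def R_def S'_def)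
    then show ?thesis using Zc[OF \<zeta>(1)] by (auto simp: c_def \<zeta>(2) leading_coeff_0_iff)
  qed
  have "((\<lambda>t. \<Sum>\<zeta>\<in>S'. poly (P \<zeta>) (of_real t) * exp (\<zeta> * of_real t) / of_real (t ^ k * exp (\<rho> * t))
      - (if Re \<zeta> = \<rho> then coeff (P \<zeta>) k * cis (Im \<zeta> * t) else 0)) \<longlongrightarrow> 0) at_top"
  proof (intro tendsto_null_sum exp_poly_term_limit)
    fix \<zeta> assume "\<zeta> \<in> S'"
    then show "Re \<zeta> < \<rho> \<or> Re \<zeta> = \<rho> \<and> degree (P \<zeta>) \<le> k"
      using \<rho>[of \<zeta>] k[of \<zeta>] by (auto simp: R_def)
  qed
  moreover have "(\<Sum>\<zeta>\<in>S'. poly (P \<zeta>) (of_real t) * exp (\<zeta> * of_real t) / of_real (t ^ k * exp (\<rho> * t))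
      - (if Re \<zeta> = \<rho> then coeff (P \<zeta>) k * cis (Im \<zeta> * t) else 0)) =
      exp_poly S P t / of_real (t ^ k * exp (\<rho> * t)) - (\<Sum>\<omega>\<in>Im ` Z. c \<omega> * cis (\<omega> * t))" for t
  proof -
    have "exp_poly S P t = (\<Sum>\<zeta>\<in>S'. poly (P \<zeta>) (of_real t) * exp (\<zeta> * of_real t))"
      unfolding exp_poly_def by (rule sum.mono_neutral_right) (use S in \<open>auto simp: S'_def\<close>)
    moreover have "(\<Sum>\<zeta>\<in>S'. if Re \<zeta> = \<rho> then coeff (P \<zeta>) k * cis (Im \<zeta> * t) else 0) =
        (\<Sum>\<zeta>\<in>Z. coeff (P \<zeta>) k * cis (Im \<zeta> * t))"
    proof (rule sum.mono_neutral_cong_right)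
      show "\<forall>\<zeta>\<in>S' - Z. (if Re \<zeta> = \<rho> then coeff (P \<zeta>) k * cis (Im \<zeta> * t) else 0) = 0"
      proof
        fix \<zeta> assume "\<zeta> \<in> S' - Z"
        then have "Re \<zeta> = \<rho> \<Longrightarrow> degree (P \<zeta>) < k" using k[of \<zeta>] by (auto simp: Z_def R_def le_less)
        then show "(if Re \<zeta> = \<rho> then coeff (P \<zeta>) k * cis (Im \<zeta> * t) else 0) = 0"
          by (auto simp: coeff_eq_0)
      qed
    qed (use S' in \<open>auto simp: Z_def R_def\<close>)
    moreover have "(\<Sum>\<zeta>\<in>Z. coeff (P \<zeta>) k * cis (Im \<zeta> * t)) = (\<Sum>\<omega>\<in>Im ` Z. c \<omega> * cis (\<omega> * t))"
    proof (subst sum.reindex)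
      show "inj_on Im Z" by (rule inj_onI) (metis Zc)
    qed (use Zc in \<open>auto simp: c_def intro!: sum.cong\<close>)
    ultimately show ?thesis by (simp add: sum_subtractf sum_divide_distrib)
  qed
  ultimately show ?thesis
    using Z W by (intro exI[of _ \<rho>] exI[of _ k] exI[of _ "Im ` Z"] exI[of _ c]) simp
qed

section \<open>Growth rates independent of frequency differences\<close>

text \<open>The rational span of the differences of arguments, in full turns per unit of time, of the points
  \<open>exp (t z)\<close> with \<open>Re z = \<rho>\<close>, before any reduction modulo \<open>2 \<pi>\<close>.\<close>

definition freq_span :: "complex set \<Rightarrow> real \<Rightarrow> complex set" where
  "freq_span \<sigma> \<rho> = rat_span {of_real ((Im z - Im w) / (2 * pi)) | z w.
     z \<in> \<sigma> \<and> w \<in> \<sigma> \<and> Re z = \<rho> \<and> Re w = \<rho>}"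

text \<open>Equivalent to exponential nonresonance for finite \<open>\<sigma>\<close>, but free of the sampling time \<open>t\<close>. Since \<open>0\<close> lies in
  every span, no element of \<open>\<sigma>\<close> can be on the imaginary axis.\<close>

definition growth_independent :: "nat \<Rightarrow> complex set \<Rightarrow> bool" where
  "growth_independent b \<sigma> \<longleftrightarrow> (\<forall>z\<in>\<sigma>. of_real (Re z / ln b) \<notin> freq_span \<sigma> (Re z))"

lemma rat_span_eq: "rat_span = rat_complex.span"
  by (simp add: rat_span_def)

lemma freq_span_add: "x \<in> freq_span \<sigma> \<rho> \<Longrightarrow> y \<in> freq_span \<sigma> \<rho> \<Longrightarrow> x + y \<in> freq_span \<sigma> \<rho>"
  unfolding freq_span_def rat_span_eq by (rule rat_complex.span_add)

lemma freq_span_0: "0 \<in> freq_span \<sigma> \<rho>"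
  unfolding freq_span_def rat_span_eq by (rule rat_complex.span_zero)

lemma freq_span_scale: "x \<in> freq_span \<sigma> \<rho> \<Longrightarrow> of_rat q * x \<in> freq_span \<sigma> \<rho>"
  unfolding freq_span_def rat_span_eq by (rule rat_complex.span_scale)

lemma freq_span_diff:
  assumes "Complex \<rho> \<omega> \<in> \<sigma>" "Complex \<rho> \<omega>' \<in> \<sigma>"
  shows "of_real ((\<omega> - \<omega>') / (2 * pi)) \<in> freq_span \<sigma> \<rho>"
  unfolding freq_span_def rat_span_eq
  by (rule rat_complex.span_base, rule CollectI, rule exI[of _ "Complex \<rho> \<omega>"], rule exI[of _ "Complex \<rho> \<omega>'"])
    (use assms in simp)

lemma Weierstrass_complex:
  fixes \<phi> :: "real \<Rightarrow> complex"
  assumes "continuous_on {a..b} \<phi>" "e > 0"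
  shows "\<exists>m n p q. \<forall>x\<in>{a..b}. norm (\<phi> x - ((\<Sum>i\<le>m. of_real (p i) * of_real x ^ i) + (\<Sum>i\<le>n. \<i> * of_real (q i) * of_real x ^ i))) < e"
proof -
  obtain g where g: "polynomial_function g" "\<And>x. x \<in> {a..b} \<Longrightarrow> norm (\<phi> x - g x) < e"
    using Stone_Weierstrass_polynomial_function[OF compact_Icc assms] by blast
  have "real_polynomial_function (Re \<circ> g)" "real_polynomial_function (Im \<circ> g)"
    using g(1) bounded_linear_Re bounded_linear_Im by (auto simp: polynomial_function_def)
  then obtain p m q n where "Re \<circ> g = (\<lambda>x. \<Sum>i\<le>m. p i * x ^ i)" "Im \<circ> g = (\<lambda>x. \<Sum>i\<le>n. q i * x ^ i)"
    unfolding real_polynomial_function_iff_sum by blast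
  then have "Re (g x) = (\<Sum>i\<le>m. p i * x ^ i)" "Im (g x) = (\<Sum>i\<le>n. q i * x ^ i)" for x
    by (auto simp: fun_eq_iff)
  then have "g x = (\<Sum>i\<le>m. of_real (p i) * of_real x ^ i) + (\<Sum>i\<le>n. \<i> * of_real (q i) * of_real x ^ i)" for x
    by (subst complex_eq[of "g x"]) (simp add: sum_distrib_left mult.assoc)
  then show ?thesis using g(2) by (intro exI[of _ m] exI[of _ n] exI[of _ p] exI[of _ q]) simp
qed

text \<open>Write \<open>f t = t ^ k * exp (\<rho> t) * u t\<close> with \<open>u\<close> close to the almost periodic sum \<open>p\<close>. The phase of interest
  splits into \<open>cis (\<alpha> \<rho> t)\<close>, a slow factor, and the phase of \<open>\<bar>u\<bar>\<close>. Away from the rare times at which \<open>p\<close> is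
  small, the last one is a continuous function of \<open>\<bar>p\<bar>\<^sup>2\<close>, hence nearly a polynomial in it, and the
  frequencies of such a polynomial are sums of differences of frequencies of \<open>p\<close>. By hypothesis none
  of them cancels the frequency \<open>\<alpha> \<rho>\<close>.\<close>

lemma mean_zero_log_phase:
  fixes f :: "real \<Rightarrow> real"
  assumes f: "f \<in> borel_measurable borel"
    and W: "finite W" "W \<noteq> {}" "\<And>\<omega>. \<omega> \<in> W \<Longrightarrow> c \<omega> \<noteq> 0"
    and lim: "((\<lambda>t. of_real (f t) / of_real (t ^ k * exp (\<rho> * t)) - (\<Sum>\<omega>\<in>W. c \<omega> * cis (\<omega> * t))) \<longlongrightarrow> (0::complex)) at_top"
    and \<Lambda>: "0 \<in> \<Lambda>" "\<And>\<mu> \<nu>. \<mu> \<in> \<Lambda> \<Longrightarrow> \<nu> \<in> \<Lambda> \<Longrightarrow> \<mu> + \<nu> \<in> \<Lambda>"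
      "\<And>\<omega> \<omega>'. \<omega> \<in> W \<Longrightarrow> \<omega>' \<in> W \<Longrightarrow> \<omega> - \<omega>' \<in> \<Lambda>" "\<And>\<nu>. \<nu> \<in> \<Lambda> \<Longrightarrow> \<alpha> * \<rho> + \<nu> \<noteq> 0"
  shows "mean_zero (\<lambda>t. cis (\<alpha> * ln \<bar>f t\<bar>))"
proof (rule mean_zero_approx)
  show "bdd_borel (\<lambda>t. cis (\<alpha> * ln \<bar>f t\<bar>))" by (rule bdd_borel_cis) (use f in measurable)
next
  fix \<eta> :: real assume \<eta>: "\<eta> > 0"
  define p where "p t = (\<Sum>\<omega>\<in>W. c \<omega> * cis (\<omega> * t))" for t
  define u where "u t = of_real (f t) / complex_of_real (t ^ k * exp (\<rho> * t))" for t
  define r where "r t = u t - p t" for t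
  have r: "(r \<longlongrightarrow> 0) at_top" using lim unfolding r_def u_def p_def .
  have [measurable]: "p \<in> borel_measurable borel" unfolding p_def by measurable
  define B where "B = (\<Sum>\<omega>\<in>W. norm (c \<omega>))"
  have pB: "norm (p t) \<le> B" for t unfolding p_def B_def by (rule sum_norm_le) (simp add: norm_mult)
  then have B: "B \<ge> 0" using norm_ge_zero order_trans by blast
  have "\<exists>\<delta>>0. \<forall>a. measure lborel {t \<in> {a..a+1}. norm (\<Sum>\<omega>\<in>W. c \<omega> * cis (\<omega> * t)) < \<delta>} \<le> \<eta> / 2"
    by (rule trig_sum_small_values) (use W \<eta> in auto)
  then obtain \<delta> where \<delta>: "\<delta> > 0" "\<And>a. measure lborel {t \<in> {a..a+1}. norm (p t) < \<delta>} \<le> \<eta> / 2"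
    unfolding p_def by blast
  define E where "E = {t. norm (p t) < \<delta>}"
  have E: "E \<in> sets borel" unfolding E_def by measurable
  have "E \<inter> {a..a+1} = {t \<in> {a..a+1}. norm (p t) < \<delta>}" for a by (auto simp: E_def)
  then have dens: "\<forall>\<^sub>F T in at_top. measure lborel (E \<inter> {0..T}) / T \<le> \<eta>"
    using unit_intervals_imp_density[OF E, of "\<eta> / 2"] \<delta>(2) \<eta> by simp
  \<comment> \<open>the phase as a function of \<open>\<bar>u\<bar>\<^sup>2\<close>, frozen near the singularity at \<open>0\<close>\<close>
  define \<phi> where "\<phi> x = cis (\<alpha> / 2 * ln (max x ((\<delta> / 2)\<^sup>2)))" for x
  have mpos: "max x ((\<delta> / 2)\<^sup>2) \<noteq> 0" for x using \<delta>(1) by (metis half_gt_zero less_max_iff_disj order_less_irrefl zero_less_power)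
  have cont: "continuous_on X \<phi>" for X unfolding \<phi>_def using mpos by (intro continuous_intros) auto
  have "uniformly_continuous_on {0..(B + 1)\<^sup>2} \<phi>" by (rule compact_uniformly_continuous[OF cont]) simp
  then obtain d where d: "d > 0"
    "\<And>x y. x \<in> {0..(B + 1)\<^sup>2} \<Longrightarrow> y \<in> {0..(B + 1)\<^sup>2} \<Longrightarrow> dist y x < d \<Longrightarrow> dist (\<phi> y) (\<phi> x) < \<eta> / 2"
    unfolding uniformly_continuous_on_def using \<eta> half_gt_zero by metis
  obtain m n a a' where poly: "\<And>x. x \<in> {0..B\<^sup>2} \<Longrightarrow>
      norm (\<phi> x - ((\<Sum>i\<le>m. of_real (a i) * of_real x ^ i) + (\<Sum>i\<le>n. \<i> * of_real (a' i) * of_real x ^ i))) < \<eta> / 2"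
    using Weierstrass_complex[OF cont[of "{0..B\<^sup>2}"] half_gt_zero[OF \<eta>]] by blast
  define Q where "Q x = (\<Sum>i\<le>m. of_real (a i) * x ^ i) + (\<Sum>i\<le>n. \<i> * of_real (a' i) * x ^ i)" for x :: complex
  define G where "G t = cis (\<alpha> * \<rho> * t) * cis (\<alpha> * k * ln t) * Q (of_real ((norm (p t))\<^sup>2))" for t
  have "trig_poly \<Lambda> (\<lambda>t. \<Sum>\<omega>\<in>W. \<Sum>\<omega>'\<in>W. (c \<omega> * cnj (c \<omega>')) * cis ((\<omega> - \<omega>') * t))"
    by (intro trig_poly_sum trig_poly.cis \<Lambda>)
  moreover have "of_real ((norm (p t))\<^sup>2) = (\<Sum>\<omega>\<in>W. \<Sum>\<omega>'\<in>W. (c \<omega> * cnj (c \<omega>')) * cis ((\<omega> - \<omega>') * t))" for t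
    unfolding complex_norm_square p_def cnj_sum sum_product
    by (intro sum.cong refl) (simp add: left_diff_distrib cis_divide[symmetric] cis_cnj divide_inverse)
  ultimately have tp: "trig_poly \<Lambda> (\<lambda>t. of_real ((norm (p t))\<^sup>2))" by simp
  have tq: "trig_poly \<Lambda> (\<lambda>t. Q (of_real ((norm (p t))\<^sup>2)))"
    unfolding Q_def
    by (intro trig_poly.add trig_poly_sum \<Lambda>(1) trig_poly_mult_left trig_poly_power[OF \<Lambda>(1)] \<Lambda>(2) tp)
  have mG: "mean_zero G"
    unfolding G_def by (rule mean_zero_trig_poly_slow_phase[OF \<Lambda>(4) tq])
  have bG: "bdd_borel G"
    unfolding G_def by (intro bdd_borel_mult bdd_borel_cis bdd_borel_trig_poly[OF tq]) measurable
  have QP: "norm (\<phi> ((norm (p t))\<^sup>2) - Q (of_real ((norm (p t))\<^sup>2))) < \<eta> / 2" for t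
    unfolding Q_def using poly[of "(norm (p t))\<^sup>2"] pB[of t] by (simp add: power_mono)
  \<comment> \<open>\<open>\<bar>r\<bar> < e\<close> keeps \<open>u\<close> away from \<open>0\<close>, bounded by \<open>B + 1\<close>, and \<open>\<bar>u\<bar>\<^sup>2\<close> within \<open>d\<close> of \<open>\<bar>p\<bar>\<^sup>2\<close>\<close>
  define e where "e = min (\<delta> / 2) (min 1 (d / (2 * B + 2)))"
  have e: "e > 0" using \<delta> d B by (simp add: e_def)
  have "\<forall>\<^sub>F t in at_top. norm (r t) < e" using tendstoD[OF r e] by simp
  then have close: "\<forall>\<^sub>F t in at_top. norm (cis (\<alpha> * ln \<bar>f t\<bar>) - G t) \<le> \<eta> + 2 * indicat_real E t"
    using eventually_gt_at_top[of 0]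
  proof eventually_elim
    case (elim t)
    define s where "s = t ^ k * exp (\<rho> * t)"
    have s: "s > 0" using elim by (simp add: s_def)
    have lns: "ln s = k * ln t + \<rho> * t" using elim by (simp add: s_def ln_mult ln_realpow)
    have Gn: "norm (z - G t) = norm (z / (cis (\<alpha> * \<rho> * t) * cis (\<alpha> * k * ln t)) - Q (of_real ((norm (p t))\<^sup>2)))" for z
    proof -
      have "z - G t = (cis (\<alpha> * \<rho> * t) * cis (\<alpha> * k * ln t)) * (z / (cis (\<alpha> * \<rho> * t) * cis (\<alpha> * k * ln t)) - Q (of_real ((norm (p t))\<^sup>2)))"
        by (simp add: G_def right_diff_distrib)
      then show ?thesis by (metis mult_1 norm_cis norm_mult)
    qed
    show ?case
    proof (cases "t \<in> E")
      case True
      have "norm (cis (\<alpha> * ln \<bar>f t\<bar>) - G t) \<le> norm (cis (\<alpha> * ln \<bar>f t\<bar>)) + norm (G t)" by (rule norm_triangle_ineq4)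
      moreover have "norm (G t) = norm (Q (of_real ((norm (p t))\<^sup>2)))" using Gn[of 0] by simp
      moreover have "norm (Q (of_real ((norm (p t))\<^sup>2))) \<le> norm (\<phi> ((norm (p t))\<^sup>2)) + \<eta> / 2"
        using norm_triangle_sub[of "Q (of_real ((norm (p t))\<^sup>2))" "\<phi> ((norm (p t))\<^sup>2)"] QP[of t]
        by (simp add: norm_minus_commute)
      ultimately show ?thesis using True \<eta> by (simp add: \<phi>_def)
    next
      case False
      then have "norm (p t) \<ge> \<delta>" by (simp add: E_def)
      moreover have "norm (p t) \<le> norm (u t) + norm (r t)"
        using norm_triangle_ineq4[of "u t" "r t"] by (simp add: r_def)
      ultimately have ud: "norm (u t) \<ge> \<delta> / 2" using elim(1) by (simp add: e_def)
      then have upos: "norm (u t) > 0" using \<delta> by linarith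
      have "u t = of_real (f t / s)" by (simp add: u_def s_def)
      then have "norm (u t) = \<bar>f t\<bar> / s" using s by (simp add: abs_divide del: of_real_divide)
      then have fu: "\<bar>f t\<bar> = s * norm (u t)" using s by simp
      have "(\<delta> / 2)\<^sup>2 \<le> (norm (u t))\<^sup>2" using ud \<delta> by (intro power_mono) auto
      then have "\<phi> ((norm (u t))\<^sup>2) = cis (\<alpha> * ln (norm (u t)))"
        using upos by (simp add: \<phi>_def max_absorb1 ln_realpow)
      moreover have "\<alpha> * ln \<bar>f t\<bar> = \<alpha> * \<rho> * t + \<alpha> * k * ln t + \<alpha> * ln (norm (u t))"
        unfolding fu using s upos by (subst ln_mult) (auto simp: lns algebra_simps)
      ultimately have "cis (\<alpha> * ln \<bar>f t\<bar>) / (cis (\<alpha> * \<rho> * t) * cis (\<alpha> * k * ln t)) = \<phi> ((norm (u t))\<^sup>2)"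
        by (simp add: cis_mult[symmetric])
      then have "norm (cis (\<alpha> * ln \<bar>f t\<bar>) - G t) = norm (\<phi> ((norm (u t))\<^sup>2) - Q (of_real ((norm (p t))\<^sup>2)))"
        by (simp only: Gn)
      also have "\<dots> \<le> norm (\<phi> ((norm (u t))\<^sup>2) - \<phi> ((norm (p t))\<^sup>2)) + norm (\<phi> ((norm (p t))\<^sup>2) - Q (of_real ((norm (p t))\<^sup>2)))"
        using norm_triangle_ineq[of "\<phi> ((norm (u t))\<^sup>2) - \<phi> ((norm (p t))\<^sup>2)" "\<phi> ((norm (p t))\<^sup>2) - Q (of_real ((norm (p t))\<^sup>2))"] by simp
      also have "norm (\<phi> ((norm (u t))\<^sup>2) - \<phi> ((norm (p t))\<^sup>2)) < \<eta> / 2"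
      proof -
        have up: "\<bar>norm (u t) - norm (p t)\<bar> \<le> norm (r t)" unfolding r_def by (rule norm_triangle_ineq3)
        then have u1: "norm (u t) \<le> B + 1" using pB[of t] elim(1) by (simp add: e_def abs_le_iff)
        have "\<bar>(norm (u t))\<^sup>2 - (norm (p t))\<^sup>2\<bar> = \<bar>norm (u t) - norm (p t)\<bar> * (norm (u t) + norm (p t))"
          by (simp add: power2_eq_square square_diff_square_factored abs_mult mult.commute)
        also have "\<dots> \<le> norm (r t) * (2 * B + 2)"
          using up u1 pB[of t] B by (intro mult_mono) auto
        also have "\<dots> < d / (2 * B + 2) * (2 * B + 2)"
          using elim(1) B by (intro mult_strict_right_mono) (auto simp: e_def)
        also have "\<dots> = d" using B by simp
        finally have dd: "dist ((norm (u t))\<^sup>2) ((norm (p t))\<^sup>2) < d" by (simp add: dist_real_def)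
        have "(norm (p t))\<^sup>2 \<in> {0..(B + 1)\<^sup>2}" "(norm (u t))\<^sup>2 \<in> {0..(B + 1)\<^sup>2}"
          using u1 order_trans[OF pB[of t], of "B + 1"] by (auto intro!: power_mono)
        from d(2)[OF this dd] show ?thesis by (simp add: dist_norm)
      qed
      finally show ?thesis using QP[of t] False by simp
    qed
  qed
  show "\<exists>G E. bdd_borel G \<and> mean_zero G \<and> E \<in> sets borel \<and>
      (\<forall>\<^sub>F t in at_top. norm (cis (\<alpha> * ln \<bar>f t\<bar>) - G t) \<le> \<eta> + 2 * indicat_real E t) \<and>
      (\<forall>\<^sub>F T in at_top. measure lborel (E \<inter> {0..T}) / T \<le> \<eta>)"
    using mG bG E close dens by blast
qed

text \<open>If \<open>2 \<pi> n \<rho> / ln b\<close> were cancelled by a sum \<open>\<nu>\<close> of frequency differences, division by \<open>- 2 \<pi> n\<close> would put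
  \<open>\<rho> / ln b\<close> into the rational span of these differences.\<close>

theorem exp_poly_benford:
  fixes f :: "real \<Rightarrow> real"
  assumes b: "b \<ge> 2" and f: "f \<in> borel_measurable borel" and S: "finite S"
    and fP: "\<And>t. of_real (f t) = exp_poly S P t" and nz: "\<exists>\<zeta>\<in>S. P \<zeta> \<noteq> 0"
    and indep: "growth_independent b S"
  shows "benford b f"
proof (rule Weyl_imp_benford[OF b f])
  fix n :: nat assume n: "n > 0"
  obtain \<rho> k W c where W: "finite W" "W \<noteq> {}" "\<And>\<omega>. \<omega> \<in> W \<Longrightarrow> c \<omega> \<noteq> 0" "\<And>\<omega>. \<omega> \<in> W \<Longrightarrow> Complex \<rho> \<omega> \<in> S"
    and lim: "((\<lambda>t. exp_poly S P t / of_real (t ^ k * exp (\<rho> * t)) - (\<Sum>\<omega>\<in>W. c \<omega> * cis (\<omega> * t))) \<longlongrightarrow> 0) at_top"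
    using exp_poly_dominant_part[OF S nz] by blast
  define \<Lambda> where "\<Lambda> = {\<nu>. complex_of_real (\<nu> / (2 * pi)) \<in> freq_span S \<rho>}"
  show "mean_zero (\<lambda>t. cis (2 * pi * real n / ln b * ln \<bar>f t\<bar>))"
  proof (rule mean_zero_log_phase[OF f W(1-3), where \<Lambda> = \<Lambda>])
    show "((\<lambda>t. of_real (f t) / of_real (t ^ k * exp (\<rho> * t)) - (\<Sum>\<omega>\<in>W. c \<omega> * cis (\<omega> * t))) \<longlongrightarrow> (0::complex)) at_top"
      using lim fP by simp
    show "0 \<in> \<Lambda>" by (simp add: \<Lambda>_def freq_span_0)
    show "\<mu> + \<nu> \<in> \<Lambda>" if "\<mu> \<in> \<Lambda>" "\<nu> \<in> \<Lambda>" for \<mu> \<nu>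
      using that freq_span_add by (simp add: \<Lambda>_def add_divide_distrib)
    show "\<omega> - \<omega>' \<in> \<Lambda>" if "\<omega> \<in> W" "\<omega>' \<in> W" for \<omega> \<omega>'
      using freq_span_diff[OF W(4)[OF that(1)] W(4)[OF that(2)]] by (simp add: \<Lambda>_def)
    show "2 * pi * real n / ln b * \<rho> + \<nu> \<noteq> 0" if \<nu>: "\<nu> \<in> \<Lambda>" for \<nu>
    proof
      assume "2 * pi * real n / ln b * \<rho> + \<nu> = 0"
      then have "\<nu> = - (2 * pi * (real n * (\<rho> / ln b)))" by (simp add: algebra_simps)
      then have eq: "\<nu> / (2 * pi) = - (real n * (\<rho> / ln b))" by simp
      have "of_rat (- (1 / of_nat n)) * complex_of_real (\<nu> / (2 * pi)) \<in> freq_span S \<rho>"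
        using \<nu> by (intro freq_span_scale) (simp add: \<Lambda>_def)
      moreover have "of_rat (- (1 / of_nat n)) * complex_of_real (\<nu> / (2 * pi)) = of_real (\<rho> / ln b)"
        unfolding eq using n by (simp add: of_rat_minus of_rat_divide)
      ultimately have "complex_of_real (\<rho> / ln b) \<in> freq_span S \<rho>" by simp
      moreover obtain \<omega> where "\<omega> \<in> W" using W(2) by blast
      ultimately show False using indep W(4) by (force simp: growth_independent_def)
    qed
  qed
qed

section \<open>Exponential nonresonance is independence of growth rates\<close>

lemma Arg_exp_eq: "\<exists>k::int. Arg (exp (of_real t * z)) = t * Im z + 2 * pi * k"
proof -
  let ?w = "of_real t * z"
  have "exp ?w = of_real (norm (exp ?w)) * exp (\<i> * of_real (Arg (exp ?w)))"
    by (rule Arg_eq) simp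
  moreover have "exp ?w = of_real (norm (exp ?w)) * exp (\<i> * of_real (Im ?w))"
    unfolding norm_exp_eq_Re cis_conv_exp[symmetric] by (rule exp_eq_polar)
  ultimately have "exp (\<i> * of_real (Arg (exp ?w))) = exp (\<i> * of_real (Im ?w))"
    by (metis exp_not_eq_zero mult_cancel_left mult_zero_left)
  then obtain n :: int where "\<i> * of_real (Arg (exp ?w)) = \<i> * of_real (Im ?w) + of_real (of_int (2 * n) * pi) * \<i>"
    unfolding exp_eq by blast
  then have "Arg (exp ?w) = Im ?w + of_int (2 * n) * pi"
    by (simp add: complex_eq_iff)
  then show ?thesis by (intro exI[of _ n]) simp
qed

text \<open>The elements of \<open>arg_diffs\<close> agree with \<open>t\<close> times a frequency difference up to an integer, and all
  integers belong to the rational span of \<open>arg_diffs\<close> because \<open>1\<close> does.\<close>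

lemma arg_diff_exp_eq:
  "\<exists>k::int. 1 + (Arg (exp (of_real t * z)) - Arg (exp (of_real t * w))) / (2 * pi) = t * ((Im z - Im w) / (2 * pi)) + k"
proof -
  obtain k l :: int where kl: "Arg (exp (of_real t * z)) = t * Im z + 2 * pi * k"
      "Arg (exp (of_real t * w)) = t * Im w + 2 * pi * l"
    using Arg_exp_eq by blast
  have shift: "1 + ((t * x + p * k') - (t * y + p * l')) / p = t * ((x - y) / p) + (1 + k' - l')"
    if "p \<noteq> 0" for p x y k' l' :: real
  proof -
    have "((t * x + p * k') - (t * y + p * l')) = t * (x - y) + p * (k' - l')" by (simp add: algebra_simps)
    then show ?thesis using that by (simp add: add_divide_distrib)
  qed
  have "2 * pi \<noteq> 0" by simp
  from shift[OF this] show ?thesis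
    unfolding kl by (intro exI[of _ "1 + k - l"]) (simp only: of_int_add of_int_diff of_int_1)
qed

lemma rat_span_of_rat:
  assumes "1 \<in> S" shows "of_rat q \<in> rat_span S"
  using rat_complex.span_scale[OF rat_complex.span_base[OF assms], of q] by (simp add: rat_span_eq)

lemma nonresonant_imp_growth_independent:
  assumes b: "b \<ge> 2" and nr: "exponentially_nonresonant b \<sigma>"
  shows "growth_independent b \<sigma>"
  unfolding growth_independent_def
proof (intro ballI notI)
  fix z assume z: "z \<in> \<sigma>" and dep: "complex_of_real (Re z / ln b) \<in> freq_span \<sigma> (Re z)"
  obtain t where t: "t \<ge> 0" "nonresonant b ((\<lambda>z. exp (of_real t * z)) ` \<sigma>)"
    using nr by (auto simp: exponentially_nonresonant_def)
  define r where "r = exp (t * Re z)"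
  define Z where "Z = (\<lambda>z. exp (of_real t * z)) ` \<sigma> \<inter> sphere 0 r"
  have mem: "exp (of_real t * w) \<in> Z" if "w \<in> \<sigma>" "Re w = Re z" for w
    using that by (auto simp: Z_def r_def)
  have "Z \<noteq> {}" using mem[OF z] by blast
  then have "circle_nonresonant b r Z"
    using t(2)[unfolded nonresonant_def, rule_format, of r] by (simp add: Z_def r_def)
  then have notin: "complex_of_real (log b r) \<notin> rat_span (complex_of_real ` arg_diffs Z)"
    by (simp add: circle_nonresonant_def)
  have one: "1 \<in> complex_of_real ` arg_diffs Z"
    using mem[OF z] by (force simp: arg_diffs_def intro!: image_eqI[of _ _ 1])
  have "of_real t * x \<in> rat_span (complex_of_real ` arg_diffs Z)" if "x \<in> freq_span \<sigma> (Re z)" for x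
    using that unfolding freq_span_def rat_span_eq
  proof (induction rule: rat_complex.span_induct)
    case base
    let ?U = "{x. of_real t * x \<in> rat_complex.span (complex_of_real ` arg_diffs Z)}"
    show ?case
    proof (rule rat_complex.subspaceI)
      fix c x assume "x \<in> ?U"
      then have "of_rat c * (of_real t * x) \<in> rat_complex.span (complex_of_real ` arg_diffs Z)"
        by (intro rat_complex.span_scale) simp
      then show "of_rat c * x \<in> ?U"
        by (simp only: mem_Collect_eq mult.left_commute)
    next
      show "0 \<in> ?U"
        using rat_complex.span_zero[of "complex_of_real ` arg_diffs Z"] by simp
    next
      fix x y assume "x \<in> ?U"
        "y \<in> ?U"
      then show "x + y \<in> ?U"
        unfolding mem_Collect_eq distrib_left by (rule rat_complex.span_add)
    qed
  next
    case (step x)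
    then obtain z1 w1 where x: "x = of_real ((Im z1 - Im w1) / (2 * pi))" "z1 \<in> \<sigma>" "w1 \<in> \<sigma>" "Re z1 = Re z" "Re w1 = Re z"
      by blast
    obtain k :: int where k: "1 + (Arg (exp (of_real t * z1)) - Arg (exp (of_real t * w1))) / (2 * pi)
        = t * ((Im z1 - Im w1) / (2 * pi)) + k" (is "?d = _")
      using arg_diff_exp_eq by blast
    have "?d \<in> arg_diffs Z" using mem x unfolding arg_diffs_def by blast
    then have "complex_of_real ?d \<in> rat_complex.span (complex_of_real ` arg_diffs Z)"
      by (intro rat_complex.span_base imageI)
    moreover have "complex_of_real (of_int k) \<in> rat_complex.span (complex_of_real ` arg_diffs Z)"
      using rat_span_of_rat[OF one, of "of_int k"] by (simp add: rat_span_eq)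
    moreover have "of_real t * x = complex_of_real ?d - complex_of_real (of_int k)"
      unfolding k x(1) by simp
    ultimately show ?case by (metis rat_complex.span_diff)
  qed
  from this[OF dep] have "complex_of_real (t * (Re z / ln b)) \<in> rat_span (complex_of_real ` arg_diffs Z)"
    by simp
  moreover have "log b r = t * (Re z / ln b)" by (simp add: log_def r_def)
  ultimately show False using notin by simp
qed

lemma countable_rat_span_finite:
  assumes "finite S" shows "countable (rat_complex.span S)"
  using assms
proof (induction S)
  case empty
  then show ?case by simp
next
  case (insert a S)
  have "rat_complex.span (insert a S) \<subseteq> (\<Union>k. (\<lambda>y. of_rat k * a + y) ` rat_complex.span S)"
  proof
    fix x assume "x \<in> rat_complex.span (insert a S)"
    then obtain k where "x - of_rat k * a \<in> rat_complex.span S"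
      using rat_complex.span_breakdown_eq by blast
    moreover have "x = of_rat k * a + (x - of_rat k * a)" by simp
    ultimately show "x \<in> (\<Union>k. (\<lambda>y. of_rat k * a + y) ` rat_complex.span S)" by blast
  qed
  moreover have "countable (\<Union>k. (\<lambda>y. of_rat k * a + y) ` rat_complex.span S)"
    using insert.IH by auto
  ultimately show ?case by (rule countable_subset)
qed

text \<open>A sampling time \<open>t\<close> is bad if it makes a nonzero frequency difference rational (the sets \<open>A\<close>) or
  creates a relation between \<open>t \<rho> / ln b\<close>, a rational number and \<open>t\<close> times an element of the span (the
  sets \<open>B\<close>). Each of these countably many relations holds for countably many \<open>t\<close> only, so a good \<open>t > 0\<close>
  exists. Positivity makes \<open>Re z\<close> recoverable from \<open>\<bar>exp (t z)\<bar>\<close>.\<close>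

lemma growth_independent_imp_nonresonant:
  assumes b: "b \<ge> 2" and fin: "finite \<sigma>" and ind: "growth_independent b \<sigma>"
  shows "exponentially_nonresonant b \<sigma>"
proof -
  define A where "A z w = {t. t * ((Im z - Im w) / (2 * pi)) \<in> \<rat>}" for z w
  define B where "B z s = {t. \<exists>q. complex_of_real (t * (Re z / ln b)) = of_rat q + of_real t * s}" for z s
  have cA: "countable (A z w)" if "Im z \<noteq> Im w" for z w
  proof (rule countable_subset)
    show "A z w \<subseteq> (\<lambda>q. q / ((Im z - Im w) / (2 * pi))) ` \<rat>"
      using that by (auto simp: A_def intro!: image_eqI)
  qed (simp add: countable_rat)
  have cB: "countable (B z s)" if "z \<in> \<sigma>" "s \<in> freq_span \<sigma> (Re z)" for z s
  proof (rule countable_subset)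
    define c where "c = complex_of_real (Re z / ln b) - s"
    have c: "c \<noteq> 0" using ind that by (auto simp: growth_independent_def c_def)
    show "B z s \<subseteq> range (\<lambda>q::rat. Re (of_rat q / c))"
    proof
      fix t assume "t \<in> B z s"
      then obtain q where "complex_of_real (t * (Re z / ln b)) = of_rat q + of_real t * s"
        by (auto simp: B_def)
      then have "of_real t * c = of_rat q" by (simp add: c_def algebra_simps)
      then have "complex_of_real t = of_rat q / c" using c by (simp add: field_simps)
      then show "t \<in> range (\<lambda>q::rat. Re (of_rat q / c))" by (metis Re_complex_of_real rangeI)
    qed
  qed simp
  have fs: "countable (freq_span \<sigma> \<rho>)" for \<rho>
    unfolding freq_span_def rat_span_eq
  proof (rule countable_rat_span_finite)
    have "{complex_of_real ((Im z - Im w) / (2 * pi)) |z w. z \<in> \<sigma> \<and> w \<in> \<sigma> \<and> Re z = \<rho> \<and> Re w = \<rho>} \<subseteq>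
        (\<lambda>(z, w). complex_of_real ((Im z - Im w) / (2 * pi))) ` (\<sigma> \<times> \<sigma>)" by auto
    then show "finite {complex_of_real ((Im z - Im w) / (2 * pi)) |z w. z \<in> \<sigma> \<and> w \<in> \<sigma> \<and> Re z = \<rho> \<and> Re w = \<rho>}"
      using fin by (meson finite_SigmaI finite_imageI finite_subset)
  qed
  define Bad where "Bad = (\<Union>z\<in>\<sigma>. \<Union>w\<in>{w\<in>\<sigma>. Im z \<noteq> Im w}. A z w) \<union> (\<Union>z\<in>\<sigma>. \<Union>s\<in>freq_span \<sigma> (Re z). B z s)"
  have "countable Bad"
    unfolding Bad_def using fin fs cA cB
    by (intro countable_Un countable_UN) (auto intro: countable_finite)
  then have "\<not> {0<..<1::real} \<subseteq> Bad"
    using uncountable_open_interval[of 0 "1::real"] countable_subset by auto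
  then obtain t where "t \<in> {0<..<1}" and tB: "t \<notin> Bad" by blast
  then have t: "t > 0" "t \<notin> Bad" by auto
  have "nonresonant b ((\<lambda>z. exp (of_real t * z)) ` \<sigma>)"
    unfolding nonresonant_def
  proof (intro allI impI)
    fix r :: real assume r: "r > 0"
    define Z where "Z = (\<lambda>z. exp (of_real t * z)) ` \<sigma> \<inter> sphere 0 r"
    have Zd: "\<exists>z\<in>\<sigma>. Re z = ln r / t \<and> x = exp (of_real t * z)" if x: "x \<in> Z" for x
    proof -
      obtain z where z: "z \<in> \<sigma>" "x = exp (of_real t * z)" "exp (t * Re z) = r"
        using x by (auto simp: Z_def)
      from z(3) have "ln r = t * Re z" by (metis ln_exp)
      then show ?thesis using t(1) z(1,2) by auto
    qed
    have "Z = {} \<or> circle_nonresonant b r Z"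
    proof (rule disjCI)
      assume "\<not> circle_nonresonant b r Z"
      show "Z = {}"
      proof (rule ccontr)
        assume "Z \<noteq> {}"
        then obtain x0 where x0: "x0 \<in> Z" by blast
        obtain z0 where z0: "z0 \<in> \<sigma>" "Re z0 = ln r / t" using Zd[OF x0] by blast
        have "arg_diffs Z \<inter> \<rat> = {1}"
        proof (intro equalityI subsetI)
          fix x assume "x \<in> arg_diffs Z \<inter> \<rat>"
          then obtain u v where uv: "u \<in> Z" "v \<in> Z" "x = 1 + (Arg u - Arg v) / (2 * pi)" "x \<in> \<rat>"
            by (auto simp: arg_diffs_def)
          obtain z where z: "z \<in> \<sigma>" "Re z = ln r / t" "u = exp (of_real t * z)" using Zd[OF uv(1)] by blast
          obtain w where w: "w \<in> \<sigma>" "Re w = ln r / t" "v = exp (of_real t * w)" using Zd[OF uv(2)] by blast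
          obtain k :: int where k: "x = t * ((Im z - Im w) / (2 * pi)) + k"
            using arg_diff_exp_eq[of t z w] unfolding uv(3) z(3) w(3) by blast
          have "x - of_int k \<in> \<rat>" using uv(4) by (intro Rats_diff) auto
          then have "t \<in> A z w" using k by (simp add: A_def)
          then have "Im z = Im w" using t(2) z(1) w(1) by (auto simp: Bad_def)
          then have "u = v" using z w by (metis complex_eq_iff)
          then show "x \<in> {1}" using uv(3) by simp
        next
          fix x :: real assume "x \<in> {1}"
          then show "x \<in> arg_diffs Z \<inter> \<rat>" using x0 by (force simp: arg_diffs_def)
        qed
        moreover have "complex_of_real (log b r) \<notin> rat_span (complex_of_real ` arg_diffs Z)"
        proof
          assume "complex_of_real (log b r) \<in> rat_span (complex_of_real ` arg_diffs Z)"
          then have "\<exists>q. \<exists>s\<in>freq_span \<sigma> (ln r / t). complex_of_real (log b r) = of_rat q + of_real t * s"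
            unfolding rat_span_eq
          proof (induction rule: rat_complex.span_induct)
            case base
            let ?V = "{a. \<exists>q. \<exists>s\<in>freq_span \<sigma> (ln r / t). a = of_rat q + complex_of_real t * s}"
            show ?case
            proof (rule rat_complex.subspaceI)
              show "0 \<in> ?V"
                using freq_span_0 by (force intro!: exI[of _ 0])
            next
              fix x y assume "x \<in> ?V"
                "y \<in> ?V"
              then obtain q s q' s' where "x = of_rat q + of_real t * s" "y = of_rat q' + of_real t * s'"
                "s \<in> freq_span \<sigma> (ln r / t)" "s' \<in> freq_span \<sigma> (ln r / t)" by blast
              then have "x + y = of_rat (q + q') + of_real t * (s + s')" "s + s' \<in> freq_span \<sigma> (ln r / t)"
                by (auto simp: of_rat_add algebra_simps freq_span_add)
              then show "x + y \<in> ?V" by blast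
            next
              fix c x assume "x \<in> ?V"
              then obtain q s where "x = of_rat q + of_real t * s" "s \<in> freq_span \<sigma> (ln r / t)" by blast
              then have "of_rat c * x = of_rat (c * q) + of_real t * (of_rat c * s)" "of_rat c * s \<in> freq_span \<sigma> (ln r / t)"
                using freq_span_scale[of s \<sigma> "ln r / t" c] by (auto simp: of_rat_mult distrib_left mult.left_commute)
              then show "of_rat c * x \<in> ?V" by blast
            qed
          next
            case (step x)
            then obtain u v where uv: "u \<in> Z" "v \<in> Z" "x = of_real (1 + (Arg u - Arg v) / (2 * pi))"
              by (auto simp: arg_diffs_def)
            obtain z where z: "z \<in> \<sigma>" "Re z = ln r / t" "u = exp (of_real t * z)" using Zd[OF uv(1)] by blast
            obtain w where w: "w \<in> \<sigma>" "Re w = ln r / t" "v = exp (of_real t * w)" using Zd[OF uv(2)] by blast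
            obtain k :: int where "1 + (Arg u - Arg v) / (2 * pi) = t * ((Im z - Im w) / (2 * pi)) + k"
              using arg_diff_exp_eq[of t z w] unfolding z(3) w(3) by blast
            then have k: "x = of_real (t * ((Im z - Im w) / (2 * pi)) + k)" by (simp only: uv(3))
            have "complex_of_real ((Im z - Im w) / (2 * pi)) \<in> freq_span \<sigma> (ln r / t)"
              unfolding freq_span_def rat_span_eq by (rule rat_complex.span_base) (use z w in blast)
            moreover have "x = of_rat (of_int k) + of_real t * complex_of_real ((Im z - Im w) / (2 * pi))"
              by (simp add: k)
            ultimately show ?case by blast
          qed
          moreover have "log b r = t * (Re z0 / ln b)" using z0 t(1) by (simp add: log_def)
          ultimately have "\<exists>s\<in>freq_span \<sigma> (Re z0). t \<in> B z0 s"
            unfolding B_def mem_Collect_eq z0(2) by metis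
          then show False using t(2) z0(1) by (auto simp: Bad_def)
        qed
        ultimately show False using \<open>\<not> circle_nonresonant b r Z\<close> by (simp add: circle_nonresonant_def)
      qed
    qed
    then show "(\<lambda>z. exp (of_real t * z)) ` \<sigma> \<inter> sphere 0 r = {} \<or>
        circle_nonresonant b r ((\<lambda>z. exp (of_real t * z)) ` \<sigma> \<inter> sphere 0 r)" by (simp add: Z_def)
  qed
  then show ?thesis using t(1) by (auto simp: exponentially_nonresonant_def intro!: exI[of _ t])
qed

section \<open>The generator of a linear flow\<close>

lemma linear_flow_bounded_linear: "linear_flow \<phi> \<Longrightarrow> bounded_linear (\<phi> t)"
  by (simp add: linear_flow_def linear_conv_bounded_linear)

lemma blinfun_apply_flow_map: "linear_flow \<phi> \<Longrightarrow> blinfun_apply (flow_map \<phi> t) = \<phi> t"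
  unfolding flow_map_def by (rule bounded_linear_Blinfun_apply[OF linear_flow_bounded_linear])

lemma flow_map_0: "linear_flow \<phi> \<Longrightarrow> flow_map \<phi> 0 = id_blinfun"
  by (rule blinfun_eqI) (simp add: blinfun_apply_flow_map, simp add: linear_flow_def)

lemma flow_map_add: "linear_flow \<phi> \<Longrightarrow> flow_map \<phi> (s + t) = flow_map \<phi> s o\<^sub>L flow_map \<phi> t"
  by (rule blinfun_eqI) (simp add: blinfun_apply_flow_map, simp add: linear_flow_def)

lemma continuous_flow_map:
  fixes \<phi> :: "real \<Rightarrow> real ^ 'n \<Rightarrow> real ^ 'n"
  assumes "linear_flow \<phi>" shows "continuous_on S (flow_map \<phi>)"
proof (rule continuous_on_subset[OF continuous_on_blinfun_componentwise])
  fix i :: "real ^ 'n"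
  have "continuous_on UNIV ((\<lambda>(t, x). \<phi> t x) \<circ> (\<lambda>t. (t, i)))"
    using assms unfolding linear_flow_def
    by (intro continuous_on_compose continuous_intros) (auto intro: continuous_on_subset)
  then show "continuous_on UNIV (\<lambda>t. blinfun_apply (flow_map \<phi> t) i)"
    by (simp add: blinfun_apply_flow_map[OF assms] o_def)
qed auto

text \<open>The integral \<open>J\<close> of the flow over \<open>[0, h]\<close> is close to \<open>h\<close> times the identity for small \<open>h\<close>, hence
  invertible. Composing the flow at time \<open>t\<close> with \<open>J\<close> gives the integral over \<open>[t, t + h]\<close>, which is
  differentiable in \<open>t\<close>; cancelling \<open>J\<close> shows that the flow itself is.\<close>

lemma flow_map_differentiable_0:
  fixes \<phi> :: "real \<Rightarrow> real ^ 'n \<Rightarrow> real ^ 'n"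
  assumes \<phi>: "linear_flow \<phi>"
  shows "\<exists>A. (flow_map \<phi> has_vector_derivative A) (at 0)"
proof -
  let ?F = "flow_map \<phi>"
  have "isCont ?F 0" using continuous_flow_map[OF \<phi>, of UNIV] by (simp add: continuous_on_eq_continuous_at)
  then obtain d where d: "d > 0" "\<And>s. \<bar>s\<bar> < d \<Longrightarrow> norm (?F s - ?F 0) < 1 / 2"
    unfolding continuous_at_eps_delta by (metis dist_norm real_norm_def diff_zero half_gt_zero_iff zero_less_one)
  define h where "h = d / 2"
  have h: "h > 0" using d by (simp add: h_def)
  define J where "J = integral {0..h} ?F"
  have "norm (J - h *\<^sub>R id_blinfun) \<le> h * (1 / 2)"
  proof -
    have eq: "J - h *\<^sub>R id_blinfun = integral {0..h} (\<lambda>s. ?F s - id_blinfun)"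
      using h by (subst integral_diff) (auto simp: J_def intro!: integrable_continuous_real continuous_flow_map[OF \<phi>])
    have "norm (integral {0..h} (\<lambda>s. ?F s - id_blinfun)) \<le> 1 / 2 * (h - 0)"
    proof (rule integral_bound)
      show "norm (?F s - id_blinfun) \<le> 1 / 2" if "s \<in> {0..h}" for s
        using d(2)[of s] that d(1) by (simp add: flow_map_0[OF \<phi>] h_def)
    qed (use h in \<open>auto intro!: continuous_intros continuous_flow_map[OF \<phi>]\<close>)
    then show ?thesis unfolding eq by simp
  qed
  then have Jn: "norm (J - h *\<^sub>R id_blinfun) \<le> h / 2" by simp
  have Jx: "norm (J x - h *\<^sub>R x) \<le> h / 2 * norm x" for x
    using order_trans[OF norm_blinfun[of "J - h *\<^sub>R id_blinfun" x] mult_right_mono[OF Jn norm_ge_zero]]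
    by (simp add: blinfun.diff_left blinfun.scaleR_left)
  have "inj (blinfun_apply J)"
    unfolding linear_injective_0[OF bounded_linear.linear[OF blinfun.bounded_linear_right]]
  proof (intro allI impI)
    fix x assume "J x = 0"
    then have "h * norm x \<le> h / 2 * norm x" using Jx[of x] h by simp
    then show "x = 0" using h by (simp add: field_simps mult_le_0_iff)
  qed
  then obtain K' where K': "linear K'" "\<And>x. J (K' x) = x"
    using linear_injective_isomorphism[OF bounded_linear.linear[OF blinfun.bounded_linear_right] \<open>inj (blinfun_apply J)\<close>] by blast
  define K where "K = Blinfun K'"
  have JK: "J (K x) = x" for x
    by (simp add: K_def bounded_linear_Blinfun_apply K' linear_conv_bounded_linear[symmetric])
  define I where "I u = integral {-1..u} ?F" for u
  have I': "(I has_vector_derivative ?F u) (at u)" if "u \<in> {-1<..<h+1}" for u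
  proof -
    have "(I has_vector_derivative ?F u) (at u within {-1..h+1})"
      unfolding I_def by (rule integral_has_vector_derivative) (use that in \<open>auto intro: continuous_flow_map[OF \<phi>]\<close>)
    then show ?thesis using that by (simp add: at_within_Icc_at)
  qed
  have FJ: "?F t = (I (t + h) - I t) o\<^sub>L K" if "t \<in> {-1<..<1}" for t
  proof -
    have "?F t o\<^sub>L J = integral {0..h} (\<lambda>s. ?F t o\<^sub>L ?F s)"
      unfolding J_def
      by (subst integral_linear[symmetric, unfolded o_def, OF _ bounded_bilinear.bounded_linear_right[OF bounded_bilinear_blinfun_compose]])
        (auto intro!: integrable_continuous_real continuous_flow_map[OF \<phi>])
    also have "\<dots> = integral {0..h} (?F \<circ> (+) t)"
      by (intro integral_cong) (simp add: flow_map_add[OF \<phi>, symmetric])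
    also have "\<dots> = integral {0 + t..h + t} ?F"
      by (rule integral_shift_Icc_real)
    also have "\<dots> = I (t + h) - I t"
      using Henstock_Kurzweil_Integration.integral_combine[of "-1" t "t + h" ?F] that h
      by (simp add: I_def add.commute integrable_continuous_real continuous_flow_map[OF \<phi>] algebra_simps)
    finally have "(?F t o\<^sub>L J) o\<^sub>L K = (I (t + h) - I t) o\<^sub>L K" by simp
    moreover have "(?F t o\<^sub>L J) o\<^sub>L K = ?F t" by (rule blinfun_eqI) (simp add: JK)
    ultimately show ?thesis by simp
  qed
  have Ih: "((\<lambda>t. I (t + h)) has_vector_derivative ?F h) (at 0)"
  proof -
    have "((\<lambda>t. t + h) has_vector_derivative 1) (at 0)" by (auto intro!: derivative_eq_intros)
    moreover have "(I has_vector_derivative ?F h) (at (0 + h))" using I'[of h] h by simp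
    ultimately show ?thesis using vector_diff_chain_at[of "\<lambda>t. t + h" 1 0 I "?F h"] by (simp add: o_def)
  qed
  have "((\<lambda>t. I (t + h) - I t) has_vector_derivative ?F h - ?F 0) (at 0)"
    using h by (intro has_vector_derivative_diff Ih I') auto
  then have "((\<lambda>t. (I (t + h) - I t) o\<^sub>L K) has_vector_derivative (?F h - ?F 0) o\<^sub>L K) (at 0)"
    by (rule bounded_linear.has_vector_derivative[OF bounded_bilinear.bounded_linear_left[OF bounded_bilinear_blinfun_compose]])
  then have "(?F has_vector_derivative (?F h - ?F 0) o\<^sub>L K) (at 0)"
    by (rule has_vector_derivative_transform_within_open[where S = "{-1<..<1}"]) (auto simp: FJ)
  then show ?thesis by blast
qed

lemma flow_map_has_derivative:
  assumes \<phi>: "linear_flow \<phi>" and A: "(flow_map \<phi> has_vector_derivative A) (at 0)"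
  shows "(flow_map \<phi> has_vector_derivative flow_map \<phi> t o\<^sub>L A) (at t)"
proof -
  have "((\<lambda>u. u - t) has_vector_derivative 1) (at t)" by (auto intro!: derivative_eq_intros)
  then have "(flow_map \<phi> \<circ> (\<lambda>u. u - t) has_vector_derivative 1 *\<^sub>R A) (at t)"
    by (rule vector_diff_chain_at) (simp add: A)
  then have "((\<lambda>u. flow_map \<phi> t o\<^sub>L (flow_map \<phi> \<circ> (\<lambda>u. u - t)) u) has_vector_derivative flow_map \<phi> t o\<^sub>L 1 *\<^sub>R A) (at t)"
    by (rule bounded_linear.has_vector_derivative[OF bounded_bilinear.bounded_linear_right[OF bounded_bilinear_blinfun_compose]])
  moreover have "flow_map \<phi> t o\<^sub>L flow_map \<phi> (u - t) = flow_map \<phi> u" for u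
    using flow_map_add[OF \<phi>, of t "u - t"] by simp
  ultimately show ?thesis by simp
qed

lemma blinfun_power_apply:
  fixes A :: "'a::real_normed_vector \<Rightarrow>\<^sub>L 'a"
  shows "blinfun_apply ((((o\<^sub>L) A) ^^ k) id_blinfun) x = (blinfun_apply A ^^ k) x"
  by (induction k) auto

lemma blinfun_power_scaleR:
  fixes A :: "'a::real_normed_vector \<Rightarrow>\<^sub>L 'a"
  shows "(((o\<^sub>L) (t *\<^sub>R A)) ^^ k) id_blinfun = t ^ k *\<^sub>R (((o\<^sub>L) A) ^^ k) id_blinfun"
  by (induction k) (auto simp: bounded_bilinear.scaleR_left[OF bounded_bilinear_blinfun_compose]
      bounded_bilinear.scaleR_right[OF bounded_bilinear_blinfun_compose])

lemma norm_blinfun_power_le: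
  fixes A :: "'a::real_normed_vector \<Rightarrow>\<^sub>L 'a"
  shows "norm ((blinfun_apply A ^^ k) x) \<le> norm A ^ k * norm x"
proof (induction k)
  case (Suc k)
  have "norm ((blinfun_apply A ^^ Suc k) x) \<le> norm A * norm ((blinfun_apply A ^^ k) x)"
    by (simp add: norm_blinfun)
  also have "\<dots> \<le> norm A * (norm A ^ k * norm x)" by (intro mult_left_mono Suc) auto
  finally show ?case by (simp add: mult.assoc)
qed simp

lemma blinfun_exp_sums:
  fixes A :: "(real ^ 'n) \<Rightarrow>\<^sub>L (real ^ 'n)"
  shows "(\<lambda>k. inverse (fact k) *\<^sub>R (t ^ k *\<^sub>R (((o\<^sub>L) A) ^^ k) id_blinfun)) sums blinfun_exp (t *\<^sub>R A)"
proof -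
  have "summable (\<lambda>k. inverse (fact k) *\<^sub>R (t ^ k *\<^sub>R (((o\<^sub>L) A) ^^ k) id_blinfun))"
  proof (rule summable_comparison_test'[where N = 0])
    show "summable (\<lambda>k. inverse (fact k) * (\<bar>t\<bar> * norm A) ^ k)" by (rule summable_exp)
    fix k :: nat
    have "norm ((((o\<^sub>L) A) ^^ k) id_blinfun) \<le> norm A ^ k"
      by (rule norm_blinfun_bound) (auto simp: blinfun_power_apply norm_blinfun_power_le)
    then show "norm (inverse (fact k) *\<^sub>R (t ^ k *\<^sub>R (((o\<^sub>L) A) ^^ k) id_blinfun)) \<le> inverse (fact k) * (\<bar>t\<bar> * norm A) ^ k"
      by (simp add: power_mult_distrib power_abs abs_mult mult.assoc mult_left_mono)
  qed
  then show ?thesis unfolding blinfun_exp_def blinfun_power_scaleR by (rule summable_sums)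
qed

text \<open>Each entry of the flow is smooth with derivatives bounded geometrically on compact intervals, so
  its Maclaurin series converges to it, and that series is the exponential series.\<close>

lemma flow_map_eq_exp:
  fixes \<phi> :: "real \<Rightarrow> real ^ 'n \<Rightarrow> real ^ 'n"
  assumes \<phi>: "linear_flow \<phi>" and A: "(flow_map \<phi> has_vector_derivative A) (at 0)"
  shows "flow_map \<phi> t = blinfun_exp (t *\<^sub>R A)"
proof (rule blinfun_eqI, rule vec_eq_iff[THEN iffD2], rule allI)
  fix x :: "real ^ 'n" and i :: 'n
  define D where "D k s = blinfun_apply (flow_map \<phi> s) ((blinfun_apply A ^^ k) x) $ i" for k s
  have D: "DERIV (D k) s :> D (Suc k) s" for k s
  proof -
    have "bounded_linear (\<lambda>B. blinfun_apply B ((blinfun_apply A ^^ k) x) $ i)"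
      by (rule bounded_linear_compose[OF bounded_linear_vec_nth blinfun.bounded_linear_left])
    from bounded_linear.has_vector_derivative[OF this flow_map_has_derivative[OF \<phi> A, of s]]
    show ?thesis by (simp add: D_def[abs_def] has_real_derivative_iff_has_vector_derivative)
  qed
  have cont: "continuous_on {-\<bar>t\<bar>..\<bar>t\<bar>} (\<lambda>s. norm (flow_map \<phi> s))"
    by (intro continuous_intros continuous_flow_map[OF \<phi>])
  obtain C where C: "\<And>s. s \<in> {-\<bar>t\<bar>..\<bar>t\<bar>} \<Longrightarrow> norm (flow_map \<phi> s) \<le> C"
    using compact_imp_bounded[OF compact_continuous_image[OF cont compact_Icc]]
    unfolding bounded_iff by (metis imageI norm_ge_zero real_norm_def abs_of_nonneg)
  have "(\<lambda>n. \<Sum>k<n. D k 0 / fact k * t ^ k) \<longlonglongrightarrow> D 0 t"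
  proof (rule LIM_zero_cancel, rule Lim_null_comparison)
    show "\<forall>\<^sub>F n in sequentially. norm ((\<Sum>k<n. D k 0 / fact k * t ^ k) - D 0 t)
        \<le> C * norm x * (inverse (fact n) * (norm A * \<bar>t\<bar>) ^ n)"
    proof (rule always_eventually, rule allI)
      fix n
      obtain s where s: "\<bar>s\<bar> \<le> \<bar>t\<bar>" "D 0 t = (\<Sum>k<n. D k 0 / fact k * t ^ k) + D n s / fact n * t ^ n"
        using Maclaurin_all_le[of D "D 0" t n] D by blast
      have "\<bar>D n s\<bar> \<le> norm (blinfun_apply (flow_map \<phi> s) ((blinfun_apply A ^^ n) x))"
        unfolding D_def by (rule component_le_norm_cart)
      also have "\<dots> \<le> norm (flow_map \<phi> s) * norm ((blinfun_apply A ^^ n) x)" by (rule norm_blinfun)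
      also have "\<dots> \<le> C * (norm A ^ n * norm x)"
      proof (rule mult_mono)
        have "s \<in> {-\<bar>t\<bar>..\<bar>t\<bar>}" using s(1) by (auto simp: abs_le_iff)
        then show "norm (flow_map \<phi> s) \<le> C" by (rule C)
        then show "0 \<le> C" using norm_ge_zero order_trans by blast
      qed (auto intro: norm_blinfun_power_le)
      finally have "\<bar>D n s\<bar> * (\<bar>t\<bar> ^ n / fact n) \<le> C * (norm A ^ n * norm x) * (\<bar>t\<bar> ^ n / fact n)"
        by (rule mult_right_mono) simp
      then show "norm ((\<Sum>k<n. D k 0 / fact k * t ^ k) - D 0 t) \<le> C * norm x * (inverse (fact n) * (norm A * \<bar>t\<bar>) ^ n)"
        by (simp add: s(2) abs_mult power_abs power_mult_distrib divide_inverse mult_ac)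
    qed
    have "(\<lambda>n. inverse (fact n) * (norm A * \<bar>t\<bar>) ^ n) \<longlonglongrightarrow> 0" by (rule summable_LIMSEQ_zero[OF summable_exp])
    then show "(\<lambda>n. C * norm x * (inverse (fact n) * (norm A * \<bar>t\<bar>) ^ n)) \<longlonglongrightarrow> 0" by (rule tendsto_mult_right_zero)
  qed
  then have "(\<lambda>k. D k 0 / fact k * t ^ k) sums D 0 t" by (simp add: sums_def)
  moreover have "(\<lambda>k. D k 0 / fact k * t ^ k) sums (blinfun_apply (blinfun_exp (t *\<^sub>R A)) x $ i)"
  proof -
    have "bounded_linear (\<lambda>B :: (real ^ 'n) \<Rightarrow>\<^sub>L (real ^ 'n). blinfun_apply B x $ i)"
      by (rule bounded_linear_compose[OF bounded_linear_vec_nth blinfun.bounded_linear_left])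
    from bounded_linear.sums[OF this blinfun_exp_sums[of t A]]
    show ?thesis
      by (simp add: D_def flow_map_0[OF \<phi>] blinfun.scaleR_left blinfun_power_apply divide_inverse mult_ac)
  qed
  ultimately have "D 0 t = blinfun_apply (blinfun_exp (t *\<^sub>R A)) x $ i" by (rule sums_unique2)
  then show "blinfun_apply (flow_map \<phi> t) x $ i = blinfun_apply (blinfun_exp (t *\<^sub>R A)) x $ i"
    by (simp add: D_def)
qed

lemma exp_derivative_0_unique:
  fixes A B :: "(real ^ 'n) \<Rightarrow>\<^sub>L (real ^ 'n)"
  assumes "((\<lambda>t. blinfun_exp (t *\<^sub>R B)) has_vector_derivative A) (at 0)"
  shows "B = A"
proof (rule blinfun_eqI, rule vec_eq_iff[THEN iffD2], rule allI)
  fix x :: "real ^ 'n" and i :: 'n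
  define c where "c k = inverse (fact k) * ((blinfun_apply B ^^ k) x $ i)" for k
  have lin: "bounded_linear (\<lambda>B :: (real ^ 'n) \<Rightarrow>\<^sub>L (real ^ 'n). blinfun_apply B x $ i)"
    by (rule bounded_linear_compose[OF bounded_linear_vec_nth blinfun.bounded_linear_left])
  have c: "(\<lambda>k. c k * t ^ k) sums (blinfun_apply (blinfun_exp (t *\<^sub>R B)) x $ i)" for t
    using bounded_linear.sums[OF lin blinfun_exp_sums[of t B]]
    by (simp add: c_def blinfun.scaleR_left blinfun_power_apply mult_ac)
  have "DERIV (\<lambda>t. \<Sum>k. c k * t ^ k) 0 :> (\<Sum>k. diffs c k * 0 ^ k)"
    by (rule termdiffs_strong_converges_everywhere) (use c in \<open>auto simp: sums_iff\<close>)
  then have "DERIV (\<lambda>t. blinfun_apply (blinfun_exp (t *\<^sub>R B)) x $ i) 0 :> c 1"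
    using c by (simp add: sums_iff diffs_def)
  moreover have "DERIV (\<lambda>t. blinfun_apply (blinfun_exp (t *\<^sub>R B)) x $ i) 0 :> blinfun_apply A x $ i"
    using bounded_linear.has_vector_derivative[OF lin assms]
    by (simp add: has_real_derivative_iff_has_vector_derivative)
  ultimately have "c 1 = blinfun_apply A x $ i" by (rule DERIV_unique)
  then show "blinfun_apply B x $ i = blinfun_apply A x $ i" by (simp add: c_def)
qed

text \<open>The generator, defined through the exponential, is the derivative of the flow at \<open>0\<close>.\<close>

theorem flow_map_derivative_generator:
  assumes \<phi>: "linear_flow \<phi>"
  shows "(flow_map \<phi> has_vector_derivative flow_map \<phi> t o\<^sub>L generator \<phi>) (at t)"
proof -
  obtain A where A: "(flow_map \<phi> has_vector_derivative A) (at 0)"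
    using flow_map_differentiable_0[OF \<phi>] by blast
  have "generator \<phi> = A"
    unfolding generator_def
  proof (rule the_equality)
    show "\<forall>t. flow_map \<phi> t = blinfun_exp (t *\<^sub>R A)" using flow_map_eq_exp[OF \<phi> A] by blast
    fix B assume "\<forall>t. flow_map \<phi> t = blinfun_exp (t *\<^sub>R B)"
    then have "flow_map \<phi> = (\<lambda>t. blinfun_exp (t *\<^sub>R B))" by blast
    with A show "B = A" by (intro exp_derivative_0_unique) simp
  qed
  then show ?thesis using flow_map_has_derivative[OF \<phi> A] by simp
qed

section \<open>Entries of the flow are exponential polynomials\<close>

definition complex_matrix :: "((real ^ 'n) \<Rightarrow>\<^sub>L (real ^ 'n)) \<Rightarrow> complex ^ 'n ^ 'n" where
  "complex_matrix B = map_matrix complex_of_real (matrix (blinfun_apply B))"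

lemma complex_matrix_nth: "complex_matrix B $ i $ j = of_real (blinfun_apply B (axis j 1) $ i)"
  by (simp add: complex_matrix_def map_matrix_def matrix_def)

lemma complex_matrix_id: "complex_matrix id_blinfun = mat 1"
  by (simp add: vec_eq_iff complex_matrix_nth mat_def axis_def)

lemma complex_matrix_compose: "complex_matrix (B o\<^sub>L C) = complex_matrix B ** complex_matrix C"
proof -
  have "linear (blinfun_apply B)" "linear (blinfun_apply C)"
    by (simp_all add: bounded_linear.linear blinfun.bounded_linear_right)
  moreover have "blinfun_apply (B o\<^sub>L C) = blinfun_apply B \<circ> blinfun_apply C" by (simp add: fun_eq_iff)
  ultimately have "matrix (blinfun_apply (B o\<^sub>L C)) = matrix (blinfun_apply B) ** matrix (blinfun_apply C)"
    by (simp add: matrix_compose)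
  then show ?thesis
    by (simp add: complex_matrix_def map_matrix_def matrix_matrix_mult_def vec_eq_iff)
qed

lemma matrix_vector_axis: "(M *v axis j 1) $ i = (M $ i $ j :: complex)"
  by (simp add: matrix_vector_mult_def axis_def if_distrib[of "\<lambda>x. _ * x"] cong: if_cong)

lemma bounded_linear_complex_matrix_component:
  fixes v :: "complex ^ 'n"
  shows "bounded_linear (\<lambda>B. (complex_matrix B *v v) $ i)"
proof -
  have "bounded_linear (\<lambda>B :: (real ^ 'n) \<Rightarrow>\<^sub>L (real ^ 'n). complex_of_real (blinfun_apply B (axis j 1) $ i) * v $ j)" for j
    by (intro bounded_linear_compose[OF bounded_linear_mult_left]
        bounded_linear_compose[OF bounded_linear_of_real]
        bounded_linear_compose[OF bounded_linear_vec_nth] blinfun.bounded_linear_left)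
  then show ?thesis
    by (simp add: matrix_vector_mult_def complex_matrix_nth bounded_linear_sum)
qed

lemma complex_flow_derivative:
  assumes "linear_flow \<phi>"
  shows "((\<lambda>t. (complex_matrix (flow_map \<phi> t) *v v) $ i) has_vector_derivative
    (complex_matrix (flow_map \<phi> t) *v (complex_matrix (generator \<phi>) *v v)) $ i) (at t)"
  using bounded_linear.has_vector_derivative[OF bounded_linear_complex_matrix_component flow_map_derivative_generator[OF assms]]
  by (simp add: complex_matrix_compose matrix_vector_mul_assoc)

lemma mem_flow_spectrum:
  "z \<in> flow_spectrum \<phi> \<longleftrightarrow> (\<exists>v. v \<noteq> 0 \<and> complex_matrix (generator \<phi>) *v v = z *s v)"
  by (simp add: flow_spectrum_def spectrum_def complex_matrix_def)

text \<open>A polynomial in \<open>M\<close>, applied to \<open>v\<close>. The Horner scheme is used because \<open>^\<close> on \<open>complex ^ 'n ^ 'n\<close> is the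
  componentwise power.\<close>

definition poly_act :: "complex ^ 'n ^ 'n \<Rightarrow> complex poly \<Rightarrow> complex ^ 'n \<Rightarrow> complex ^ 'n" where
  "poly_act M p v = fold_coeffs (\<lambda>a w. a *s v + M *v w) p 0"

lemma poly_act_0 [simp]: "poly_act M 0 v = 0"
  by (simp add: poly_act_def)

lemma poly_act_pCons [simp]: "poly_act M (pCons a p) v = a *s v + M *v poly_act M p v"
  by (cases "p = 0 \<and> a = 0") (auto simp: poly_act_def)

lemma poly_act_add: "poly_act M (p + q) v = poly_act M p v + poly_act M q v"
  by (induction p q rule: poly_induct2) (auto simp: matrix_vector_right_distrib vector_sadd_rdistrib algebra_simps)

lemma poly_act_smult: "poly_act M (smult c p) v = c *s poly_act M p v"
  by (induction p) (auto simp: vector_smult_assoc vector_add_ldistrib vector_scalar_commute)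

lemma poly_act_mult: "poly_act M (p * q) v = poly_act M p (poly_act M q v)"
  by (induction p) (auto simp: poly_act_add poly_act_smult)

lemma poly_act_arg_add: "poly_act M p (v + w) = poly_act M p v + poly_act M p w"
  by (induction p) (auto simp: matrix_vector_right_distrib vector_add_ldistrib)

lemma poly_act_arg_smult: "poly_act M p (c *s v) = c *s poly_act M p v"
  by (induction p) (auto simp: vector_smult_assoc vector_add_ldistrib vector_scalar_commute mult.commute)

lemma poly_act_arg_0 [simp]: "poly_act M p 0 = 0"
  using poly_act_arg_smult[of M p 0 0] by simp

lemma poly_act_arg_sum: "poly_act M p (\<Sum>i\<in>I. f i) = (\<Sum>i\<in>I. poly_act M p (f i))"
  by (induction I rule: infinite_finite_induct) (auto simp: poly_act_arg_add)

lemma poly_act_sum: "poly_act M (\<Sum>i\<in>I. p i) v = (\<Sum>i\<in>I. poly_act M (p i) v)"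
  by (induction I rule: infinite_finite_induct) (auto simp: poly_act_add)

lemma poly_act_monom: "poly_act M (monom c k) v = c *s ((*v) M ^^ k) v"
  by (induction k) (auto simp: monom_0 monom_Suc vector_scalar_commute)

lemma poly_act_eigenvector:
  assumes "M *v v = z *s v" shows "poly_act M p v = poly p z *s v"
  by (induction p) (auto simp: assms vector_scalar_commute vector_smult_assoc vector_sadd_rdistrib mult.commute)

lemma of_real_vector_smult: "complex_of_real c *s w = c *\<^sub>R w"
  by (simp add: vec_eq_iff) (simp add: scaleR_conv_of_real)

text \<open>The vectors \<open>v, M v, M (M v), \<dots>\<close> cannot all be distinct and linearly independent.\<close>

lemma ex_local_annihilator: "\<exists>p. p \<noteq> 0 \<and> poly_act M p v = (0 :: complex ^ 'n)"
proof -
  define f where "f i = ((*v) M ^^ i) v" for i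
  define d where "d = DIM(complex ^ 'n)"
  show ?thesis
  proof (cases "inj_on f {..d}")
    case True
    have "card (f ` {..d}) = Suc d" using True by (simp add: card_image)
    then have "dependent (f ` {..d})" by (intro dependent_biggerset) (simp add: d_def)
    then obtain u where u: "\<exists>w\<in>f ` {..d}. u w \<noteq> 0" "(\<Sum>w\<in>f ` {..d}. u w *\<^sub>R w) = 0"
      using dependent_finite[of "f ` {..d}"] by auto
    define p where "p = (\<Sum>i\<le>d. monom (complex_of_real (u (f i))) i)"
    obtain k where k: "k \<le> d" "u (f k) \<noteq> 0" using u(1) by auto
    have "coeff p k = of_real (u (f k))" using k(1) by (simp add: p_def coeff_sum)
    then have "p \<noteq> 0" using k(2) by auto
    moreover have "poly_act M p v = (\<Sum>i\<le>d. u (f i) *\<^sub>R f i)"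
      by (simp add: p_def poly_act_sum poly_act_monom f_def of_real_vector_smult)
    then have "poly_act M p v = 0" using u(2) True by (simp add: sum.reindex)
    ultimately show ?thesis by blast
  next
    case False
    then obtain i j where ij: "i \<noteq> j" "f i = f j" by (auto simp: inj_on_def)
    define p where "p = monom (1::complex) i + smult (-1) (monom 1 j)"
    have "coeff p i = 1" using ij by (simp add: p_def)
    then have "p \<noteq> 0" by auto
    moreover have "poly_act M p v = 0"
      unfolding p_def poly_act_add poly_act_smult poly_act_monom using ij(2) by (simp add: f_def)
    ultimately show ?thesis by blast
  qed
qed

text \<open>Annihilators of the basis vectors multiply to an annihilator of the whole space. In one of least
  degree every root is an eigenvalue: dividing out the factor of a root \<open>z\<close> leaves a polynomial that
  does not annihilate, and its nonzero values are eigenvectors for \<open>z\<close>.\<close>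

lemma ex_annihilator_roots_eigenvalues:
  fixes M :: "complex ^ 'n ^ 'n"
  shows "\<exists>p. p \<noteq> 0 \<and> (\<forall>v. poly_act M p v = 0) \<and> (\<forall>z. poly p z = 0 \<longrightarrow> (\<exists>v. v \<noteq> 0 \<and> M *v v = z *s v))"
proof -
  define ann where "ann p \<longleftrightarrow> p \<noteq> 0 \<and> (\<forall>v. poly_act M p v = 0)" for p
  obtain P where P: "\<And>j. P j \<noteq> 0" "\<And>j. poly_act M (P j) (axis j 1) = 0"
    using ex_local_annihilator[of M "axis _ 1"] by metis
  have "ann (\<Prod>j\<in>UNIV. P j)"
    unfolding ann_def
  proof (intro conjI allI)
    show "(\<Prod>j\<in>UNIV. P j) \<noteq> 0" using P by simp
    fix v :: "complex ^ 'n"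
    have "poly_act M (\<Prod>j\<in>UNIV. P j) (axis i 1) = 0" for i
    proof -
      have "(\<Prod>j\<in>UNIV. P j) = (\<Prod>j\<in>UNIV - {i}. P j) * P i"
        by (simp add: prod.remove[of UNIV i] mult.commute)
      then show ?thesis by (simp add: poly_act_mult P)
    qed
    then have "poly_act M (\<Prod>j\<in>UNIV. P j) (\<Sum>i\<in>UNIV. v $ i *s axis i 1) = 0"
      by (simp add: poly_act_arg_sum poly_act_arg_smult)
    then show "poly_act M (\<Prod>j\<in>UNIV. P j) v = 0" by (simp add: basis_expansion)
  qed
  then obtain p where p: "ann p" "\<And>q. ann q \<Longrightarrow> degree p \<le> degree q"
    using ex_has_least_nat[of ann _ degree] by blast
  have "\<exists>v. v \<noteq> 0 \<and> M *v v = z *s v" if root: "poly p z = 0" for z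
  proof -
    have "[:-z, 1:] dvd p" using root by (simp only: poly_eq_0_iff_dvd)
    then obtain q where q: "p = [:-z, 1:] * q" by (rule dvdE)
    have "q \<noteq> 0" using p(1) q by (auto simp: ann_def)
    have "degree p = degree [:-z, 1:] + degree q" unfolding q by (rule degree_mult_eq) (use \<open>q \<noteq> 0\<close> in simp_all)
    then have "degree p = Suc (degree q)" by simp
    then have "\<not> ann q" using p(2)[of q] by auto
    then obtain v where v: "poly_act M q v \<noteq> 0" using \<open>q \<noteq> 0\<close> by (auto simp: ann_def)
    have "poly_act M p v = 0" using p(1) by (simp add: ann_def)
    then have "M *v poly_act M q v = z *s poly_act M q v"
      unfolding q poly_act_mult by simp
    with v show ?thesis by blast
  qed
  then show ?thesis using p(1) by (auto simp: ann_def)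
qed

lemma finite_flow_spectrum: "finite (flow_spectrum \<phi>)"
proof -
  obtain p where p: "p \<noteq> 0" "\<And>v. poly_act (complex_matrix (generator \<phi>)) p v = 0"
    using ex_annihilator_roots_eigenvalues by blast
  have "flow_spectrum \<phi> \<subseteq> {z. poly p z = 0}"
  proof
    fix z assume "z \<in> flow_spectrum \<phi>"
    then obtain v where v: "v \<noteq> 0" "complex_matrix (generator \<phi>) *v v = z *s v"
      by (auto simp: mem_flow_spectrum)
    then have "poly p z *s v = 0" using poly_act_eigenvector[OF v(2), of p] p(2) by simp
    then show "z \<in> {z. poly p z = 0}" using v(1) by simp
  qed
  then show ?thesis using poly_roots_finite[OF p(1)] finite_subset by blast
qed

definition is_exp_poly :: "complex set \<Rightarrow> (real \<Rightarrow> complex) \<Rightarrow> bool" where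
  "is_exp_poly S g \<longleftrightarrow> (\<exists>P. \<forall>t. g t = exp_poly S P t)"

lemma is_exp_poly_0: "is_exp_poly S (\<lambda>t. 0)"
  unfolding is_exp_poly_def by (intro exI[of _ "\<lambda>_. 0"]) (simp add: exp_poly_def)

lemma is_exp_poly_add:
  assumes "is_exp_poly S g" "is_exp_poly S h" shows "is_exp_poly S (\<lambda>t. g t + h t)"
proof -
  obtain P Q where "\<And>t. g t = exp_poly S P t" "\<And>t. h t = exp_poly S Q t"
    using assms by (auto simp: is_exp_poly_def)
  then show ?thesis
    unfolding is_exp_poly_def
    by (intro exI[of _ "\<lambda>z. P z + Q z"]) (simp add: exp_poly_def sum.distrib distrib_right)
qed

lemma is_exp_poly_mult_left:
  assumes "is_exp_poly S g" shows "is_exp_poly S (\<lambda>t. c * g t)"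
proof -
  obtain P where "\<And>t. g t = exp_poly S P t" using assms by (auto simp: is_exp_poly_def)
  then show ?thesis
    unfolding is_exp_poly_def
    by (intro exI[of _ "\<lambda>z. smult c (P z)"]) (simp add: exp_poly_def sum_distrib_left mult.assoc)
qed

lemma is_exp_poly_sum:
  "(\<And>i. i \<in> I \<Longrightarrow> is_exp_poly S (g i)) \<Longrightarrow> is_exp_poly S (\<lambda>t. \<Sum>i\<in>I. g i t)"
  by (induction I rule: infinite_finite_induct) (auto intro: is_exp_poly_0 is_exp_poly_add)

lemma ex_pderiv_eq: "\<exists>Q :: complex poly. pderiv Q = P"
proof -
  define Q where "Q = (\<Sum>i\<le>degree P. monom (coeff P i / of_nat (Suc i)) (Suc i))"
  have pderiv_sum: "pderiv (\<Sum>i\<in>I. f i) = (\<Sum>i\<in>I. pderiv (f i))" for f :: "nat \<Rightarrow> complex poly" and I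
    by (induction I rule: infinite_finite_induct) (auto simp: pderiv_add)
  have "pderiv Q = (\<Sum>i\<le>degree P. monom (coeff P i) i)"
    unfolding Q_def pderiv_sum by (simp add: pderiv_monom del: of_nat_Suc)
  then show ?thesis using poly_as_sum_of_monoms by metis
qed

lemma ex_pderiv_add_smult_eq:
  assumes "c \<noteq> 0" shows "\<exists>Q :: complex poly. pderiv Q + smult c Q = P"
proof (induction "degree P" arbitrary: P rule: less_induct)
  case less
  show ?case
  proof (cases "degree P = 0")
    case True
    then have "pderiv P = 0" by (simp add: pderiv_eq_0_iff)
    then show ?thesis
      using assms by (intro exI[of _ "smult (1 / c) P"]) (simp add: pderiv_smult)
  next
    case False
    then have "degree (pderiv P) < degree P" by (simp add: degree_pderiv)
    then obtain R where R: "pderiv R + smult c R = pderiv P" using less by blast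
    then have "pderiv P - pderiv R = smult c R" by (metis add_diff_cancel_left')
    then show ?thesis
      using assms by (intro exI[of _ "smult (1 / c) (P - R)"]) (simp add: pderiv_smult pderiv_diff)
  qed
qed

text \<open>Solving \<open>g' = \<mu> g + h\<close> does not leave the space of exponential polynomials with exponents in \<open>S\<close>: the two
  preceding lemmas provide a particular solution term by term, and the homogeneous part is a multiple
  of \<open>exp (\<mu> t)\<close>.\<close>

lemma is_exp_poly_ode:
  assumes S: "finite S" "\<mu> \<in> S" and h: "is_exp_poly S h"
    and g: "\<And>t. (g has_vector_derivative \<mu> * g t + h t) (at t)"
  shows "is_exp_poly S g"
proof -
  obtain P where P: "\<And>t. h t = exp_poly S P t" using h by (auto simp: is_exp_poly_def)
  have "\<exists>Q. pderiv Q + smult (z - \<mu>) Q = P z" for z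
    using ex_pderiv_eq[of "P z"] ex_pderiv_add_smult_eq[of "z - \<mu>" "P z"] by (cases "z = \<mu>") auto
  then obtain Q where Q: "\<And>z. pderiv (Q z) + smult (z - \<mu>) (Q z) = P z" by metis
  have dQ: "((\<lambda>t. poly (Q z) (of_real t) * exp (z * of_real t)) has_vector_derivative
      \<mu> * (poly (Q z) (of_real t) * exp (z * of_real t)) + poly (P z) (of_real t) * exp (z * of_real t)) (at t)" for z t
  proof -
    have "((\<lambda>x. poly (Q z) x * exp (z * x)) has_field_derivative
        (poly (pderiv (Q z)) (of_real t) * exp (z * of_real t) + poly (Q z) (of_real t) * (exp (z * of_real t) * z))) (at (complex_of_real t))"
      by (auto intro!: derivative_eq_intros)
    from has_vector_derivative_real_field[OF this]
    have "((\<lambda>t. poly (Q z) (of_real t) * exp (z * of_real t)) has_vector_derivative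
        (poly (pderiv (Q z)) (of_real t) * exp (z * of_real t) + poly (Q z) (of_real t) * (exp (z * of_real t) * z))) (at t)" .
    moreover have "poly (pderiv (Q z)) (of_real t) = poly (P z) (of_real t) - (z - \<mu>) * poly (Q z) (of_real t)"
      using arg_cong[OF Q[of z], of "\<lambda>p. poly p (of_real t)"] by (simp add: algebra_simps)
    ultimately show ?thesis by (simp add: algebra_simps)
  qed
  have dE: "(exp_poly S Q has_vector_derivative \<mu> * exp_poly S Q t + h t) (at t)" for t
    unfolding P exp_poly_def[abs_def]
    using has_vector_derivative_sum[of S, OF dQ] by (simp add: sum.distrib sum_distrib_left)
  define w where "w t = (g t - exp_poly S Q t) * exp (- \<mu> * of_real t)" for t
  have "(w has_vector_derivative 0) (at t)" for t
  proof -
    have "((\<lambda>t. exp (- \<mu> * of_real t)) has_vector_derivative exp (- \<mu> * of_real t) * (- \<mu>)) (at t)"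
      by (rule has_vector_derivative_real_field) (auto intro!: derivative_eq_intros)
    from has_vector_derivative_mult[OF has_vector_derivative_diff[OF g dE] this]
    show ?thesis unfolding w_def[abs_def] by (simp add: algebra_simps)
  qed
  then obtain c where c: "\<And>t. w t = c"
    using has_vector_derivative_zero_constant[of UNIV w] by auto
  have "g t = exp_poly S Q t + c * exp (\<mu> * of_real t)" for t
  proof -
    have "w t * exp (\<mu> * of_real t) = (g t - exp_poly S Q t) * (exp (- \<mu> * of_real t) * exp (\<mu> * of_real t))"
      by (simp add: w_def)
    also have "exp (- \<mu> * of_real t) * exp (\<mu> * of_real t) = 1" by (simp flip: exp_add)
    finally show ?thesis by (simp add: c)
  qed
  moreover have "is_exp_poly S (\<lambda>t. c * exp (\<mu> * of_real t))"
  proof -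
    have "c * exp (\<mu> * of_real t) = exp_poly S (\<lambda>z. if z = \<mu> then [:c:] else 0) t" for t
      using S by (simp add: exp_poly_def if_distrib[of "\<lambda>p. poly p _"] if_distrib[of "\<lambda>x. x * _"] cong: if_cong)
    then show ?thesis by (auto simp: is_exp_poly_def)
  qed
  moreover have "is_exp_poly S (exp_poly S Q)" by (auto simp: is_exp_poly_def)
  ultimately show ?thesis using is_exp_poly_add[of S "exp_poly S Q"] by (simp add: fun_eq_iff is_exp_poly_def)
qed

text \<open>Induction on the degree of a polynomial annihilating \<open>v\<close> and having only eigenvalues as roots: for a
  root \<open>z\<close>, the vector \<open>w = M v - z v\<close> is annihilated by a polynomial of smaller degree, and the orbit of
  \<open>v\<close> solves \<open>g' = z g + h\<close>, where \<open>h\<close> is the orbit of \<open>w\<close>. This takes the place of the Jordan normal form.\<close>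

lemma complex_flow_component_exp_poly:
  assumes \<phi>: "linear_flow \<phi>"
  shows "is_exp_poly (flow_spectrum \<phi>) (\<lambda>t. (complex_matrix (flow_map \<phi> t) *v v) $ i)"
proof -
  let ?M = "complex_matrix (generator \<phi>)"
  have main: "is_exp_poly (flow_spectrum \<phi>) (\<lambda>t. (complex_matrix (flow_map \<phi> t) *v v) $ i)"
    if "p \<noteq> 0" "\<And>z. poly p z = 0 \<Longrightarrow> z \<in> flow_spectrum \<phi>" "poly_act ?M p v = 0" for p v
    using that
  proof (induction "degree p" arbitrary: p v)
    case 0
    then obtain c where "p = [:c:]" "c \<noteq> 0" by (metis degree_0_id pCons_0_0 degree_eq_zeroE)
    then have "v = 0" using 0 by simp
    then show ?case by (simp add: is_exp_poly_0)
  next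
    case (Suc d)
    have "\<not> constant (poly p)" using Suc.hyps(2) by (simp add: constant_degree)
    then obtain z where z: "poly p z = 0" using fundamental_theorem_of_algebra by blast
    then have "[:-z, 1:] dvd p" by (simp only: poly_eq_0_iff_dvd)
    then obtain q where q: "p = [:-z, 1:] * q" by (rule dvdE)
    have q0: "q \<noteq> 0" using Suc.prems q by auto
    have "degree p = degree [:-z, 1:] + degree q" unfolding q by (rule degree_mult_eq) (use q0 in simp_all)
    then have dq: "d = degree q" using Suc.hyps(2) by simp
    define w where "w = ?M *v v - z *s v"
    have "poly_act ?M [:-z, 1:] v = w" by (simp add: w_def)
    moreover have "poly_act ?M (q * [:-z, 1:]) v = 0" using Suc.prems(3) q by (simp add: mult.commute)
    ultimately have w: "poly_act ?M q w = 0" by (simp only: poly_act_mult)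
    have "is_exp_poly (flow_spectrum \<phi>) (\<lambda>t. (complex_matrix (flow_map \<phi> t) *v w) $ i)"
      by (rule Suc.hyps(1)[OF dq q0 _ w]) (use Suc.prems(2) q in auto)
    then show ?case
    proof (rule is_exp_poly_ode[OF finite_flow_spectrum Suc.prems(2)[OF z]])
      fix t
      have "?M *v v = z *s v + w" by (simp add: w_def)
      then have "(complex_matrix (flow_map \<phi> t) *v (?M *v v)) $ i =
          z * (complex_matrix (flow_map \<phi> t) *v v) $ i + (complex_matrix (flow_map \<phi> t) *v w) $ i"
        by (simp add: matrix_vector_right_distrib vector_scalar_commute)
      then show "((\<lambda>t. (complex_matrix (flow_map \<phi> t) *v v) $ i) has_vector_derivative
          z * (complex_matrix (flow_map \<phi> t) *v v) $ i + (complex_matrix (flow_map \<phi> t) *v w) $ i) (at t)"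
        using complex_flow_derivative[OF \<phi>, of v i t] by simp
    qed
  qed
  obtain p where "p \<noteq> 0" "\<And>v. poly_act ?M p v = 0" "\<And>z. poly p z = 0 \<Longrightarrow> z \<in> flow_spectrum \<phi>"
    using ex_annihilator_roots_eigenvalues[of ?M] unfolding mem_flow_spectrum by blast
  then show ?thesis using main by blast
qed

lemma complex_flow_eigenvector:
  assumes \<phi>: "linear_flow \<phi>" and v: "complex_matrix (generator \<phi>) *v v = z *s v"
  shows "(complex_matrix (flow_map \<phi> t) *v v) $ i = exp (z * of_real t) * v $ i"
proof -
  define y where "y t = (complex_matrix (flow_map \<phi> t) *v v) $ i" for t
  define w where "w t = y t * exp (- z * of_real t)" for t
  have y': "(y has_vector_derivative z * y t) (at t)" for t
    using complex_flow_derivative[OF \<phi>, of v i t] by (simp add: y_def[abs_def] v vector_scalar_commute)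
  have "(w has_vector_derivative 0) (at t)" for t
  proof -
    have "((\<lambda>t. exp (- z * of_real t)) has_vector_derivative exp (- z * of_real t) * (- z)) (at t)"
      by (rule has_vector_derivative_real_field) (auto intro!: derivative_eq_intros)
    from has_vector_derivative_mult[OF y' this]
    show ?thesis unfolding w_def[abs_def] by (simp add: algebra_simps)
  qed
  then obtain c where "\<And>t. w t = c"
    using has_vector_derivative_zero_constant[of UNIV w] by auto
  then have "w t = w 0" by simp
  moreover have "w 0 = v $ i" by (simp add: w_def y_def flow_map_0[OF \<phi>] complex_matrix_id)
  moreover have "w t * exp (z * of_real t) = y t * (exp (- z * of_real t) * exp (z * of_real t))" by (simp add: w_def)
  then have "w t * exp (z * of_real t) = y t" by (simp flip: exp_add)
  ultimately show ?thesis by (simp add: y_def mult.commute)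
qed

lemma flow_observable_exp_poly:
  fixes \<phi> :: "real \<Rightarrow> real ^ 'n \<Rightarrow> real ^ 'n" and H :: "((real ^ 'n) \<Rightarrow>\<^sub>L (real ^ 'n)) \<Rightarrow> real"
  assumes \<phi>: "linear_flow \<phi>" and H: "linear H"
  shows "is_exp_poly (flow_spectrum \<phi>) (\<lambda>t. of_real (H (flow_map \<phi> t)))"
proof -
  define E where "E i j = Blinfun (\<lambda>x :: real ^ 'n. x $ j *\<^sub>R axis i (1::real))" for i j :: 'n
  have E: "blinfun_apply (E i j) x = x $ j *\<^sub>R axis i 1" for i j x
    unfolding E_def by (subst bounded_linear_Blinfun_apply) (auto intro!: bounded_linear_intros bounded_linear_vec_nth)
  have expand: "B = (\<Sum>i\<in>UNIV. \<Sum>j\<in>UNIV. (blinfun_apply B (axis j 1) $ i) *\<^sub>R E i j)"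
    for B :: "(real ^ 'n) \<Rightarrow>\<^sub>L (real ^ 'n)"
  proof (rule blinfun_eqI)
    fix x :: "real ^ 'n"
    have lin: "linear (blinfun_apply B)" by (simp add: bounded_linear.linear blinfun.bounded_linear_right)
    have "blinfun_apply B x = blinfun_apply B (\<Sum>j\<in>UNIV. x $ j *s axis j 1)" by (simp only: basis_expansion)
    also have "\<dots> = (\<Sum>j\<in>UNIV. x $ j *\<^sub>R blinfun_apply B (axis j 1))"
      by (simp add: linear_sum[OF lin] linear_scale[OF lin] scalar_mult_eq_scaleR)
    also have "\<dots> = (\<Sum>j\<in>UNIV. \<Sum>i\<in>UNIV. (blinfun_apply B (axis j 1) $ i) *\<^sub>R blinfun_apply (E i j) x)"
    proof (intro sum.cong refl)
      fix j
      have "blinfun_apply B (axis j 1) = (\<Sum>i\<in>UNIV. blinfun_apply B (axis j 1) $ i *s axis i 1)"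
        by (simp only: basis_expansion)
      then have "x $ j *\<^sub>R blinfun_apply B (axis j 1) = x $ j *\<^sub>R (\<Sum>i\<in>UNIV. blinfun_apply B (axis j 1) $ i *s axis i 1)"
        by simp
      then show "x $ j *\<^sub>R blinfun_apply B (axis j 1) = (\<Sum>i\<in>UNIV. (blinfun_apply B (axis j 1) $ i) *\<^sub>R blinfun_apply (E i j) x)"
        by (simp add: E scaleR_sum_right scalar_mult_eq_scaleR mult.commute)
    qed
    also have "\<dots> = (\<Sum>i\<in>UNIV. \<Sum>j\<in>UNIV. (blinfun_apply B (axis j 1) $ i) *\<^sub>R blinfun_apply (E i j) x)"
      by (rule sum.swap)
    finally show "blinfun_apply B x = blinfun_apply (\<Sum>i\<in>UNIV. \<Sum>j\<in>UNIV. (blinfun_apply B (axis j 1) $ i) *\<^sub>R E i j) x"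
      by (simp add: blinfun.sum_left blinfun.scaleR_left)
  qed
  have "complex_of_real (H (flow_map \<phi> t)) =
      (\<Sum>i\<in>UNIV. \<Sum>j\<in>UNIV. of_real (H (E i j)) * (complex_matrix (flow_map \<phi> t) *v axis j 1) $ i)" for t
  proof -
    have "H (flow_map \<phi> t) = (\<Sum>i\<in>UNIV. \<Sum>j\<in>UNIV. (blinfun_apply (flow_map \<phi> t) (axis j 1) $ i) * H (E i j))"
      by (subst expand[of "flow_map \<phi> t"]) (simp add: linear_sum[OF H] linear_scale[OF H])
    moreover have "(complex_matrix (flow_map \<phi> t) *v axis j 1) $ i = of_real (blinfun_apply (flow_map \<phi> t) (axis j 1) $ i)" for i j
      by (simp only: matrix_vector_axis complex_matrix_nth)
    ultimately show ?thesis by (simp add: mult.commute)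
  qed
  moreover have "is_exp_poly (flow_spectrum \<phi>) (\<lambda>t. \<Sum>i\<in>UNIV. \<Sum>j\<in>UNIV. of_real (H (E i j)) * (complex_matrix (flow_map \<phi> t) *v axis j 1) $ i)"
    by (intro is_exp_poly_sum is_exp_poly_mult_left complex_flow_component_exp_poly \<phi>)
  ultimately show ?thesis by simp
qed

lemma cnj_mem_flow_spectrum:
  assumes "z \<in> flow_spectrum \<phi>" shows "cnj z \<in> flow_spectrum \<phi>"
proof -
  obtain v where v: "v \<noteq> 0" "complex_matrix (generator \<phi>) *v v = z *s v"
    using assms by (auto simp: mem_flow_spectrum)
  define w where "w = (\<chi> i. cnj (v $ i))"
  have "w \<noteq> 0" using v(1) by (auto simp: w_def vec_eq_iff)
  moreover have "(complex_matrix (generator \<phi>) *v w) $ i = (cnj z *s w) $ i" for i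
  proof -
    have "(complex_matrix (generator \<phi>) *v w) $ i = cnj ((complex_matrix (generator \<phi>) *v v) $ i)"
      by (simp add: matrix_vector_mult_def w_def complex_matrix_nth)
    then show ?thesis by (simp add: v(2) w_def)
  qed
  ultimately show ?thesis unfolding mem_flow_spectrum by (intro exI[of _ w]) (simp add: vec_eq_iff)
qed

text \<open>A suitable multiple of one coordinate of the orbit of an eigenvector for \<open>z\<close> equals \<open>exp (z t)\<close>.\<close>

lemma ex_observable:
  fixes \<phi> :: "real \<Rightarrow> real ^ 'n \<Rightarrow> real ^ 'n"
  assumes \<phi>: "linear_flow \<phi>" and Z: "Z \<subseteq> flow_spectrum \<phi>"
  shows "\<exists>H :: ((real ^ 'n) \<Rightarrow>\<^sub>L (real ^ 'n)) \<Rightarrow> real. linear H \<and>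
    (\<forall>t. H (flow_map \<phi> t) = Re (\<Sum>z\<in>Z. a z * exp (z * of_real t)))"
proof -
  have "\<forall>z\<in>flow_spectrum \<phi>. \<exists>v. v \<noteq> 0 \<and> complex_matrix (generator \<phi>) *v v = z *s v"
    by (simp add: mem_flow_spectrum)
  from bchoice[OF this] obtain v where v: "\<And>z. z \<in> flow_spectrum \<phi> \<Longrightarrow> v z \<noteq> 0 \<and> complex_matrix (generator \<phi>) *v v z = z *s v z"
    by blast
  then have "\<exists>i. v z $ i \<noteq> 0" if "z \<in> flow_spectrum \<phi>" for z using that by (auto simp: vec_eq_iff)
  then obtain i where i: "\<And>z. z \<in> flow_spectrum \<phi> \<Longrightarrow> v z $ i z \<noteq> 0" by metis
  define H where "H B = Re (\<Sum>z\<in>Z. a z / v z $ i z * (complex_matrix B *v v z) $ i z)" for B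
  have "bounded_linear H"
    unfolding H_def
    by (intro bounded_linear_compose[OF bounded_linear_Re] bounded_linear_sum
        bounded_linear_compose[OF bounded_linear_mult_right] bounded_linear_complex_matrix_component)
  then have "linear H" by (rule bounded_linear.linear)
  moreover have "H (flow_map \<phi> t) = Re (\<Sum>z\<in>Z. a z * exp (z * of_real t))" for t
    unfolding H_def
  proof (intro arg_cong[of _ _ Re] sum.cong refl)
    fix z assume "z \<in> Z"
    then have "z \<in> flow_spectrum \<phi>" using Z by blast
    then show "a z / v z $ i z * (complex_matrix (flow_map \<phi> t) *v v z) $ i z = a z * exp (z * of_real t)"
      using complex_flow_eigenvector[OF \<phi>, of "v z" z t "i z"] v[of z] i[of z] by simp
  qed
  ultimately show ?thesis by blast
qed

section \<open>Consequences of the Benford property\<close>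

text \<open>The character \<open>x \<mapsto> \<bar>x\<bar> powr (i \<beta>)\<close> of the multiplicative group, extended by \<open>0\<close>.\<close>

definition log_char :: "real \<Rightarrow> real \<Rightarrow> complex" where
  "log_char \<beta> x = (if x = 0 then 0 else cis (\<beta> * ln \<bar>x\<bar>))"

lemma log_char_mult: "log_char \<beta> (x * y) = log_char \<beta> x * log_char \<beta> y"
  by (auto simp: log_char_def abs_mult ln_mult cis_mult distrib_left)

lemma norm_log_char_le: "norm (log_char \<beta> x) \<le> 1"
  by (simp add: log_char_def)

lemma log_char_exp [simp]: "log_char \<beta> (exp x) = cis (\<beta> * x)"
  by (simp add: log_char_def)

lemma log_char_minus: "log_char \<beta> (- x) = log_char \<beta> x"
  by (simp add: log_char_def)

lemma borel_measurable_log_char [measurable]: "log_char \<beta> \<in> borel_measurable borel"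
  unfolding log_char_def[abs_def] by measurable

lemma bdd_borel_log_char: "f \<in> borel_measurable borel \<Longrightarrow> bdd_borel (\<lambda>t. log_char \<beta> (f t))"
  by (rule bdd_borelI[of _ 1]) (auto simp: norm_log_char_le)

lemma sum_roots_of_unity:
  fixes N n :: nat
  assumes "0 < N" "N < n" shows "(\<Sum>j<n. cis (2 * pi * (real N * (Suc j / n)))) = 0"
proof -
  define z where "z = cis (2 * pi * (N / n))"
  have zpow: "cis (2 * pi * (N * (Suc j / n))) = z * z ^ j" for j
    unfolding z_def Complex.DeMoivre cis_mult
    by (rule arg_cong[of _ _ cis]) (simp add: add_divide_distrib algebra_simps)
  have "z ^ n = cis (2 * pi * real N)"
    unfolding z_def Complex.DeMoivre by (rule arg_cong[of _ _ cis]) (use assms in simp)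
  then have zn: "z ^ n = 1" using cis_multiple_2pi[of "real N"] by simp
  have "z \<noteq> 1"
  proof
    assume "z = 1"
    then have "cis (2 * pi * (N / n)) = cis (2 * pi * 0)" by (simp add: z_def)
    then have "real N / n = 0" by (rule cis_2pi_inj) (use assms in auto)
    then show False using assms by simp
  qed
  then have "(\<Sum>j<n. z ^ j) = 0" using zn by (simp add: geometric_sum)
  then show ?thesis unfolding zpow sum_distrib_left[symmetric] by simp
qed

text \<open>For a Benford function the fractional part \<open>L\<close> of \<open>log b \<bar>f\<bar>\<close> is uniformly distributed, and the function
  in question is \<open>cis (2 \<pi> N L)\<close>. It is approximated by the step function \<open>G\<close> that replaces \<open>L\<close> by the right
  end point of its cell in the partition of \<open>[0, 1]\<close> into \<open>n\<close> equal cells; the mean of \<open>G\<close> tends to a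
  vanishing sum of roots of unity.\<close>

lemma benford_imp_mean_zero_log_char:
  assumes b: "b \<ge> 2" and f: "f \<in> borel_measurable borel" and ben: "benford b f" and N: "N > 0"
  shows "mean_zero (\<lambda>t. log_char (2 * pi * real N / ln b) (f t))"
proof (rule mean_zero_approx[OF bdd_borel_log_char[OF f]])
  fix \<eta> :: real assume \<eta>: "\<eta> > 0"
  obtain n :: nat where n': "2 * pi * N / \<eta> + N < n" using reals_Archimedean2 by blast
  have "2 * pi * N / \<eta> > 0" using \<eta> N by simp
  then have nN: "N < n" and n: "2 * pi * N / \<eta> < n" using n' by linarith+
  have n0: "n > 0" using nN by simp
  have step: "2 * pi * N * (1 / n) \<le> \<eta>" using n \<eta> n0 by (simp add: field_simps)
  define L where "L t = frac (log b \<bar>f t\<bar>)" for t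
  define A where "A j = (if j < n then {t. significand b (f t) \<le> real b powr (j / n)} else UNIV)" for j
  have pw: "real b powr (j / n) \<in> {1..<real b}" if "j < n" for j
    using b that powr_less_mono[of "j / n" 1 "real b"] by (auto intro!: ge_one_powr_ge_zero)
  have A_iff: "t \<in> A j \<longleftrightarrow> f t = 0 \<or> L t \<le> j / n" if "j \<le> n" for t j
  proof (cases "j < n")
    case True
    then show ?thesis using b significand_le_iff[OF b, of "real b powr (j / n)" "f t"] pw[OF True]
      by (simp add: A_def L_def)
  next
    case False
    then show ?thesis using that frac_lt_1[of "log b \<bar>f t\<bar>"] n0 by (simp add: A_def L_def less_imp_le)
  qed
  have mA: "A j \<in> sets borel" for j
  proof (cases "j < n")
    case True
    have "real b powr (j / n) \<ge> 1" using pw[OF True] by (simp only: atLeastLessThan_iff)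
    then show ?thesis unfolding A_def if_P[OF True] by (rule sets_significand_le[OF b _ f])
  next
    case False
    then show ?thesis unfolding A_def if_not_P[OF False] by simp
  qed
  have dens: "((\<lambda>T. time_mean (indicat_real (A j)) T) \<longlongrightarrow> j / n) at_top" if "j \<le> n" for j
  proof (cases "j < n")
    case True
    have "((\<lambda>T. measure lborel {t \<in> {0..T}. significand b (f t) \<le> real b powr (j / n)} / T) \<longlongrightarrow> log b (real b powr (j / n))) at_top"
      by (rule ben[unfolded benford_def, THEN conjunct2, rule_format, OF pw[OF True]])
    moreover have "{t \<in> {0..T}. significand b (f t) \<le> real b powr (j / n)} = A j \<inter> {0..T}" for T
      using True by (auto simp: A_def)
    ultimately show ?thesis using b by (simp add: time_mean_indicat[OF mA])
  next
    case False
    then have "j = n" using that by simp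
    have "\<forall>\<^sub>F T in at_top. time_mean (indicat_real (A j)) T = j / n"
      using eventually_gt_at_top[of 0]
    proof eventually_elim
      case (elim T)
      then show ?case using time_mean_const[OF elim, of "1::real"] \<open>j = n\<close> n0 by (simp add: A_def indicator_def[abs_def])
    qed
    then show ?thesis by (rule tendsto_eventually)
  qed
  define G where "G t = (\<Sum>j<n. cis (2 * pi * (N * (Suc j / n))) * of_real (indicat_real (A (Suc j)) t - indicat_real (A j) t))" for t
  have bG: "bdd_borel G"
    unfolding G_def by (intro bdd_borel_intros mA)
  have "((\<lambda>T. \<Sum>j<n. cis (2 * pi * (N * (Suc j / n))) * of_real (time_mean (indicat_real (A (Suc j))) T - time_mean (indicat_real (A j)) T))
      \<longlongrightarrow> (\<Sum>j<n. cis (2 * pi * (N * (Suc j / n))) * of_real (Suc j / n - j / n))) at_top"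
    by (intro tendsto_sum tendsto_mult tendsto_const tendsto_of_real tendsto_diff dens) auto
  moreover have "(\<Sum>j<n. cis (2 * pi * (N * (Suc j / n))) * of_real (Suc j / n - j / n)) = 0"
  proof -
    have "complex_of_real (Suc j / n - j / n) = of_real (1 / n)" for j
      by (simp add: diff_divide_distrib[symmetric])
    then show ?thesis
      unfolding sum_distrib_right[symmetric] using sum_roots_of_unity[OF N nN]
      by (simp only: sum_distrib_right[symmetric] mult_zero_left)
  qed
  moreover have "time_mean G T = (\<Sum>j<n. cis (2 * pi * (N * (Suc j / n))) * of_real (time_mean (indicat_real (A (Suc j))) T - time_mean (indicat_real (A j)) T))" for T
    unfolding G_def
    by (subst time_mean_sum)
      (auto intro!: bdd_borel_intros mA simp: time_mean_mult_left time_mean_of_real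
        time_mean_diff[OF bdd_borel_indicat[OF mA] bdd_borel_indicat[OF mA]] simp del: of_real_diff)
  ultimately have "((\<lambda>T. time_mean G T) \<longlongrightarrow> 0) at_top" by (simp only:)
  then have mG: "mean_zero G" by (simp add: mean_zero_def)
  have "\<forall>\<^sub>F T in at_top. time_mean (indicat_real (A 0)) T < \<eta>"
    by (rule order_tendstoD(2)[OF dens]) (use \<eta> in auto)
  then have small: "\<forall>\<^sub>F T in at_top. measure lborel (A 0 \<inter> {0..T}) / T \<le> \<eta>"
    unfolding time_mean_indicat[OF mA] by (rule eventually_mono) simp
  have close: "norm (log_char (2 * pi * real N / ln b) (f t) - G t) \<le> \<eta> + 2 * indicat_real (A 0) t" for t
  proof (cases "t \<in> A 0")
    case True
    then have "t \<in> A j" if "j \<le> n" for j using A_iff[of 0 t] A_iff[OF that, of t] order_trans[of "L t" 0 "j / n"] by auto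
    then have "G t = 0" unfolding G_def by (intro sum.neutral) auto
    then show ?thesis using True \<eta> norm_log_char_le[of "2 * pi * real N / ln b" "f t"] by simp
  next
    case False
    then have ft: "f t \<noteq> 0" and L0: "L t > 0" using A_iff[of 0 t] by auto
    have L1: "L t < 1" by (simp add: L_def frac_lt_1)
    define j where "j = nat (\<lceil>n * L t\<rceil> - 1)"
    have "0 < n * L t" "n * L t \<le> n" using L0 L1 n0 by (auto simp: mult_le_cancel_left1)
    then have c: "0 < \<lceil>n * L t\<rceil>" "\<lceil>n * L t\<rceil> \<le> int n" by (simp_all only: zero_less_ceiling ceiling_le_iff of_int_of_nat_eq)
    have j: "j < n" "real (Suc j) = of_int \<lceil>n * L t\<rceil>" unfolding j_def using c by linarith+
    have j1: "real j < n * L t" "n * L t \<le> real (Suc j)" using j(2) by linarith+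
    have mem: "t \<in> A i \<longleftrightarrow> Suc j \<le> i" if "i \<le> n" for i
    proof -
      have "t \<in> A i \<longleftrightarrow> n * L t \<le> i" using A_iff[OF that, of t] ft n0 by (simp add: field_simps)
      also have "\<dots> \<longleftrightarrow> Suc j \<le> i" using j1 by (simp add: Suc_le_eq) linarith
      finally show ?thesis .
    qed
    have "G t = (\<Sum>i<n. if i = j then cis (2 * pi * (N * (Suc j / n))) else 0)"
      unfolding G_def
    proof (rule sum.cong[OF refl])
      fix i assume "i \<in> {..<n}"
      then show "cis (2 * pi * (N * (Suc i / n))) * of_real (indicat_real (A (Suc i)) t - indicat_real (A i) t) =
          (if i = j then cis (2 * pi * (N * (Suc j / n))) else 0)"
        using mem[of i] mem[of "Suc i"] by (auto simp: indicator_def)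
    qed
    then have "G t = cis (2 * pi * (N * (Suc j / n)))" using j(1) by simp
    moreover have "log_char (2 * pi * real N / ln b) (f t) = cis (2 * pi * (N * L t))"
      unfolding L_def cis_log_eq_frac[OF b, symmetric] using ft by (simp add: log_char_def)
    ultimately have "norm (log_char (2 * pi * real N / ln b) (f t) - G t) \<le> \<bar>2 * pi * (N * L t) - 2 * pi * (N * (Suc j / n))\<bar>"
      by (simp only: norm_cis_diff_le)
    also have "\<dots> = 2 * pi * N * \<bar>L t - Suc j / n\<bar>"
    proof -
      have "2 * pi * (real N * L t) - 2 * pi * (real N * y) = 2 * pi * real N * (L t - y)" for y
        by (simp add: algebra_simps)
      then show ?thesis by (simp only: abs_mult abs_of_nat abs_numeral abs_of_pos[OF pi_gt_zero])
    qed
    also have "\<dots> \<le> 2 * pi * N * (1 / n)"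
    proof (rule mult_left_mono)
      have "L t \<le> Suc j / n" "Suc j / n - 1 / n < L t"
        using j1 n0 by (auto simp: field_simps)
      then show "\<bar>L t - Suc j / n\<bar> \<le> 1 / n" by linarith
    qed simp
    also have "\<dots> \<le> \<eta>" by (rule step)
    finally show ?thesis using False by simp
  qed
  show "\<exists>G E. bdd_borel G \<and> mean_zero G \<and> E \<in> sets borel \<and>
      (\<forall>\<^sub>F t in at_top. norm (log_char (2 * pi * real N / ln b) (f t) - G t) \<le> \<eta> + 2 * indicat_real E t) \<and>
      (\<forall>\<^sub>F T in at_top. measure lborel (E \<inter> {0..T}) / T \<le> \<eta>)"
    using bG mG mA[of 0] close small by (intro exI[of _ G] exI[of _ "A 0"]) auto
qed

section \<open>Averaging over Gaussian coefficients\<close>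

definition gauss_char_mean :: "real \<Rightarrow> complex" where
  "gauss_char_mean \<beta> = (LINT x|lborel. std_normal_density x *\<^sub>R log_char \<beta> x)"

lemma integrable_std_normal_log_char: "integrable lborel (\<lambda>x. std_normal_density x *\<^sub>R log_char \<beta> x)"
proof (rule Bochner_Integration.integrable_bound[OF integrable_normal_moment[of 1 0 0]])
  show "AE x in lborel. norm (std_normal_density x *\<^sub>R log_char \<beta> x) \<le> norm (std_normal_density x * (x - 0) ^ 0)"
    using norm_log_char_le[of \<beta>] by (intro AE_I2) (auto simp: mult_left_le)
qed auto

text \<open>The substitution \<open>t = x\<^sup>2 / 2\<close> turns the integral over the positive half-line into a nonzero multiple of
  \<open>Gamma ((1 + i \<beta>) / 2)\<close>, and the Gamma function has no zeros.\<close>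

lemma gauss_char_mean_nonzero: "gauss_char_mean \<beta> \<noteq> 0"
proof
  assume zero: "gauss_char_mean \<beta> = 0"
  define z where "z = (1 + \<i> * of_real \<beta>) / 2"
  have z: "Re z > 0" by (simp add: z_def)
  define f where "f t = complex_of_real t powr (z - 1) / of_real (exp t)" for t
  define c where "c = exp (- (z - 1) * of_real (ln 2))"
  define k where "k x = exp (- x\<^sup>2 / 2) *\<^sub>R log_char \<beta> x" for x
  have img: "(\<lambda>x::real. x\<^sup>2 / 2) ` {0<..} = {0<..}"
  proof (intro equalityI subsetI)
    fix t :: real assume t: "t \<in> {0<..}"
    then have "t = (sqrt (2 * t))\<^sup>2 / 2" by simp
    then show "t \<in> (\<lambda>x. x\<^sup>2 / 2) ` {0<..}" using t by (intro image_eqI[of _ _ "sqrt (2 * t)"]) auto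
  qed auto
  have "f absolutely_integrable_on (\<lambda>x. x\<^sup>2 / 2) ` {0<..}" "integral ((\<lambda>x. x\<^sup>2 / 2) ` {0<..}) f = Gamma z"
    unfolding img f_def using absolutely_integrable_Gamma_integral'[OF z] integral_unique[OF Gamma_integral_complex'[OF z]] by auto
  moreover have "inj_on (\<lambda>x::real. x\<^sup>2 / 2) {0<..}"
    by (rule inj_onI) simp
  moreover have "((\<lambda>x. x\<^sup>2 / 2) has_field_derivative x) (at x within {0<..})" for x :: real
    by (auto intro!: derivative_eq_intros)
  ultimately have ai: "(\<lambda>x. \<bar>x\<bar> *\<^sub>R f (x\<^sup>2 / 2)) absolutely_integrable_on {0<..}"
    and int: "integral {0<..} (\<lambda>x. \<bar>x\<bar> *\<^sub>R f (x\<^sup>2 / 2)) = Gamma z"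
    using has_absolute_integral_change_of_variables_real[of "{0<..}" "\<lambda>x. x\<^sup>2 / 2" "\<lambda>x. x" f "Gamma z"] by auto
  have eq: "\<bar>x\<bar> *\<^sub>R f (x\<^sup>2 / 2) = c * k x" if "x > 0" for x
  proof -
    have "complex_of_real (x\<^sup>2 / 2) powr (z - 1) = exp ((z - 1) * of_real (ln (x\<^sup>2 / 2)))"
    proof -
      have "Ln (complex_of_real (x\<^sup>2 / 2)) = of_real (ln (x\<^sup>2 / 2))" by (rule Ln_of_real) (use that in simp)
      then show ?thesis unfolding powr_def using that by simp
    qed
    also have "ln (x\<^sup>2 / 2) = 2 * ln x - ln 2" using that by (simp add: ln_div ln_realpow)
    also have "exp ((z - 1) * of_real (2 * ln x - ln 2)) = exp ((\<i> * of_real \<beta> - 1) * of_real (ln x)) * c"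
      unfolding c_def exp_add[symmetric] by (rule arg_cong[of _ _ exp]) (simp add: z_def field_simps)
    also have "exp ((\<i> * of_real \<beta> - 1) * of_real (ln x)) = exp (\<i> * of_real (\<beta> * ln x)) * exp (- of_real (ln x))"
      unfolding exp_add[symmetric] by (rule arg_cong[of _ _ exp]) (simp add: algebra_simps)
    also have "exp (- complex_of_real (ln x)) = of_real (1 / x)"
      using that by (simp add: exp_minus exp_of_real field_simps flip: of_real_exp)
    finally have "f (x\<^sup>2 / 2) = cis (\<beta> * ln x) * of_real (1 / x) * c / of_real (exp (x\<^sup>2 / 2))"
      by (simp add: f_def cis_conv_exp)
    moreover have "k x = of_real (inverse (exp (x\<^sup>2 / 2))) * cis (\<beta> * ln x)"
      unfolding k_def log_char_def scaleR_conv_of_real minus_divide_left[symmetric] exp_minus using that by simp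
    moreover have "of_real x * (u * of_real (1 / x) * c / of_real e) = c * (of_real (inverse e) * u)" for u :: complex and e
      using that by (simp add: divide_inverse)
    ultimately show ?thesis using that by (simp only: scaleR_conv_of_real abs_of_pos)
  qed
  have [measurable]: "k \<in> borel_measurable borel" unfolding k_def by measurable
  have "integral {0<..} (\<lambda>x. \<bar>x\<bar> *\<^sub>R f (x\<^sup>2 / 2)) = (LINT x:{0<..}|lebesgue. \<bar>x\<bar> *\<^sub>R f (x\<^sup>2 / 2))"
    by (rule set_lebesgue_integral_eq_integral(2)[OF ai, symmetric])
  also have "\<dots> = (LINT x|lebesgue. c * (indicat_real {0<..} x *\<^sub>R k x))"
    unfolding set_lebesgue_integral_def by (intro Bochner_Integration.integral_cong) (use eq in \<open>auto simp: indicator_def\<close>)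
  also have "\<dots> = (LINT x|lborel. c * (indicat_real {0<..} x *\<^sub>R k x))"
    by (rule integral_completion) measurable
  finally have half: "Gamma z = c * (LINT x|lborel. indicat_real {0<..} x *\<^sub>R k x)"
    by (simp only: int integral_mult_right_zero)
  have kd: "std_normal_density x *\<^sub>R log_char \<beta> x = (1 / sqrt (2 * pi)) *\<^sub>R k x" for x
    by (simp add: k_def std_normal_density_def)
  have "integrable lborel (\<lambda>x. sqrt (2 * pi) *\<^sub>R (std_normal_density x *\<^sub>R log_char \<beta> x))"
    by (intro integrable_scaleR_right integrable_std_normal_log_char)
  then have ik: "integrable lborel k" unfolding kd by simp
  have "integrable lborel (\<lambda>x. indicat_real {0..} x *\<^sub>R k x)"
    by (rule integrable_mult_indicator[OF _ ik]) simp
  then have "has_bochner_integral lborel (\<lambda>x. indicat_real {0..} x *\<^sub>R k x) (LINT x|lborel. indicat_real {0..} x *\<^sub>R k x)"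
    by (rule has_bochner_integral_integrable)
  from has_bochner_integral_even_function[OF this]
  have "(LINT x|lborel. k x) = 2 *\<^sub>R (LINT x|lborel. indicat_real {0..} x *\<^sub>R k x)"
    by (simp add: has_bochner_integral_integral_eq k_def log_char_minus)
  moreover have "(LINT x|lborel. k x) = 0"
    using zero by (simp add: gauss_char_mean_def kd)
  moreover have "(LINT x|lborel. indicat_real {0..} x *\<^sub>R k x) = (LINT x|lborel. indicat_real {0<..} x *\<^sub>R k x)"
    by (rule integral_cong_AE) (use AE_lborel_singleton[of 0] in \<open>auto simp: indicator_def elim!: eventually_mono\<close>)
  ultimately have "Gamma z = 0" using half by simp
  then show False using z by (auto simp: Gamma_eq_zero_iff elim!: nonpos_Ints_cases)
qed

abbreviation "std_normal \<equiv> density lborel std_normal_density"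

lemma prob_space_std_normal: "prob_space std_normal"
  by (rule prob_space_normal_density) simp

text \<open>A linear combination of independent standard normal variables is normal, with the Euclidean
  length of the coefficient vector as standard deviation, and \<open>log_char\<close> turns the scaling into a factor.
  The average is thus a smooth function of a nonzero coefficient vector, although \<open>log_char\<close> is
  singular at \<open>0\<close>.\<close>

lemma expectation_log_char_gauss:
  fixes p :: "'i \<Rightarrow> real"
  assumes I: "finite I" and pos: "(\<Sum>i\<in>I. (p i)\<^sup>2) > 0"
  shows "(LINT \<omega>|PiM I (\<lambda>_. std_normal). log_char \<beta> (\<Sum>i\<in>I. p i * \<omega> i)) =
    cis (\<beta> / 2 * ln (\<Sum>i\<in>I. (p i)\<^sup>2)) * gauss_char_mean \<beta>"
proof -
  let ?M = "PiM I (\<lambda>_. std_normal)"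
  interpret N: prob_space std_normal by (rule prob_space_std_normal)
  interpret M: prob_space ?M by (rule prob_space_PiM) (rule prob_space_std_normal)
  \<comment> \<open>vanishing coefficients would give degenerate normal variables\<close>
  define J where "J = {i\<in>I. p i \<noteq> 0}"
  have "\<exists>i\<in>I. p i \<noteq> 0"
  proof (rule ccontr)
    assume "\<not> ?thesis"
    then have "(\<Sum>i\<in>I. (p i)\<^sup>2) = 0" by (intro sum.neutral) auto
    then show False using pos by simp
  qed
  then have J: "finite J" "J \<noteq> {}" "J \<subseteq> I" using I by (auto simp: J_def)
  have meas: "(\<lambda>\<omega>. \<omega> i) \<in> borel_measurable ?M" if "i \<in> I" for i
    using measurable_component_singleton[OF that, of "\<lambda>_. std_normal"] by (simp cong: measurable_cong_sets)
  have dX: "distributed ?M lborel (\<lambda>\<omega>. \<omega> i) std_normal_density" if "i \<in> I" for i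
    unfolding distributed_def
  proof (intro conjI)
    have "distr ?M lborel (\<lambda>\<omega>. \<omega> i) = distr ?M std_normal (\<lambda>\<omega>. \<omega> i)" by (intro distr_cong) auto
    also have "\<dots> = std_normal" by (rule distr_PiM_component) (use that I prob_space_std_normal in auto)
    finally show "distr ?M lborel (\<lambda>\<omega>. \<omega> i) = density lborel (\<lambda>x. ennreal (std_normal_density x))" .
  qed (use meas[OF that] in auto)
  have indepI: "M.indep_vars (\<lambda>_. borel) (\<lambda>i \<omega>. \<omega> i) I"
  proof (subst M.indep_vars_iff_distr_eq_PiM')
    show "I \<noteq> {}" using J by auto
    have "distr ?M (PiM I (\<lambda>_. borel)) (\<lambda>\<omega>. \<lambda>i\<in>I. \<omega> i) = distr ?M ?M (\<lambda>\<omega>. \<omega>)"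
    proof (rule distr_cong)
      show "sets (PiM I (\<lambda>_. borel)) = sets ?M" by (rule sets_PiM_cong) auto
      show "(\<lambda>i\<in>I. \<omega> i) = \<omega>" if "\<omega> \<in> space ?M" for \<omega> :: "'i \<Rightarrow> real"
        using that by (auto simp: space_PiM PiE_def extensional_restrict)
    qed simp
    also have "\<dots> = ?M" by (rule distr_id)
    also have "?M = PiM I (\<lambda>i. distr ?M borel (\<lambda>\<omega>. \<omega> i))"
    proof (rule PiM_cong[OF refl])
      fix i assume i: "i \<in> I"
      have "distr ?M borel (\<lambda>\<omega>. \<omega> i) = distr ?M lborel (\<lambda>\<omega>. \<omega> i)" by (intro distr_cong) auto
      then show "std_normal = distr ?M borel (\<lambda>\<omega>. \<omega> i)" using dX[OF i] by (simp add: distributed_def)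
    qed
    finally show "distr ?M (PiM I (\<lambda>_. borel)) (\<lambda>\<omega>. \<lambda>i\<in>I. \<omega> i) = PiM I (\<lambda>i. distr ?M borel (\<lambda>\<omega>. \<omega> i))" .
  qed (use meas in auto)
  have indep: "M.indep_vars (\<lambda>_. borel) (\<lambda>i \<omega>. p i * \<omega> i) J"
    by (rule M.indep_vars_compose2[OF M.indep_vars_subset[OF indepI J(3)]]) auto
  have dp: "distributed ?M lborel (\<lambda>\<omega>. p i * \<omega> i) (normal_density 0 \<bar>p i\<bar>)" if "i \<in> J" for i
    using M.normal_density_affine[OF dX, of i "p i" 0] that by (auto simp: J_def)
  define R where "R = sqrt (\<Sum>i\<in>I. (p i)\<^sup>2)"
  have R: "R > 0" using pos by (simp add: R_def)
  have sq: "(\<Sum>i\<in>J. \<bar>p i\<bar>\<^sup>2) = (\<Sum>i\<in>I. (p i)\<^sup>2)"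
    unfolding J_def using I by (intro sum.mono_neutral_cong_left) auto
  have sm: "(\<Sum>i\<in>J. p i * \<omega> i) = (\<Sum>i\<in>I. p i * \<omega> i)" for \<omega>
    unfolding J_def using I by (intro sum.mono_neutral_cong_left) auto
  have "distributed ?M lborel (\<lambda>\<omega>. \<Sum>i\<in>J. p i * \<omega> i) (normal_density (\<Sum>i\<in>J. 0) (sqrt (\<Sum>i\<in>J. \<bar>p i\<bar>\<^sup>2)))"
    by (rule M.sum_indep_normal[OF J(1,2) indep]) (use dp in \<open>auto simp: J_def\<close>)
  then have dist: "distributed ?M lborel (\<lambda>\<omega>. \<Sum>i\<in>I. p i * \<omega> i) (normal_density 0 R)"
    by (simp only: sq sm sum.neutral_const R_def)
  have "(LINT \<omega>|?M. log_char \<beta> (\<Sum>i\<in>I. p i * \<omega> i)) = (LINT x|distr ?M lborel (\<lambda>\<omega>. \<Sum>i\<in>I. p i * \<omega> i). log_char \<beta> x)"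
    by (rule integral_distr[symmetric]) (use meas in auto)
  also have "\<dots> = (LINT x|density lborel (normal_density 0 R). log_char \<beta> x)"
    using dist by (simp add: distributed_def)
  also have "\<dots> = (LINT x|lborel. normal_density 0 R x *\<^sub>R log_char \<beta> x)"
    by (rule integral_density) auto
  also have "\<dots> = \<bar>R\<bar> *\<^sub>R (LINT x|lborel. normal_density 0 R (0 + R * x) *\<^sub>R log_char \<beta> (0 + R * x))"
    by (rule lborel_integral_real_affine) (use R in simp)
  also have "\<dots> = (LINT x|lborel. log_char \<beta> R * (std_normal_density x *\<^sub>R log_char \<beta> x))"
    unfolding integral_scaleR_right[symmetric]
  proof (rule Bochner_Integration.integral_cong[OF refl])
    fix x
    have "R * normal_density 0 R (R * x) = std_normal_density x"
      using R by (simp add: normal_density_def real_sqrt_mult power_mult_distrib)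
    then show "\<bar>R\<bar> *\<^sub>R normal_density 0 R (0 + R * x) *\<^sub>R log_char \<beta> (0 + R * x) = log_char \<beta> R * (std_normal_density x *\<^sub>R log_char \<beta> x)"
      using R by (simp add: log_char_mult scaleR_conv_of_real flip: of_real_mult mult.assoc)
  qed
  also have "\<dots> = log_char \<beta> R * gauss_char_mean \<beta>"
    by (simp only: gauss_char_mean_def integral_mult_right_zero)
  also have "log_char \<beta> R = cis (\<beta> / 2 * ln (\<Sum>i\<in>I. (p i)\<^sup>2))"
    using pos R by (simp add: log_char_def R_def ln_sqrt)
  finally show ?thesis .
qed

text \<open>Fubini's theorem exchanges the two averages, and dominated convergence takes the limit under the
  expectation.\<close>

lemma mean_zero_expectation:
  fixes F :: "'a \<Rightarrow> real \<Rightarrow> complex"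
  assumes M: "prob_space M" and F: "(\<lambda>(x, t). F x t) \<in> borel_measurable (M \<Otimes>\<^sub>M borel)"
    and bound: "\<And>x t. norm (F x t) \<le> 1" and mz: "\<And>x. x \<in> space M \<Longrightarrow> mean_zero (F x)"
  shows "mean_zero (\<lambda>t. LINT x|M. F x t)"
proof -
  interpret M: prob_space M by fact
  interpret pair_sigma_finite M lborel by standard
  have F': "(\<lambda>(x, t). F x t) \<in> borel_measurable (M \<Otimes>\<^sub>M lborel)"
  proof -
    have "sets (M \<Otimes>\<^sub>M lborel) = sets (M \<Otimes>\<^sub>M (borel :: real measure))"
      by (intro sets_pair_measure_cong) simp_all
    then have "M \<Otimes>\<^sub>M lborel \<rightarrow>\<^sub>M (borel :: complex measure) = M \<Otimes>\<^sub>M (borel :: real measure) \<rightarrow>\<^sub>M borel"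
      by (rule measurable_cong_sets) (rule refl)
    then show ?thesis using F by (simp only:)
  qed
  have int: "integrable (M \<Otimes>\<^sub>M lborel) (\<lambda>(x, t). indicat_real {0..T} t *\<^sub>R F x t)" for T
  proof (rule Bochner_Integration.integrable_bound)
    show "integrable (M \<Otimes>\<^sub>M lborel) (indicat_real (space M \<times> {0..T}))"
      by (intro integrable_real_indicator) (auto simp: lborel.emeasure_pair_measure_Times M.emeasure_space_1 emeasure_lborel_Icc_eq)
    show "(\<lambda>(x, t). indicat_real {0..T} t *\<^sub>R F x t) \<in> borel_measurable (M \<Otimes>\<^sub>M lborel)"
      using F' by measurable
    show "AE x in M \<Otimes>\<^sub>M lborel. norm (case x of (x, t) \<Rightarrow> indicat_real {0..T} t *\<^sub>R F x t) \<le> norm (indicat_real (space M \<times> {0..T}) x)"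
      using bound by (intro AE_I2) (auto simp: indicator_def space_pair_measure)
  qed
  have fub: "time_mean (\<lambda>t. LINT x|M. F x t) T = (LINT x|M. time_mean (F x) T)" for T
  proof -
    have "(LINT t|lborel. (LINT x|M. indicat_real {0..T} t *\<^sub>R F x t)) = (LINT x|M. (LINT t|lborel. indicat_real {0..T} t *\<^sub>R F x t))"
      using Fubini_integral[OF int[of T]] by simp
    then show ?thesis by (simp add: time_mean_def set_lebesgue_integral_def)
  qed
  have meas: "(\<lambda>x. time_mean (F x) T) \<in> borel_measurable M" for T
    unfolding time_mean_def set_lebesgue_integral_def using F' by measurable
  have "((\<lambda>T. LINT x|M. time_mean (F x) T) \<longlongrightarrow> (LINT x|M. 0)) at_top"
  proof (rule integral_dominated_convergence_at_top[where w = "\<lambda>_. 1"])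
    show "\<forall>\<^sub>F T in at_top. AE x in M. norm (time_mean (F x) T) \<le> 1"
      using eventually_gt_at_top[of 0]
    proof eventually_elim
      case (elim T)
      show ?case
      proof (rule AE_I2)
        fix x assume x: "x \<in> space M"
        have "bdd_borel (F x)"
          by (rule bdd_borelI[OF _ bound]) (use measurable_Pair2[OF F x] in simp)
        then show "norm (time_mean (F x) T) \<le> 1" by (rule time_mean_norm_bound) (use elim bound in auto)
      qed
    qed
    show "AE x in M. ((\<lambda>T. time_mean (F x) T) \<longlongrightarrow> 0) at_top"
      using mz by (intro AE_I2) (simp add: mean_zero_def)
  qed (use meas in auto)
  then have "((\<lambda>T. time_mean (\<lambda>t. LINT x|M. F x t) T) \<longlongrightarrow> 0) at_top"
    by (simp add: fub)
  then show ?thesis by (simp add: mean_zero_def)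
qed

section \<open>Resonance produces observables that are not Benford\<close>

text \<open>The frequencies, with multiplicity, of the \<open>k\<close>-th power of the sum of the exponentials with
  frequencies \<open>ds\<close>.\<close>

fun freq_power :: "real list \<Rightarrow> nat \<Rightarrow> real list" where
  "freq_power ds 0 = [0]"
| "freq_power ds (Suc k) = concat (map (\<lambda>d. map (\<lambda>x. x + d) (freq_power ds k)) ds)"

lemma sum_list_cis_shift:
  "(\<Sum>x\<leftarrow>map (\<lambda>x. x + d) xs. cis (x * t)) = cis (d * t) * (\<Sum>x\<leftarrow>xs. cis (x * t))"
  by (induction xs) (auto simp: distrib_left distrib_right cis_mult add.commute)

lemma sum_list_cis_concat:
  "(\<Sum>x\<leftarrow>concat (map (\<lambda>d. map (\<lambda>x. x + d) xs) ds). cis (x * t)) = (\<Sum>d\<leftarrow>ds. cis (d * t)) * (\<Sum>x\<leftarrow>xs. cis (x * t))"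
proof (induction ds)
  case (Cons d ds)
  then show ?case
    by (simp only: list.map concat.simps map_append sum_list.append sum_list.Cons sum_list_cis_shift distrib_right)
qed simp

lemma sum_list_freq_power: "(\<Sum>x\<leftarrow>freq_power ds k. cis (x * t)) = (\<Sum>d\<leftarrow>ds. cis (d * t)) ^ k"
  by (induction k) (simp_all only: freq_power.simps sum_list_cis_concat, simp_all)

lemma set_freq_power_Suc: "set (freq_power ds (Suc k)) = {x + d | x d. x \<in> set (freq_power ds k) \<and> d \<in> set ds}"
  by auto

lemma freq_power_add:
  "x \<in> set (freq_power ds k) \<Longrightarrow> y \<in> set (freq_power ds l) \<Longrightarrow> x + y \<in> set (freq_power ds (k + l))"
proof (induction l arbitrary: y)
  case (Suc l)
  then obtain y' d where "y = y' + d" "y' \<in> set (freq_power ds l)" "d \<in> set ds"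
    unfolding set_freq_power_Suc by blast
  then have "x + y = (x + y') + d" "x + y' \<in> set (freq_power ds (k + l))"
    using Suc.IH[OF Suc.prems(1), of y'] by auto
  then show ?case unfolding add_Suc_right set_freq_power_Suc using \<open>d \<in> set ds\<close> by blast
qed simp

lemma freq_power_uminus:
  assumes "\<And>d. d \<in> set ds \<Longrightarrow> - d \<in> set ds"
  shows "x \<in> set (freq_power ds k) \<Longrightarrow> - x \<in> set (freq_power ds k)"
proof (induction k arbitrary: x)
  case (Suc k)
  then obtain x' d where x: "x = x' + d" "x' \<in> set (freq_power ds k)" "d \<in> set ds"
    unfolding set_freq_power_Suc by blast
  then have "- x = - x' + - d" "- x' \<in> set (freq_power ds k)" "- d \<in> set ds"
    using Suc.IH assms by auto
  then show ?case unfolding set_freq_power_Suc by blast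
qed simp

lemma freq_power_multiple:
  "x \<in> set (freq_power ds k) \<Longrightarrow> real n * x \<in> set (freq_power ds (n * k))"
proof (induction n)
  case (Suc n)
  then have "x + real n * x \<in> set (freq_power ds (k + n * k))" by (intro freq_power_add) auto
  then show ?case by (simp add: distrib_right)
qed simp

lemma freq_power_int_multiple:
  assumes "\<And>d. d \<in> set ds \<Longrightarrow> - d \<in> set ds" "x \<in> set (freq_power ds k)"
  shows "\<exists>l. of_int m * x \<in> set (freq_power ds l)"
proof (cases "m \<ge> 0")
  case True
  then have "of_int m * x = real (nat m) * x" by simp
  then have "of_int m * x \<in> set (freq_power ds (nat m * k))"
    using freq_power_multiple[OF assms(2), of "nat m"] by (simp only:)
  then show ?thesis by blast
next
  case False
  then have "of_int m * x = - (real (nat (- m)) * x)" by simp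
  then have "of_int m * x \<in> set (freq_power ds (nat (- m) * k))"
    using freq_power_uminus[OF assms(1) freq_power_multiple[OF assms(2), of "nat (- m)"]] by (simp only:)
  then show ?thesis by blast
qed

text \<open>Clearing denominators turns membership in the rational span into an integral relation.\<close>

lemma freq_span_integral_relation:
  assumes ds: "set ds = {Im z - Im w | z w. z \<in> \<sigma> \<and> w \<in> \<sigma> \<and> Re z = \<rho> \<and> Re w = \<rho>}"
    and x: "x \<in> freq_span \<sigma> \<rho>"
  shows "\<exists>N k. \<exists>y\<in>set (freq_power ds k). N > 0 \<and> x = of_real (y / (2 * pi * real N))"
proof -
  have neg: "- d \<in> set ds" if "d \<in> set ds" for d using that unfolding ds by force
  let ?R = "\<lambda>x. \<exists>N k. \<exists>y\<in>set (freq_power ds k). N > 0 \<and> x = complex_of_real (y / (2 * pi * real N))"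
  show ?thesis
    using x unfolding freq_span_def rat_span_eq
  proof (induction rule: rat_complex.span_induct)
    case base
    show ?case
    proof (rule rat_complex.subspaceI, unfold mem_Collect_eq)
      show "?R 0"
        by (rule exI[of _ 1], rule exI[of _ 0]) simp
    next
      fix x x' :: complex
      assume "?R x"
        "?R x'"
      then obtain N k y N' k' y' where y: "y \<in> set (freq_power ds k)" "N > 0" "x = of_real (y / (2 * pi * real N))"
        and y': "y' \<in> set (freq_power ds k')" "N' > 0" "x' = of_real (y' / (2 * pi * real N'))" by blast
      have "real N' * y + real N * y' \<in> set (freq_power ds (N' * k + N * k'))"
        by (intro freq_power_add freq_power_multiple y y')
      moreover have "y / (p * a) + y' / (p * a') = (a' * y + a * y') / (p * (a * a'))"
        if "p \<noteq> 0" "a \<noteq> 0" "a' \<noteq> 0" for p a a' :: real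
        using that by (simp add: divide_simps)
      from this[of "2 * pi" "real N" "real N'"]
      have "y / (2 * pi * real N) + y' / (2 * pi * real N') = (real N' * y + real N * y') / (2 * pi * real (N * N'))"
        using y(2) y'(2) by simp
      then have "x + x' = of_real ((real N' * y + real N * y') / (2 * pi * real (N * N')))"
        unfolding y(3) y'(3) of_real_add[symmetric] by (rule arg_cong)
      ultimately show "?R (x + x')"
        using y(2) y'(2) by (metis nat_0_less_mult_iff)
    next
      fix q :: rat and x :: complex
      assume "?R x"
      then obtain N k y where y: "y \<in> set (freq_power ds k)" "N > 0" "x = of_real (y / (2 * pi * real N))" by blast
      obtain m d where q: "q = Fract m d" "d > 0" using Rat_cases by blast
      obtain l where l: "of_int m * y \<in> set (freq_power ds l)"
        using freq_power_int_multiple[OF neg y(1)] by blast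
      have "complex_of_rat q = of_real (of_int m / of_int d)"
        using q by (simp add: of_rat_rat)
      moreover have "of_int m / of_int d * (y / (2 * pi * real N)) = of_int m * y / (2 * pi * real (N * nat d))"
        using q(2) by (simp add: mult_ac)
      ultimately have "of_rat q * x = of_real (of_int m * y / (2 * pi * real (N * nat d)))"
        unfolding y(3) by (simp only: of_real_mult[symmetric])
      moreover have "N * nat d > 0" using y(2) q(2) by simp
      ultimately show "?R (of_rat q * x)"
        using l by blast
    qed
  next
    case (step x)
    then obtain z w where zw: "x = of_real ((Im z - Im w) / (2 * pi))" "z \<in> \<sigma>" "w \<in> \<sigma>" "Re z = \<rho>" "Re w = \<rho>" by blast
    then have "Im z - Im w \<in> set ds" unfolding ds by blast
    then have "Im z - Im w \<in> set (freq_power ds 1)" by simp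
    then show ?case using zw(1) by (intro exI[of _ 1] exI[of _ 1] bexI[of _ "Im z - Im w"]) auto
  qed
qed

lemma time_mean_cis_list:
  "((\<lambda>T. time_mean (\<lambda>t. cis (\<Omega> * t) * (\<Sum>x\<leftarrow>xs. cis (x * t))) T) \<longlongrightarrow> of_nat (count_list xs (- \<Omega>))) at_top"
proof (induction xs)
  case (Cons a xs)
  have "bdd_borel (\<lambda>t. \<Sum>x\<leftarrow>xs. cis (x * t))"
    by (induction xs) (auto intro!: bdd_borel_intros bdd_borel_cis)
  then have bdd: "bdd_borel (\<lambda>t. cis (\<Omega> * t) * (\<Sum>x\<leftarrow>xs. cis (x * t)))"
    by (intro bdd_borel_mult bdd_borel_cis) auto
  have eq: "cis (\<Omega> * t) * (\<Sum>x\<leftarrow>a # xs. cis (x * t)) = cis ((\<Omega> + a) * t) + cis (\<Omega> * t) * (\<Sum>x\<leftarrow>xs. cis (x * t))" for t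
    by (simp add: distrib_left distrib_right cis_mult)
  have "((\<lambda>T. time_mean (\<lambda>t. cis ((\<Omega> + a) * t)) T + time_mean (\<lambda>t. cis (\<Omega> * t) * (\<Sum>x\<leftarrow>xs. cis (x * t))) T)
      \<longlongrightarrow> (if \<Omega> + a = 0 then 1 else 0) + of_nat (count_list xs (- \<Omega>))) at_top"
    by (intro tendsto_add time_mean_cis Cons.IH)
  moreover have "(if \<Omega> + a = 0 then 1 else 0) + complex_of_nat (count_list xs (- \<Omega>)) = of_nat (count_list (a # xs) (- \<Omega>))"
    by (auto simp: add_eq_0_iff)
  ultimately show ?case
    unfolding eq using bdd by (subst time_mean_add) (auto intro!: bdd_borel_cis)
qed simp

text \<open>The function is \<open>(1 + y) powr (i \<gamma>)\<close>, so this is the tail estimate of the binomial series.\<close>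

lemma cis_ln_Taylor:
  "\<exists>C\<ge>0. \<forall>y\<in>{0..1/2}. norm (cis (\<gamma> * ln (1 + y)) - (\<Sum>k\<le>n. ((\<i> * of_real \<gamma>) gchoose k) * of_real y ^ k)) \<le> C * y ^ Suc n"
proof -
  define a where "a k = ((\<i> * of_real \<gamma>) gchoose k)" for k
  have sums: "(\<lambda>k. a k * of_real y ^ k) sums cis (\<gamma> * ln (1 + y))" if "y \<in> {0..<1}" for y :: real
  proof -
    have "(\<lambda>k. a k * of_real y ^ k) sums (1 + of_real y) powr (\<i> * of_real \<gamma>)"
      unfolding a_def by (rule gen_binomial_complex) (use that in auto)
    moreover have "(1 + of_real y) powr (\<i> * of_real \<gamma>) = cis (\<gamma> * ln (1 + y))"
    proof -
      have pos: "1 + y > 0" using that by simp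
      have "(1 + complex_of_real y) = of_real (1 + y)" by simp
      moreover have "Ln (complex_of_real (1 + y)) = of_real (ln (1 + y))" by (rule Ln_of_real) (rule pos)
      moreover have "complex_of_real (1 + y) \<noteq> 0" using pos of_real_eq_0_iff by (metis less_irrefl)
      ultimately show ?thesis unfolding powr_def by (simp add: cis_conv_exp mult.assoc)
    qed
    ultimately show ?thesis by simp
  qed
  have "summable (\<lambda>k. norm (a k * (1/2) ^ k))"
    by (rule powser_insidea[of a "of_real (3/4)"]) (use sums[of "3/4"] in \<open>auto simp: sums_iff\<close>)
  then have sm: "summable (\<lambda>k. norm (a (k + Suc n)) * (1/2) ^ (k + Suc n))"
    using summable_ignore_initial_segment[of "\<lambda>k. norm (a k) * (1/2) ^ k" "Suc n"] by (simp add: norm_mult norm_power)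
  define C where "C = (\<Sum>k. norm (a (k + Suc n)) * (1/2) ^ (k + Suc n)) * 2 ^ Suc n"
  have "C \<ge> 0" unfolding C_def by (intro mult_nonneg_nonneg suminf_nonneg sm) auto
  moreover have "norm (cis (\<gamma> * ln (1 + y)) - (\<Sum>k\<le>n. a k * of_real y ^ k)) \<le> C * y ^ Suc n" if y: "y \<in> {0..1/2}" for y
  proof -
    have s: "(\<lambda>k. a k * of_real y ^ k) sums cis (\<gamma> * ln (1 + y))" using y by (intro sums) auto
    have tail: "(\<lambda>k. a (k + Suc n) * of_real y ^ (k + Suc n)) sums (cis (\<gamma> * ln (1 + y)) - (\<Sum>k<Suc n. a k * of_real y ^ k))"
      using sums_split_initial_segment[OF s, of "Suc n"] .
    have le: "norm (a (k + Suc n) * of_real y ^ (k + Suc n)) \<le> norm (a (k + Suc n)) * (1/2) ^ (k + Suc n) * (2 ^ Suc n * y ^ Suc n)" for k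
    proof -
      have "y ^ k \<le> (1/2) ^ k" using y by (intro power_mono) auto
      then have le: "norm (a (k + Suc n)) * (y ^ k * y ^ Suc n) \<le> norm (a (k + Suc n)) * ((1/2) ^ k * y ^ Suc n)"
        using y by (intro mult_left_mono mult_right_mono) auto
      have half: "(1/2 :: real) ^ k = (1/2) ^ (k + Suc n) * 2 ^ Suc n" by (simp add: power_add power_one_over)
      have "norm (a (k + Suc n) * of_real y ^ (k + Suc n)) = norm (a (k + Suc n)) * y ^ (k + Suc n)"
        using y by (simp only: norm_mult norm_power norm_of_real atLeastAtMost_iff abs_of_nonneg)
      also have "y ^ (k + Suc n) = y ^ k * y ^ Suc n" by (rule power_add)
      finally show ?thesis using le unfolding half by (simp only: mult.assoc)
    qed
    have sm': "summable (\<lambda>k. norm (a (k + Suc n)) * (1/2) ^ (k + Suc n) * (2 ^ Suc n * y ^ Suc n))"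
      by (rule summable_mult2[OF sm])
    have "norm (cis (\<gamma> * ln (1 + y)) - (\<Sum>k<Suc n. a k * of_real y ^ k)) \<le> (\<Sum>k. norm (a (k + Suc n)) * (1/2) ^ (k + Suc n) * (2 ^ Suc n * y ^ Suc n))"
      unfolding sums_unique[OF tail] by (rule norm_suminf_le[OF le sm'])
    also have "\<dots> = C * y ^ Suc n" unfolding C_def by (subst suminf_mult2[OF sm, symmetric]) (simp add: mult.assoc)
    finally show ?thesis by (simp only: lessThan_Suc_atMost)
  qed
  ultimately show ?thesis unfolding a_def by blast
qed

lemma gbinomial_imaginary_nonzero:
  assumes "\<gamma> \<noteq> 0" shows "((\<i> * complex_of_real \<gamma>) gchoose k) \<noteq> 0"
proof -
  have "\<i> * complex_of_real \<gamma> - of_nat i \<noteq> 0" for i using assms by (auto simp: complex_eq_iff)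
  then show ?thesis using assms by (simp add: gbinomial_prod_rev)
qed

text \<open>Suppose that the integral relation \<open>rel\<close> holds and that all observables are Benford. Then, with \<open>\<beta>\<close> as
  below, \<open>cis (\<Omega> t) * \<bar>p t\<bar> powr (i \<beta>)\<close> has vanishing mean for every real trigonometric sum \<open>p\<close> with
  frequencies in \<open>W\<close>. The zeros of \<open>p\<close> make this function hard to analyse for a single \<open>p\<close>. Averaging over
  independent normal coefficients of \<open>cos (\<omega>\<^sub>0 t)\<close>, \<open>sin (\<omega>\<^sub>0 t)\<close> and \<open>sqrt x * Q t\<close> replaces \<open>\<bar>p t\<bar>\<close> by
  \<open>sqrt (1 + x (Q t)\<^sup>2)\<close>, up to a nonzero constant, and this is bounded away from zero. Expanding in powers of
  \<open>x\<close>, the mean of every \<open>cis (\<Omega> t) * (Q t) ^ (2 k)\<close> must vanish, since no binomial coefficient of an imaginary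
  exponent is zero. But \<open>(Q t) ^ (2 k)\<close> is a sum of exponentials with positive coefficients, and for \<open>k = K\<close>
  the frequency \<open>- \<Omega>\<close> occurs among them.\<close>

theorem resonance_not_all_benford:
  fixes W :: "real set"
  assumes b: "b \<ge> 2" and W: "finite W" "W \<noteq> {}" and sym: "\<And>\<omega>. \<omega> \<in> W \<Longrightarrow> - \<omega> \<in> W"
    and ds: "set ds = {\<omega> - \<omega>' | \<omega> \<omega>'. \<omega> \<in> W \<and> \<omega>' \<in> W}"
    and rel: "N > 0" "\<Omega> \<in> set (freq_power ds K)" "2 * pi * real N / ln b * \<rho> = \<Omega>"
    and obs: "\<And>a :: real \<Rightarrow> complex. benford b (\<lambda>t. exp (\<rho> * t) * Re (\<Sum>\<omega>\<in>W. a \<omega> * cis (\<omega> * t))) \<or>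
      (\<forall>t. exp (\<rho> * t) * Re (\<Sum>\<omega>\<in>W. a \<omega> * cis (\<omega> * t)) = 0)"
  shows False
proof -
  define \<beta> where "\<beta> = 2 * pi * real N / ln b"
  have \<beta>: "\<beta> \<noteq> 0" using b rel(1) by (simp add: \<beta>_def)
  obtain \<omega>\<^sub>0 where \<omega>\<^sub>0: "\<omega>\<^sub>0 \<in> W" using W by blast
  define Q where "Q t = (\<Sum>\<omega>\<in>W. cos (\<omega> * t))" for t
  have mQ [measurable]: "Q \<in> borel_measurable borel" unfolding Q_def by measurable
  define B where "B = real (card W)"
  have QB: "\<bar>Q t\<bar> \<le> B" for t
  proof -
    have "\<bar>Q t\<bar> \<le> (\<Sum>\<omega>\<in>W. \<bar>cos (\<omega> * t)\<bar>)" unfolding Q_def by (rule sum_abs)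
    also have "\<dots> \<le> (\<Sum>\<omega>\<in>W. 1)" by (intro sum_mono abs_cos_le_one)
    finally show ?thesis by (simp add: B_def)
  qed
  have Q_cis: "complex_of_real (Q t) = (\<Sum>\<omega>\<in>W. cis (\<omega> * t))" for t
  proof -
    have "(\<Sum>\<omega>\<in>W. sin (\<omega> * t)) = (\<Sum>\<omega>\<in>W. sin (- \<omega> * t))"
      by (rule sum.reindex_bij_witness[of _ uminus uminus]) (use sym in auto)
    then have "(\<Sum>\<omega>\<in>W. sin (\<omega> * t)) = 0" by (simp add: sum_negf)
    then show ?thesis by (simp add: complex_eq_iff Q_def)
  qed
  obtain ws where ws: "set ws = W" "distinct ws" using finite_distinct_list[OF W(1)] by blast
  define es where "es = map (\<lambda>(x, y). x - y) (List.product ws ws)"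
  have set_es: "set es = set ds" unfolding es_def ds using ws by force
  have fp_set: "set (freq_power es k) = set (freq_power ds k)" for k
    by (induction k) (simp_all only: set_freq_power_Suc set_es, simp)
  have Q2: "complex_of_real ((Q t)\<^sup>2) = (\<Sum>d\<leftarrow>es. cis (d * t))" for t
  proof -
    have "complex_of_real ((Q t)\<^sup>2) = complex_of_real (Q t) * cnj (complex_of_real (Q t))"
      by (simp add: power2_eq_square)
    also have "\<dots> = (\<Sum>x\<in>W. \<Sum>y\<in>W. cis ((x - y) * t))"
      unfolding Q_cis cnj_sum sum_product
      by (intro sum.cong refl) (simp add: left_diff_distrib cis_divide[symmetric] cis_cnj divide_inverse)
    also have "\<dots> = (\<Sum>p\<in>set (List.product ws ws). cis ((fst p - snd p) * t))"
      by (simp add: sum.cartesian_product ws case_prod_beta)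
    also have "\<dots> = (\<Sum>p\<leftarrow>List.product ws ws. cis ((fst p - snd p) * t))"
      by (rule sum_list_distinct_conv_sum_set[symmetric]) (simp add: distinct_product ws)
    finally show ?thesis by (simp add: es_def o_def case_prod_beta)
  qed
  have neg: "- \<Omega> \<in> set (freq_power es K)"
    unfolding fp_set by (rule freq_power_uminus[OF _ rel(2)]) (unfold ds, force)

  have avg: "mean_zero (\<lambda>t. cis (\<Omega> * t) * cis (\<beta> / 2 * ln (1 + x * (Q t)\<^sup>2)))" if x: "x \<ge> 0" for x
  proof -
    define p where "p t i = (if i = 0 then cos (\<omega>\<^sub>0 * t) else if i = 1 then sin (\<omega>\<^sub>0 * t) else sqrt x * Q t)" for t and i :: nat
    define M where "M = PiM {..<3::nat} (\<lambda>_. std_normal)"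
    have M: "prob_space M" unfolding M_def by (rule prob_space_PiM) (rule prob_space_std_normal)
    define F where "F v t = cis (\<Omega> * t) * log_char \<beta> (\<Sum>i<3. p t i * v i)" for v t
    have three: "(\<Sum>i<3. g i) = g 0 + g 1 + g 2" for g :: "nat \<Rightarrow> real" by (simp add: eval_nat_numeral)
    have "mean_zero (\<lambda>t. LINT v|M. F v t)"
    proof (rule mean_zero_expectation[OF M])
      have comp: "(\<lambda>v. v i) \<in> borel_measurable M" if "i < 3" for i
        unfolding M_def using measurable_component_singleton[of i "{..<3}" "\<lambda>_. std_normal"] that
        by (simp cong: measurable_cong_sets)
      have [measurable]: "(\<lambda>v. v (0::nat)) \<in> borel_measurable M" "(\<lambda>v. v (1::nat)) \<in> borel_measurable M"
        "(\<lambda>v. v (2::nat)) \<in> borel_measurable M" by (rule comp, simp)+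
      have "(\<lambda>(v, t). cis (\<Omega> * t) * log_char \<beta> (cos (\<omega>\<^sub>0 * t) * v 0 + sin (\<omega>\<^sub>0 * t) * v 1 + sqrt x * Q t * v 2)) \<in> borel_measurable (M \<Otimes>\<^sub>M borel)"
        by measurable
      then show "(\<lambda>(v, t). F v t) \<in> borel_measurable (M \<Otimes>\<^sub>M borel)" by (simp add: F_def three p_def)
      show "norm (F v t) \<le> 1" for v t by (simp add: F_def norm_mult norm_log_char_le)
      fix v :: "nat \<Rightarrow> real"
      define a where "a \<omega> = (if \<omega> = \<omega>\<^sub>0 then of_real (v 0) - \<i> * of_real (v 1) else 0) + complex_of_real (sqrt x * v 2)" for \<omega>
      have pa: "(\<Sum>i<3. p t i * v i) = Re (\<Sum>\<omega>\<in>W. a \<omega> * cis (\<omega> * t))" for t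
      proof -
        have "(\<Sum>\<omega>\<in>W. a \<omega> * cis (\<omega> * t)) = (\<Sum>\<omega>\<in>W. if \<omega> = \<omega>\<^sub>0 then (of_real (v 0) - \<i> * of_real (v 1)) * cis (\<omega>\<^sub>0 * t) else 0)
            + (\<Sum>\<omega>\<in>W. complex_of_real (sqrt x * v 2) * cis (\<omega> * t))"
          unfolding sum.distrib[symmetric] by (rule sum.cong) (auto simp: a_def distrib_right)
        also have "\<dots> = (of_real (v 0) - \<i> * of_real (v 1)) * cis (\<omega>\<^sub>0 * t) + complex_of_real (sqrt x * v 2) * complex_of_real (Q t)"
          using W(1) \<omega>\<^sub>0 by (simp add: Q_cis sum_distrib_left)
        finally show ?thesis by (simp add: three p_def mult_ac)
      qed
      define f where "f t = exp (\<rho> * t) * (\<Sum>i<3. p t i * v i)" for t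
      have "(\<lambda>t. exp (\<rho> * t) * (cos (\<omega>\<^sub>0 * t) * v 0 + sin (\<omega>\<^sub>0 * t) * v 1 + sqrt x * Q t * v 2)) \<in> borel_measurable borel"
        by measurable
      then have mf: "f \<in> borel_measurable borel" by (simp add: f_def[abs_def] three p_def)
      have Ff: "F v t = log_char \<beta> (f t)" for t
        using rel(3) by (simp add: F_def f_def log_char_mult \<beta>_def mult.assoc[symmetric])
      have "benford b f \<or> (\<forall>t. f t = 0)" using obs[of a] by (simp add: f_def[abs_def] pa)
      then show "mean_zero (F v)"
      proof
        assume "benford b f"
        from benford_imp_mean_zero_log_char[OF b mf this rel(1)]
        show ?thesis by (simp add: Ff[abs_def] \<beta>_def)
      next
        assume "\<forall>t. f t = 0"
        then have "F v = (\<lambda>t. 0)" by (simp add: Ff fun_eq_iff log_char_def)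
        moreover have "time_mean (\<lambda>t. 0 :: complex) = (\<lambda>T. 0)" by (rule ext) simp
        ultimately show ?thesis by (simp add: mean_zero_def)
      qed
    qed
    moreover have "(LINT v|M. F v t) = gauss_char_mean \<beta> * (cis (\<Omega> * t) * cis (\<beta> / 2 * ln (1 + x * (Q t)\<^sup>2)))" for t
    proof -
      have "(\<Sum>i<3. (p t i)\<^sup>2) = 1 + x * (Q t)\<^sup>2"
        using x by (simp add: three p_def power_mult_distrib)
      moreover have "1 + x * (Q t)\<^sup>2 > 0" using x by (intro add_pos_nonneg) auto
      ultimately have "(LINT v|M. log_char \<beta> (\<Sum>i<3. p t i * v i)) = cis (\<beta> / 2 * ln (1 + x * (Q t)\<^sup>2)) * gauss_char_mean \<beta>"
        unfolding M_def using expectation_log_char_gauss[of "{..<3}" "p t" \<beta>] by simp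
      moreover have "(LINT v|M. F v t) = cis (\<Omega> * t) * (LINT v|M. log_char \<beta> (\<Sum>i<3. p t i * v i))"
        unfolding F_def by (rule integral_mult_right_zero)
      ultimately show ?thesis by (simp only: mult_ac)
    qed
    ultimately have "mean_zero (\<lambda>t. gauss_char_mean \<beta> * (cis (\<Omega> * t) * cis (\<beta> / 2 * ln (1 + x * (Q t)\<^sup>2))))" by simp
    from mean_zero_mult_left[OF this, of "1 / gauss_char_mean \<beta>"] show ?thesis
      using gauss_char_mean_nonzero[of \<beta>] by simp
  qed

  \<comment> \<open>\<open>m k\<close> is the mean of \<open>cis (\<Omega> t) * (Q t) ^ (2 k)\<close>; only the first nonzero one is compared, so that a
    finite Taylor expansion suffices\<close>
  define m where "m k = count_list (freq_power es k) (- \<Omega>)" for k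
  have "m K \<noteq> 0" using neg by (simp add: m_def count_list_0_iff)
  define k0 where "k0 = (LEAST k. m k \<noteq> 0)"
  have k0: "m k0 \<noteq> 0" unfolding k0_def by (rule LeastI[of "\<lambda>k. m k \<noteq> 0"]) fact
  have below: "m k = 0" if "k < k0" for k
    using not_less_Least[of k "\<lambda>k. m k \<noteq> 0"] that unfolding k0_def by blast
  have lim: "((\<lambda>T. time_mean (\<lambda>t. cis (\<Omega> * t) * of_real ((Q t)\<^sup>2) ^ k) T) \<longlongrightarrow> of_nat (m k)) at_top" for k
    unfolding Q2 sum_list_freq_power[symmetric] m_def by (rule time_mean_cis_list)
  define c where "c k = ((\<i> * of_real (\<beta> / 2)) gchoose k)" for k
  have c0: "c k0 * of_nat (m k0) \<noteq> 0"
    using gbinomial_imaginary_nonzero[of "\<beta> / 2" k0] \<beta> k0 by (simp add: c_def)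
  obtain C where C: "C \<ge> 0" "\<And>y. y \<in> {0..1/2} \<Longrightarrow> norm (cis (\<beta> / 2 * ln (1 + y)) - (\<Sum>k\<le>k0. c k * of_real y ^ k)) \<le> C * y ^ Suc k0"
    using cis_ln_Taylor[of "\<beta> / 2" k0] unfolding c_def by blast
  have key: "norm (c k0 * of_nat (m k0)) \<le> C * (B\<^sup>2) ^ Suc k0 * x" if x: "x > 0" "x * B\<^sup>2 \<le> 1 / 2" for x
  proof -
    define H where "H t = cis (\<Omega> * t) * cis (\<beta> / 2 * ln (1 + x * (Q t)\<^sup>2))" for t
    define S where "S t = (\<Sum>k\<le>k0. c k * of_real x ^ k * (cis (\<Omega> * t) * of_real ((Q t)\<^sup>2) ^ k))" for t
    have bQ: "bdd_borel (\<lambda>t. complex_of_real ((Q t)\<^sup>2))"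
    proof (rule bdd_borelI)
      show "norm (complex_of_real ((Q t)\<^sup>2)) \<le> B\<^sup>2" for t
        using power_mono[OF QB[of t], of 2] by (simp only: norm_of_real power2_abs abs_power2)
    qed measurable
    have bH: "bdd_borel H" unfolding H_def by (intro bdd_borel_mult bdd_borel_cis) measurable
    have bS1: "bdd_borel (\<lambda>t. cis (\<Omega> * t) * of_real ((Q t)\<^sup>2) ^ k)" for k
      by (intro bdd_borel_mult bdd_borel_cis bdd_borel_power bQ) measurable
    have bS: "bdd_borel S" unfolding S_def by (intro bdd_borel_sum bdd_borel_mult bdd_borel_const bS1)
    have HS: "norm (H t - S t) \<le> C * (x * B\<^sup>2) ^ Suc k0" for t
    proof -
      define y where "y = x * (Q t)\<^sup>2"
      have "(Q t)\<^sup>2 \<le> B\<^sup>2" using power_mono[OF QB[of t], of 2] by simp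
      then have yB: "y \<le> x * B\<^sup>2" using x(1) by (simp add: y_def)
      moreover have "0 \<le> y" using x(1) by (simp add: y_def)
      ultimately have y: "y \<in> {0..1/2}" using x(2) by simp
      have "S t = cis (\<Omega> * t) * (\<Sum>k\<le>k0. c k * of_real y ^ k)"
        unfolding S_def sum_distrib_left y_def of_real_mult power_mult_distrib by (intro sum.cong refl) (simp only: mult_ac)
      then have "H t - S t = cis (\<Omega> * t) * (cis (\<beta> / 2 * ln (1 + y)) - (\<Sum>k\<le>k0. c k * of_real y ^ k))"
        by (simp add: H_def y_def right_diff_distrib)
      then have "norm (H t - S t) \<le> C * y ^ Suc k0" using C(2)[OF y] by (simp only: norm_mult norm_cis mult_1)
      also have "\<dots> \<le> C * (x * B\<^sup>2) ^ Suc k0" using y yB C(1) by (intro mult_left_mono power_mono) auto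
      finally show ?thesis .
    qed
    have "((\<lambda>T. time_mean H T) \<longlongrightarrow> 0) at_top"
      using avg[of x] x unfolding H_def mean_zero_def by simp
    moreover have "((\<lambda>T. time_mean S T) \<longlongrightarrow> (\<Sum>k\<le>k0. c k * of_real x ^ k * of_nat (m k))) at_top"
    proof -
      have "time_mean S T = (\<Sum>k\<le>k0. c k * of_real x ^ k * time_mean (\<lambda>t. cis (\<Omega> * t) * of_real ((Q t)\<^sup>2) ^ k) T)" for T
        unfolding S_def by (subst time_mean_sum) (intro bdd_borel_mult bdd_borel_const bS1, simp only: time_mean_mult_left)
      then show ?thesis by (simp only:) (intro tendsto_sum tendsto_mult tendsto_const lim)
    qed
    ultimately have "((\<lambda>T. norm (time_mean H T - time_mean S T)) \<longlongrightarrow> norm (0 - (\<Sum>k\<le>k0. c k * of_real x ^ k * of_nat (m k)))) at_top"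
      by (intro tendsto_norm tendsto_diff)
    moreover have "\<forall>\<^sub>F T in at_top. norm (time_mean H T - time_mean S T) \<le> C * (x * B\<^sup>2) ^ Suc k0"
      using eventually_gt_at_top[of 0]
    proof eventually_elim
      case (elim T)
      show ?case
        unfolding time_mean_diff[OF bH bS, symmetric]
        by (rule time_mean_norm_bound) (use bdd_borel_diff[OF bH bS] elim HS in auto)
    qed
    ultimately have "norm (0 - (\<Sum>k\<le>k0. c k * of_real x ^ k * of_nat (m k))) \<le> C * (x * B\<^sup>2) ^ Suc k0"
      by (rule tendsto_upperbound) simp
    moreover have "(\<Sum>k\<le>k0. c k * of_real x ^ k * of_nat (m k)) = c k0 * of_real x ^ k0 * of_nat (m k0)"
      using below by (simp add: lessThan_Suc_atMost[symmetric])
    ultimately have "norm (c k0 * of_nat (m k0)) * x ^ k0 \<le> C * (B\<^sup>2) ^ Suc k0 * x * x ^ k0"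
      using x(1) by (simp add: norm_mult norm_power power_mult_distrib mult_ac)
    then show ?thesis using x(1) by (rule mult_right_le_imp_le[OF _ zero_less_power])
  qed
  have "((\<lambda>x. C * (B\<^sup>2) ^ Suc k0 * x) \<longlongrightarrow> C * (B\<^sup>2) ^ Suc k0 * 0) (at_right 0)"
    by (intro tendsto_intros)
  moreover have "\<forall>\<^sub>F x in at_right 0. norm (c k0 * of_nat (m k0)) \<le> C * (B\<^sup>2) ^ Suc k0 * x"
  proof -
    have "((\<lambda>x. x * B\<^sup>2) \<longlongrightarrow> 0 * B\<^sup>2) (at_right 0)" by (intro tendsto_intros)
    then have "\<forall>\<^sub>F x in at_right 0. x * B\<^sup>2 < 1 / 2" by (intro order_tendstoD(2)) auto
    then show ?thesis using eventually_at_right_less[of "0::real"]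
    proof eventually_elim
      case (elim x)
      then show ?case by (intro key) auto
    qed
  qed
  ultimately have "norm (c k0 * of_nat (m k0)) \<le> C * (B\<^sup>2) ^ Suc k0 * 0"
    by (rule tendsto_lowerbound) simp
  then show False using c0 by simp
qed

section \<open>The equivalence\<close>

lemma growth_independent_imp_observables_benford:
  fixes \<phi> :: "real \<Rightarrow> real ^ 'n \<Rightarrow> real ^ 'n" and H :: "((real ^ 'n) \<Rightarrow>\<^sub>L (real ^ 'n)) \<Rightarrow> real"
  assumes b: "b \<ge> 2" and \<phi>: "linear_flow \<phi>" and ind: "growth_independent b (flow_spectrum \<phi>)" and H: "linear H"
  shows "benford b (\<lambda>t. H (flow_map \<phi> t)) \<or> (\<forall>t. H (flow_map \<phi> t) = 0)"
proof -
  obtain P where P: "\<And>t. complex_of_real (H (flow_map \<phi> t)) = exp_poly (flow_spectrum \<phi>) P t"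
    using flow_observable_exp_poly[OF \<phi> H] by (auto simp: is_exp_poly_def)
  show ?thesis
  proof (cases "\<exists>z\<in>flow_spectrum \<phi>. P z \<noteq> 0")
    case True
    have "continuous_on UNIV (\<lambda>t. Re (exp_poly (flow_spectrum \<phi>) P t))"
      unfolding exp_poly_def by (intro continuous_intros)
    moreover have "H (flow_map \<phi> t) = Re (exp_poly (flow_spectrum \<phi>) P t)" for t
      using P[of t] by (metis Re_complex_of_real)
    ultimately have "(\<lambda>t. H (flow_map \<phi> t)) \<in> borel_measurable borel"
      by (simp add: borel_measurable_continuous_onI)
    then show ?thesis using exp_poly_benford[OF b _ finite_flow_spectrum P True ind] by blast
  next
    case False
    then have "complex_of_real (H (flow_map \<phi> t)) = 0" for t unfolding P by (simp add: exp_poly_def)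
    then show ?thesis by simp
  qed
qed

text \<open>The frequencies on the vertical line \<open>Re z = \<rho>\<close> are symmetric about \<open>0\<close> since the flow is real, so a
  rational relation on this line is the resonance excluded above.\<close>

lemma observables_benford_imp_growth_independent:
  fixes \<phi> :: "real \<Rightarrow> real ^ 'n \<Rightarrow> real ^ 'n"
  assumes b: "b \<ge> 2" and \<phi>: "linear_flow \<phi>"
    and obs: "\<And>H :: ((real ^ 'n) \<Rightarrow>\<^sub>L (real ^ 'n)) \<Rightarrow> real. linear H \<Longrightarrow>
      benford b (\<lambda>t. H (flow_map \<phi> t)) \<or> (\<forall>t. H (flow_map \<phi> t) = 0)"
  shows "growth_independent b (flow_spectrum \<phi>)"
  unfolding growth_independent_def
proof (intro ballI notI)
  fix z0 assume z0: "z0 \<in> flow_spectrum \<phi>"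
    and dep: "complex_of_real (Re z0 / ln b) \<in> freq_span (flow_spectrum \<phi>) (Re z0)"
  define \<rho> where "\<rho> = Re z0"
  define Z where "Z = {z \<in> flow_spectrum \<phi>. Re z = \<rho>}"
  have Z: "finite Z" "z0 \<in> Z" using finite_flow_spectrum[of \<phi>] z0 by (auto simp: Z_def \<rho>_def)
  have inj: "inj_on Im Z" by (rule inj_onI) (auto simp: Z_def complex_eq_iff)
  have "finite {Im z - Im w | z w. z \<in> flow_spectrum \<phi> \<and> w \<in> flow_spectrum \<phi> \<and> Re z = \<rho> \<and> Re w = \<rho>}"
  proof (rule finite_subset)
    show "{Im z - Im w | z w. z \<in> flow_spectrum \<phi> \<and> w \<in> flow_spectrum \<phi> \<and> Re z = \<rho> \<and> Re w = \<rho>} \<subseteq>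
        (\<lambda>(z, w). Im z - Im w) ` (Z \<times> Z)" by (auto simp: Z_def)
  qed (use Z in simp)
  from finite_list[OF this] obtain ds where ds: "set ds = {Im z - Im w | z w. z \<in> flow_spectrum \<phi> \<and> w \<in> flow_spectrum \<phi> \<and> Re z = \<rho> \<and> Re w = \<rho>}"
    by blast
  obtain N k y where y: "y \<in> set (freq_power ds k)" "N > 0" "complex_of_real (\<rho> / ln b) = of_real (y / (2 * pi * real N))"
    using freq_span_integral_relation[OF ds] dep unfolding \<rho>_def by blast
  have eq: "\<rho> / ln b = y / (2 * pi * real N)" using y(3) by (simp only: of_real_eq_iff)
  have "2 * pi * real N / ln b * \<rho> = 2 * pi * real N * (\<rho> / ln b)" by simp
  also have "\<dots> = y" unfolding eq using y(2) by simp
  finally have rel: "2 * pi * real N / ln b * \<rho> = y" .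
  show False
  proof (rule resonance_not_all_benford[OF b _ _ _ _ y(2,1) rel])
    show "finite (Im ` Z)" "Im ` Z \<noteq> {}" using Z by auto
    show "- \<omega> \<in> Im ` Z" if "\<omega> \<in> Im ` Z" for \<omega>
    proof -
      obtain z where z: "z \<in> Z" "\<omega> = Im z" using \<open>\<omega> \<in> Im ` Z\<close> by blast
      then have "cnj z \<in> Z" using cnj_mem_flow_spectrum[of z \<phi>] by (simp add: Z_def)
      moreover have "- \<omega> = Im (cnj z)" by (simp add: z(2))
      ultimately show ?thesis by blast
    qed
    show "set ds = {\<omega> - \<omega>' |\<omega> \<omega>'. \<omega> \<in> Im ` Z \<and> \<omega>' \<in> Im ` Z}"
      unfolding ds Z_def by blast
    fix a :: "real \<Rightarrow> complex"
    obtain H :: "((real ^ 'n) \<Rightarrow>\<^sub>L (real ^ 'n)) \<Rightarrow> real"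
      where H: "linear H" "\<And>t. H (flow_map \<phi> t) = Re (\<Sum>z\<in>Z. a (Im z) * exp (z * of_real t))"
      using ex_observable[OF \<phi>, of Z "\<lambda>z. a (Im z)"] by (auto simp: Z_def)
    have "H (flow_map \<phi> t) = exp (\<rho> * t) * Re (\<Sum>\<omega>\<in>Im ` Z. a \<omega> * cis (\<omega> * t))" for t
    proof -
      have "(\<Sum>z\<in>Z. a (Im z) * exp (z * of_real t)) = (\<Sum>z\<in>Z. of_real (exp (\<rho> * t)) * (a (Im z) * cis (Im z * t)))"
        by (intro sum.cong refl) (simp add: exp_eq_polar[of "_ * of_real t"] Z_def mult_ac)
      also have "\<dots> = of_real (exp (\<rho> * t)) * (\<Sum>\<omega>\<in>Im ` Z. a \<omega> * cis (\<omega> * t))"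
        by (simp only: sum_distrib_left sum.reindex[OF inj] o_def)
      finally show ?thesis unfolding H(2) by simp
    qed
    then show "benford b (\<lambda>t. exp (\<rho> * t) * Re (\<Sum>\<omega>\<in>Im ` Z. a \<omega> * cis (\<omega> * t))) \<or>
        (\<forall>t. exp (\<rho> * t) * Re (\<Sum>\<omega>\<in>Im ` Z. a \<omega> * cis (\<omega> * t)) = 0)"
      using obs[OF H(1)] by simp
  qed
qed

theorem theorem3p2:
  fixes b :: nat and \<phi> :: "real \<Rightarrow> real ^ 'n \<Rightarrow> real ^ 'n"
  assumes "b \<ge> 2" and "linear_flow \<phi>"
  shows "exponentially_nonresonant b (flow_spectrum \<phi>) \<longleftrightarrow>
    (\<forall>H :: ((real ^ 'n) \<Rightarrow>\<^sub>L (real ^ 'n)) \<Rightarrow> real. linear H \<longrightarrow>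
       benford b (\<lambda>t. H (flow_map \<phi> t)) \<or> (\<forall>t. H (flow_map \<phi> t) = 0))"
proof
  assume "exponentially_nonresonant b (flow_spectrum \<phi>)"
  then have "growth_independent b (flow_spectrum \<phi>)"
    by (rule nonresonant_imp_growth_independent[OF assms(1)])
  then show "\<forall>H :: ((real ^ 'n) \<Rightarrow>\<^sub>L (real ^ 'n)) \<Rightarrow> real. linear H \<longrightarrow>
       benford b (\<lambda>t. H (flow_map \<phi> t)) \<or> (\<forall>t. H (flow_map \<phi> t) = 0)"
    using growth_independent_imp_observables_benford[OF assms] by blast
next
  assume "\<forall>H :: ((real ^ 'n) \<Rightarrow>\<^sub>L (real ^ 'n)) \<Rightarrow> real. linear H \<longrightarrow>
       benford b (\<lambda>t. H (flow_map \<phi> t)) \<or> (\<forall>t. H (flow_map \<phi> t) = 0)"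
  then have "growth_independent b (flow_spectrum \<phi>)"
    by (intro observables_benford_imp_growth_independent[OF assms]) blast
  then show "exponentially_nonresonant b (flow_spectrum \<phi>)"
    by (rule growth_independent_imp_nonresonant[OF assms(1) finite_flow_spectrum])
qed

end
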